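(* Let $G=(V,E)$ be an infinite connected graph with uniformly bounded degree, and let $(V_x)_{x\in V}$ be functions $\mathbb{R}\to\mathbb{R}$ with $\int_{\mathbb{R}}e^{-V_x(t)}dt=1$ for all $x\in V$, such that: (1) there is a constant $M$ with $\int_{\mathbb{R}}t\,e^{-V_x(t)}dt=M$ for all $x\in V$; (2) $V_x\in C^2$ for all $x\in V$; (3) there are constants $C_+\geqslant C_->0$ with $C_-\leqslant V_x''(t)\leqslant C_+$ for all $x\in V$, $t\in\mathbb{R}$. Let $(P_t)_{t\geqslant 0}$ be the semigroup of the associated Ginzburg-Landau process, $\mathbb{E}$ and $\mathbb{C}ov$ the expectation and covariance under its reversible Gibbs measure $\mu$, and $X$ the associated random walk in the dynamic environment. Then for all $x,y\in V$ and all $t\geqslant 0$: $$\frac{1}{C_+}\,\mathbb{E}\left[\mathbb{P}_x^{\eta}\left(X(t)=y\right)\right]\ \leqslant\ \mathbb{C}ov\left(\eta_x;P_t\eta_y\right)\ \leqslant\ \frac{1}{C_-}\,\mathbb{E}\left[\mathbb{P}_x^{\eta}\left(X(t)=y\right)\right].$$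
   Context: Notation. $x\sim y$ means $\{x,y\}\in E$. Fix an arbitrary orientation of the edges and let $\overrightarrow{B}$ be the resulting set of oriented edges. For $b=(y,z)\in\overrightarrow{B}$, set $sgn_x(b)=-1$ if $y=x$, $sgn_x(b)=1$ if $z=x$, and $sgn_x(b)=0$ otherwise. Environments are $\eta=(\eta_x)_{x\in V}\in\Omega=\mathbb{R}^V$. Write $\partial_x=\partial/\partial\eta_x$, and $\partial_b=\partial_x-\partial_y$ for $b=(x,y)$. The potential is the formal sum $H(\eta)=\sum_{x\in V}V_x(\eta_x)$, so $\partial_xH(\eta)=V_x'(\eta_x)$. Ginzburg-Landau process. $(\eta(t))_{t\geqslant0}$ is the $\Omega$-valued process solving $$d\eta_x(t)=\sum_{b\in\overrightarrow{B}}sgn_x(b)\left(\partial_bH(\eta(t))\,dt+\sqrt2\,dB_b(t)\right),\quad x\in V,$$ where $(B_b)_{b\in\overrightarrow{B}}$ are independent standard Brownian motions. Equivalently its semigroup is $P_t=e^{-t\mathcal{L}_e}$, with $\mathcal{L}_ef=\sum_{b\in\overrightarrow{B}}\left(-\partial_b\partial_bf+\partial_bH\,\partial_bf\right)$ (the positive sign convention for generators); thus $P_tf(\sigma)$ is the expectation of $f(\eta(t))$ given $\eta(0)=\sigma$. The system is considered well defined for these potentials, including on infinite graphs. In $\mathbb{C}ov(\eta_x;P_t\eta_y)$, $\eta_y$ denotes the coordinate function $\eta\mapsto\eta_y$. Reversible measure. $\mu$ is the product measure $\prod_{x\in V}e^{-V_x(\eta_x)}d\eta_x$ on $\Omega$.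 $\mathbb{E}$ is expectation over $\eta\sim\mu$, and $\mathbb{C}ov(f;g)=\mathbb{E}[(f-\mathbb{E}[f])(g-\mathbb{E}[g])]$. Random walk. $(X(t))_{t\geqslant0}$ is the walk on $V$, evolving jointly with the process $(\eta(t))_{t\geqslant 0}$, which at time $t$, when at $x$, jumps to each neighbor $z\sim x$ at rate $V_x''(\eta_x(t))$; the environment evolves autonomously as the Ginzburg-Landau process. $\mathbb{P}_x^{\sigma}$ is the joint law of walk and environment with $X(0)=x$, $\eta(0)=\sigma$. In $\mathbb{E}[\mathbb{P}_x^{\eta}(X(t)=y)]$ the initial environment $\eta$ is averaged over $\mu$. *)

theory Defs
  imports "HOL-Probability.Probability"
begin

text \<open>A graph has vertex set \<open>UNIV :: 'v set\<close> and a set \<open>E\<close> of unordered edges.\<close>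

definition simple_graph :: "'v set set \<Rightarrow> bool" where
  "simple_graph E \<longleftrightarrow> (\<forall>e\<in>E. card e = 2)"

definition nbrs :: "'v set set \<Rightarrow> 'v \<Rightarrow> 'v set" where
  "nbrs E x = {y. {x, y} \<in> E}"

definition connected_graph :: "'v set set \<Rightarrow> bool" where
  "connected_graph E \<longleftrightarrow> (\<forall>x y. (x, y) \<in> {(u, v). {u, v} \<in> E}\<^sup>*)"

definition bounded_degree :: "'v set set \<Rightarrow> bool" where
  "bounded_degree E \<longleftrightarrow> (\<exists>D. \<forall>x. finite (nbrs E x) \<and> card (nbrs E x) \<le> D)"

definition gdist :: "'v set set \<Rightarrow> 'v \<Rightarrow> 'v \<Rightarrow> nat" where
  "gdist E x y = (LEAST n. (x, y) \<in> {(u, v). {u, v} \<in> E} ^^ n)"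

text \<open>Exactly one of \<open>(y, z)\<close>, \<open>(z, y)\<close> is selected for every edge \<open>{y, z}\<close>.\<close>

definition orientation :: "'v set set \<Rightarrow> ('v \<times> 'v) set \<Rightarrow> bool" where
  "orientation E A \<longleftrightarrow> bij_betw (\<lambda>(y, z). {y, z}) A E"

definition sgn_at :: "'v \<Rightarrow> 'v \<times> 'v \<Rightarrow> real" where
  "sgn_at x b = (if fst b = x then - 1 else if snd b = x then 1 else 0)"

definition C2_fun :: "(real \<Rightarrow> real) \<Rightarrow> bool" where
  "C2_fun f \<longleftrightarrow> (\<forall>t. f differentiable (at t)) \<and> (\<forall>t. deriv f differentiable (at t))
     \<and> continuous_on UNIV (deriv (deriv f))"

text \<open>The potential family is written \<open>U\<close>. Since the Hamiltonian is a formal sum of one-site terms,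
  only its derivatives are meaningful: \<open>dH U x\<close> is its derivative in direction \<open>x\<close>, and \<open>dH_edge U b\<close>
  is its derivative in direction \<open>b = (x, y)\<close>, i.e. in \<open>x\<close> minus in \<open>y\<close>.\<close>

definition dH :: "('v \<Rightarrow> real \<Rightarrow> real) \<Rightarrow> 'v \<Rightarrow> ('v \<Rightarrow> real) \<Rightarrow> real" where
  "dH U x \<eta> = deriv (U x) (\<eta> x)"

definition dH_edge :: "('v \<Rightarrow> real \<Rightarrow> real) \<Rightarrow> 'v \<times> 'v \<Rightarrow> ('v \<Rightarrow> real) \<Rightarrow> real" where
  "dH_edge U b \<eta> = dH U (fst b) \<eta> - dH U (snd b) \<eta>"

definition gibbs :: "('v \<Rightarrow> real \<Rightarrow> real) \<Rightarrow> ('v \<Rightarrow> real) measure" where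
  "gibbs U = (\<Pi>\<^sub>M x\<in>UNIV. density lborel (\<lambda>t. ennreal (exp (- U x t))))"

definition covariance :: "'a measure \<Rightarrow> ('a \<Rightarrow> real) \<Rightarrow> ('a \<Rightarrow> real) \<Rightarrow> real" where
  "covariance M f g = (\<integral>\<sigma>. (f \<sigma> - (\<integral>\<tau>. f \<tau> \<partial>M)) * (g \<sigma> - (\<integral>\<tau>. g \<tau> \<partial>M)) \<partial>M)"

definition standard_BM :: "'w measure \<Rightarrow> (real \<Rightarrow> 'w \<Rightarrow> real) \<Rightarrow> bool" where
  "standard_BM N W \<longleftrightarrow>
     (\<forall>t\<ge>0. W t \<in> borel_measurable N)
   \<and> (AE \<omega> in N. W 0 \<omega> = 0 \<and> continuous_on {0..} (\<lambda>t. W t \<omega>))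
   \<and> (\<forall>s t. 0 \<le> s \<and> s < t \<longrightarrow>
        distributed N lborel (\<lambda>\<omega>. W t \<omega> - W s \<omega>) (\<lambda>u. ennreal (normal_density 0 (sqrt (t - s)) u))
      \<and> prob_space.indep_set N
          (sets (vimage_algebra (space N) (\<lambda>\<omega>. \<lambda>r\<in>{0..s}. W r \<omega>) (\<Pi>\<^sub>M r\<in>{0..s}. borel)))
          (sets (vimage_algebra (space N) (\<lambda>\<omega>. W t \<omega> - W s \<omega>) borel)))"

definition independent_BMs :: "'w measure \<Rightarrow> 'i set \<Rightarrow> ('i \<Rightarrow> real \<Rightarrow> 'w \<Rightarrow> real) \<Rightarrow> bool" where
  "independent_BMs N I B \<longleftrightarrow>
     (\<forall>i\<in>I. standard_BM N (B i))
   \<and> prob_space.indep_vars N (\<lambda>_. \<Pi>\<^sub>M t\<in>{0..}. borel) (\<lambda>i \<omega>. \<lambda>t\<in>{0..}. B i t \<omega>) I"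

text \<open>On an infinite graph the equations need a growth condition at infinity: without one, solutions
  need not be unique (Tychonoff's examples for the heat equation), and from some initial
  configurations none exists. We use configurations of at most exponential growth in the graph
  distance; by connectedness the base point \<open>z\<close> is irrelevant. On a graph of bounded degree the
  drift is Lipschitz in the corresponding weighted norms, the Brownian motions stay in this class,
  and so does almost every configuration under \<open>gibbs U\<close>.\<close>

definition tempered :: "'v set set \<Rightarrow> ('v \<Rightarrow> real) \<Rightarrow> bool" where
  "tempered E \<sigma> \<longleftrightarrow> (\<exists>z a C. \<forall>x. \<bar>\<sigma> x\<bar> \<le> C * exp (a * real (gdist E z x)))"

text \<open>The noise is additive, so the stochastic differential equation is literally an integral equation
  for almost every path. The sum is restricted to the finitely many oriented edges incident to \<open>x\<close>,
  the others having sign \<open>0\<close>, because sums over infinite sets are \<open>0\<close> by convention.\<close>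

definition gl_process ::
  "'v set set \<Rightarrow> ('v \<times> 'v) set \<Rightarrow> ('v \<Rightarrow> real \<Rightarrow> real) \<Rightarrow> 'w measure \<Rightarrow>
   ('v \<times> 'v \<Rightarrow> real \<Rightarrow> 'w \<Rightarrow> real) \<Rightarrow> ('v \<Rightarrow> real) \<Rightarrow> (real \<Rightarrow> 'w \<Rightarrow> 'v \<Rightarrow> real) \<Rightarrow> bool" where
  "gl_process E A U N B \<sigma> \<eta> \<longleftrightarrow>
     (\<forall>t\<ge>0. \<forall>x. (\<lambda>\<omega>. \<eta> t \<omega> x) \<in> borel_measurable N)
   \<and> (\<forall>\<omega>\<in>space N. \<forall>x. continuous_on {0..} (\<lambda>t. \<eta> t \<omega> x))
   \<and> (AE \<omega> in N. \<forall>x. \<forall>t\<ge>0.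
        \<eta> t \<omega> x = \<sigma> x + (\<Sum>b\<in>{b \<in> A. fst b = x \<or> snd b = x}.
          sgn_at x b * ((LBINT s:{0..t}. dH_edge U b (\<eta> s \<omega>)) + sqrt 2 * B b t \<omega>)))
   \<and> (AE \<omega> in N. \<forall>T\<ge>0. \<exists>z a C. \<forall>s\<in>{0..T}. \<forall>x.
        \<bar>\<eta> s \<omega> x\<bar> \<le> C * exp (a * real (gdist E z x)))"

text \<open>Number of jumps of the path \<open>X\<close> from \<open>u\<close> to \<open>v\<close> during the time interval \<open>{s<..t}\<close>.\<close>

definition jump_count :: "(real \<Rightarrow> 'w \<Rightarrow> 'v) \<Rightarrow> 'v \<Rightarrow> 'v \<Rightarrow> real \<Rightarrow> real \<Rightarrow> 'w \<Rightarrow> nat" where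
  "jump_count X u v s t \<omega> = card {r \<in> {s<..t}. (\<forall>\<^sub>F q in at_left r. X q \<omega> = u) \<and> X r \<omega> = v}"

text \<open>Events determined by the whole environment path and the walk up to time \<open>s\<close>. Including the whole
  environment path expresses that the environment evolves autonomously, unaffected by the walk.\<close>

definition history ::
  "'w measure \<Rightarrow> (real \<Rightarrow> 'w \<Rightarrow> 'v \<Rightarrow> real) \<Rightarrow> (real \<Rightarrow> 'w \<Rightarrow> 'v) \<Rightarrow> real \<Rightarrow> 'w set set" where
  "history N \<eta> X s = sigma_sets (space N)
     ({(\<lambda>\<omega>. \<eta> r \<omega> z) -` S \<inter> space N | r z S. 0 \<le> r \<and> S \<in> sets borel}
      \<union> {X r -` S \<inter> space N | r S. 0 \<le> r \<and> r \<le> s})"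

definition jump_rate ::
  "'v set set \<Rightarrow> ('v \<Rightarrow> real \<Rightarrow> real) \<Rightarrow> 'v \<Rightarrow> 'v \<Rightarrow> ('v \<Rightarrow> real) \<Rightarrow> real" where
  "jump_rate E U u v \<eta> = (if v \<in> nbrs E u then deriv (deriv (U u)) (\<eta> u) else 0)"

text \<open>The walk is a right-continuous pure jump process started at \<open>x\<close>; the last clause says that, for
  \<open>u \<noteq> v\<close>, its jumps from \<open>u\<close> to \<open>v\<close> have stochastic intensity \<open>1{X r = u} * jump_rate E U u v (\<eta> r)\<close>
  with respect to \<open>history\<close>.\<close>

definition walk_in_env ::
  "'v set set \<Rightarrow> ('v \<Rightarrow> real \<Rightarrow> real) \<Rightarrow> 'w measure \<Rightarrow> (real \<Rightarrow> 'w \<Rightarrow> 'v \<Rightarrow> real) \<Rightarrow>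
   'v \<Rightarrow> (real \<Rightarrow> 'w \<Rightarrow> 'v) \<Rightarrow> bool" where
  "walk_in_env E U N \<eta> x X \<longleftrightarrow>
     (\<forall>t\<ge>0. X t \<in> N \<rightarrow>\<^sub>M count_space UNIV)
   \<and> (AE \<omega> in N. X 0 \<omega> = x)
   \<and> (\<forall>\<omega>\<in>space N. \<forall>t\<ge>0. \<forall>\<^sub>F q in at_right t. X q \<omega> = X t \<omega>)
   \<and> (\<forall>\<omega>\<in>space N. \<forall>t>0. \<exists>u. \<forall>\<^sub>F q in at_left t. X q \<omega> = u)
   \<and> (\<forall>u v s t. u \<noteq> v \<and> 0 \<le> s \<and> s \<le> t \<longrightarrow> (\<forall>F \<in> history N \<eta> X s.
        (\<integral>\<^sup>+\<omega>\<in>F. of_nat (jump_count X u v s t \<omega>) \<partial>N)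
        = (\<integral>\<^sup>+\<omega>\<in>F. (\<integral>\<^sup>+r\<in>{s..t}.
              indicator {r. X r \<omega> = u} r * ennreal (jump_rate E U u v (\<eta> r \<omega>)) \<partial>lborel) \<partial>N)))"

text \<open>In the next two definitions \<open>\<eta> \<sigma>\<close> is the process started from \<open>\<sigma>\<close> and \<open>X x \<sigma>\<close> the walk started
  from \<open>x\<close> in that environment. Initial configurations that are not tempered, for which there need
  not be a process, form a null set of \<open>gibbs U\<close>; the arbitrary value \<open>0\<close> is assigned to them.\<close>

definition gl_semigroup ::
  "'v set set \<Rightarrow> 'w measure \<Rightarrow> (('v \<Rightarrow> real) \<Rightarrow> real \<Rightarrow> 'w \<Rightarrow> 'v \<Rightarrow> real) \<Rightarrow>
   real \<Rightarrow> (('v \<Rightarrow> real) \<Rightarrow> real) \<Rightarrow> ('v \<Rightarrow> real) \<Rightarrow> real" where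
  "gl_semigroup E N \<eta> t f \<sigma> = (if tempered E \<sigma> then (\<integral>\<omega>. f (\<eta> \<sigma> t \<omega>) \<partial>N) else 0)"

definition walk_prob ::
  "'v set set \<Rightarrow> 'w measure \<Rightarrow> ('v \<Rightarrow> ('v \<Rightarrow> real) \<Rightarrow> real \<Rightarrow> 'w \<Rightarrow> 'v) \<Rightarrow>
   'v \<Rightarrow> real \<Rightarrow> 'v \<Rightarrow> ('v \<Rightarrow> real) \<Rightarrow> real" where
  "walk_prob E N X x t y \<sigma> =
     (if tempered E \<sigma> then measure N {\<omega> \<in> space N. X x \<sigma> t \<omega> = y} else 0)"

end

theory Submission
  imports Defs
begin

text \<open>The theorem rests on two facts about \<open>F \<sigma>\<close>, the expectation at time \<open>t\<close> of the coordinate at \<open>y\<close> of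
the process started from \<open>\<sigma>\<close>.

The derivative of \<open>F\<close> in direction \<open>x\<close> at \<open>\<sigma>\<close> is the probability that the walk started from \<open>x\<close>
is at \<open>y\<close> at time \<open>t\<close>. The noise is additive, so the solutions started from \<open>\<sigma>\<close> and from
\<open>\<sigma>(x := \<sigma> x + h)\<close> have a difference \<open>d\<close> that contains no noise: the time derivative of \<open>d v\<close> is
the sum over the neighbours \<open>u\<close> of \<open>v\<close> of \<open>a u * d u - a v * d v\<close>, where \<open>a u\<close> is an average of
\<open>U u''\<close> between the two solutions. As \<open>h\<close> tends to \<open>0\<close>, \<open>d / h\<close> tends, for each environment, to the
solution of the Kolmogorov forward equation of the walk, whose jump rates are \<open>U u''\<close>. This is
\<open>mean_flow_derivative\<close>; in particular the derivative lies between \<open>0\<close> and \<open>1\<close>.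

The covariance with a coordinate is comparable with the derivative in that coordinate. Freeze all
coordinates but \<open>x\<close>, write \<open>V\<close> for \<open>U x\<close> and \<open>f s = F (\<sigma>(x := s))\<close>, and integrate against
the density \<open>exp (- V s)\<close>, under which \<open>s - M\<close> and \<open>V' s\<close> have mean \<open>0\<close>. The function
\<open>s - M - V' s / C\<close> decreases for \<open>C = Cm\<close> and increases for \<open>C = Cp\<close>, whereas \<open>f\<close> increases.
Hence Chebyshev's correlation inequality puts the integral of \<open>(s - M) * f s\<close> between the
integrals of \<open>V' s * f s / Cp\<close> and of \<open>V' s * f s / Cm\<close>, and integration by parts turns \<open>V' * f\<close> into
\<open>f'\<close>. This is \<open>covariance_sandwich\<close>. Averaging it over the frozen coordinates, with the coordinate
at \<open>x\<close> resampled, is the theorem.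

Three points need care. First, on an infinite graph the solutions only satisfy some
exponential bound in the graph distance, with a random rate; \<open>graph_gronwall\<close> turns this and an
integral inequality into estimates that do not depend on that rate. Secondly, the law of the walk given the environment is
never constructed. Instead the difference between \<open>h\<close> times the indicator of the event that the walk
is at \<open>v\<close> and the displacement \<open>d v\<close> is tested against bounded nonnegative functions \<open>Z\<close> of the
environment. The equation for this quantity multiplies \<open>Z\<close> by \<open>U u''\<close>, a function of the environment
again, so that it can be iterated (\<open>discrepancy_bound\<close>). Thirdly, solutions for different initial configurations are chosen independently
of each other, so the measurability of \<open>F\<close> has to be derived from its continuity
(\<open>mean_flow_discretize\<close>).\<close>

section \<open>Graphs of bounded degree\<close>

locale bounded_graph =
  fixes E :: "'v set set" and D :: nat
  assumes simple: "simple_graph E"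
    and connected: "connected_graph E"
    and degree: "finite (nbrs E z)" "card (nbrs E z) \<le> D"
begin

abbreviation adj :: "('v \<times> 'v) set" where
  "adj \<equiv> {(u, v). {u, v} \<in> E}"

lemma nbrs_sym: "w \<in> nbrs E z \<longleftrightarrow> z \<in> nbrs E w"
  by (simp add: nbrs_def insert_commute)

lemma nbrs_irrefl: "z \<notin> nbrs E z"
  using simple by (auto simp: nbrs_def simple_graph_def)

lemma gdist_relpow: "(z, w) \<in> adj ^^ gdist E z w"
proof -
  have "(z, w) \<in> adj\<^sup>*"
    using connected by (simp add: connected_graph_def)
  then obtain n where "(z, w) \<in> adj ^^ n"
    using rtrancl_imp_relpow by blast
  then show ?thesis
    unfolding gdist_def by (rule LeastI)
qed

lemma gdist_le: "(z, w) \<in> adj ^^ n \<Longrightarrow> gdist E z w \<le> n"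
  unfolding gdist_def by (rule Least_le)

lemma gdist_triangle: "gdist E p z \<le> gdist E p q + gdist E q z"
proof (rule gdist_le)
  show "(p, z) \<in> adj ^^ (gdist E p q + gdist E q z)"
    using gdist_relpow[of p q] gdist_relpow[of q z] by (auto simp: relpow_add)
qed

lemma gdist_nbr: "w \<in> nbrs E z \<Longrightarrow> gdist E p w \<le> gdist E p z + 1"
proof -
  assume "w \<in> nbrs E z"
  then have "(z, w) \<in> adj ^^ 1" by (simp add: nbrs_def)
  then have "gdist E z w \<le> 1" by (rule gdist_le)
  with gdist_triangle[of p w z] show ?thesis by simp
qed

lemma finite_walk_ends: "finite {z. (p, z) \<in> adj ^^ n} \<and> card {z. (p, z) \<in> adj ^^ n} \<le> D ^ n"
proof (induction n)
  case 0
  then show ?case by simp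
next
  case (Suc n)
  let ?S = "{z. (p, z) \<in> adj ^^ n}"
  have eq: "{z. (p, z) \<in> adj ^^ Suc n} = (\<Union>z\<in>?S. nbrs E z)"
    by (auto simp: nbrs_def)
  have "card (\<Union>z\<in>?S. nbrs E z) \<le> (\<Sum>z\<in>?S. card (nbrs E z))"
    using Suc by (intro card_UN_le) auto
  also have "\<dots> \<le> (\<Sum>z\<in>?S. D)"
    by (intro sum_mono degree)
  also have "\<dots> \<le> D ^ Suc n"
    using Suc by simp
  finally show ?case
    using Suc degree(1) eq by simp
qed

lemma finite_ball: "finite {z. gdist E p z \<le> n}"
proof (rule finite_subset)
  show "{z. gdist E p z \<le> n} \<subseteq> (\<Union>k\<le>n. {z. (p, z) \<in> adj ^^ k})"
    using gdist_relpow by force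
  show "finite (\<Union>k\<le>n. {z. (p, z) \<in> adj ^^ k})"
    using finite_walk_ends by blast
qed

lemma countable_vertices: "countable (UNIV :: 'v set)"
proof -
  have "UNIV = (\<Union>n. {z. gdist E undefined z \<le> n})" by auto
  moreover have "countable (\<Union>n::nat. {z. gdist E undefined z \<le> n})"
    by (rule countable_UN) (auto intro!: countable_finite finite_ball)
  ultimately show ?thesis by simp
qed

text \<open>There are at most \<open>D ^ n\<close> vertices at distance \<open>n\<close>; with this rate they have total weight at most \<open>(1/2) ^ n\<close>.\<close>

definition decay :: real where
  "decay = ln (2 * (real D + 1))"

lemma decay_nonneg: "0 \<le> decay"
  by (simp add: decay_def)

lemma decaying_weights_summable:
  "(\<integral>\<^sup>+z. ennreal (exp (- decay * real (gdist E p z))) \<partial>count_space UNIV) \<le> 2"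
proof -
  let ?q = "1 / (2 * (real D + 1))"
  have e: "exp (- decay * real n) = ?q ^ n" for n
  proof -
    have "exp (- decay * real n) = exp (- decay) ^ n"
      by (metis exp_of_nat2_mult)
    also have "exp (- decay) = ?q"
      by (simp add: decay_def exp_minus divide_simps)
    finally show ?thesis .
  qed
  have "(\<integral>\<^sup>+z. ennreal (exp (- decay * real (gdist E p z))) \<partial>count_space UNIV)
      \<le> (\<integral>\<^sup>+z. (\<Sum>n. ennreal (?q ^ n) * indicator {z. (p, z) \<in> adj ^^ n} z) \<partial>count_space UNIV)"
  proof (rule nn_integral_mono)
    fix z
    let ?f = "\<lambda>n. ennreal (?q ^ n) * indicator {z. (p, z) \<in> adj ^^ n} z"
    have "?f (gdist E p z) = sum ?f {gdist E p z}" by (subst sum.insert) auto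
    also have "\<dots> \<le> (\<Sum>n. ?f n)"
      by (rule sum_le_suminf) (auto intro: summableI)
    finally show "ennreal (exp (- decay * real (gdist E p z))) \<le> (\<Sum>n. ?f n)"
      using gdist_relpow[of p z] e by simp
  qed
  also have "\<dots> = (\<Sum>n. \<integral>\<^sup>+z. ennreal (?q ^ n) * indicator {z. (p, z) \<in> adj ^^ n} z \<partial>count_space UNIV)"
    by (rule nn_integral_suminf) simp
  also have "\<dots> \<le> (\<Sum>n. ennreal ((1/2) ^ n))"
  proof (rule suminf_le)
    fix n
    have "(\<integral>\<^sup>+z. ennreal (?q ^ n) * indicator {z. (p, z) \<in> adj ^^ n} z \<partial>count_space UNIV)
        = ennreal (?q ^ n) * of_nat (card {z. (p, z) \<in> adj ^^ n})"
      using finite_walk_ends[of p n] by (simp add: nn_integral_cmult_indicator emeasure_count_space)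
    also have "\<dots> = ennreal (?q ^ n * real (card {z. (p, z) \<in> adj ^^ n}))"
      by (simp add: ennreal_mult'' ennreal_of_nat_eq_real_of_nat)
    also have "\<dots> \<le> ennreal ((1/2) ^ n)"
    proof (rule ennreal_leI)
      have "real (card {z. (p, z) \<in> adj ^^ n}) \<le> (real D + 1) ^ n"
      proof -
        have "real (card {z. (p, z) \<in> adj ^^ n}) \<le> real D ^ n"
          using finite_walk_ends[of p n] by (metis of_nat_le_iff of_nat_power)
        also have "\<dots> \<le> (real D + 1) ^ n" by (intro power_mono) auto
        finally show ?thesis .
      qed
      then have "?q ^ n * real (card {z. (p, z) \<in> adj ^^ n}) \<le> ?q ^ n * (real D + 1) ^ n"
        by (intro mult_left_mono) auto
      also have "\<dots> = (1/2) ^ n"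
        unfolding power_mult_distrib[symmetric] by (rule arg_cong[where f="\<lambda>q. q ^ n"]) (simp add: field_simps)
      finally show "?q ^ n * real (card {z. (p, z) \<in> adj ^^ n}) \<le> (1/2) ^ n" .
    qed
    finally show "(\<integral>\<^sup>+z. ennreal (?q ^ n) * indicator {z. (p, z) \<in> adj ^^ n} z \<partial>count_space UNIV)
        \<le> ennreal ((1/2) ^ n)" .
  qed (auto intro: summableI)
  also have "\<dots> = ennreal (\<Sum>n. (1/2) ^ n)"
    by (intro suminf_ennreal2) (auto simp: summable_geometric)
  also have "\<dots> = 2"
    by (subst suminf_geometric) auto
  finally show ?thesis .
qed

abbreviation growth :: "real \<Rightarrow> 'v \<Rightarrow> 'v \<Rightarrow> real" where
  "growth a p z \<equiv> exp (a * real (gdist E p z))"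

lemma exp_gdist_nbr:
  assumes "0 \<le> a" "w \<in> nbrs E z"
  shows "growth a p w \<le> exp a * growth a p z"
proof -
  have "a * real (gdist E p w) \<le> a * (real (gdist E p z) + 1)"
    using gdist_nbr[OF assms(2), of p] assms(1) by (intro mult_left_mono) auto
  then show ?thesis
    by (simp add: algebra_simps flip: exp_add)
qed

lemma exponential_growth_rebase:
  assumes "\<And>z. f z \<le> C * growth a q z"
  shows "f z \<le> (\<bar>C\<bar> * growth \<bar>a\<bar> q p) * growth \<bar>a\<bar> p z"
proof -
  have "f z \<le> C * growth a q z" by fact
  also have "\<dots> \<le> \<bar>C\<bar> * growth \<bar>a\<bar> q z"
    by (intro mult_mono) (auto intro!: mult_right_mono)
  also have "\<dots> \<le> \<bar>C\<bar> * exp (\<bar>a\<bar> * (real (gdist E q p) + real (gdist E p z)))"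
    using gdist_triangle[of q z p] by (intro mult_left_mono) (auto intro!: mult_left_mono simp flip: of_nat_add)
  finally show ?thesis
    by (simp add: exp_add algebra_simps)
qed

text \<open>Taking rate and constant to be the same natural number leaves countably many conditions, which
makes the sets of tempered paths and configurations measurable.\<close>

lemma exponential_growth_nat:
  assumes "\<And>i z. i \<in> I \<Longrightarrow> f i z \<le> C * growth a q z"
  obtains n :: nat where "\<And>i z. i \<in> I \<Longrightarrow> f i z \<le> real n * growth (real n) p z"
proof -
  define c where "c = \<bar>C\<bar> * growth \<bar>a\<bar> q p"
  obtain n :: nat where n: "c \<le> real n" "\<bar>a\<bar> \<le> real n"
    using real_arch_simple[of "max c \<bar>a\<bar>"] by auto
  have "f i z \<le> real n * growth (real n) p z" if "i \<in> I" for i z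
  proof -
    have "f i z \<le> c * growth \<bar>a\<bar> p z"
      unfolding c_def using assms[OF that] by (rule exponential_growth_rebase)
    also have "\<dots> \<le> real n * growth (real n) p z"
      using n by (intro mult_mono) (auto intro!: mult_right_mono)
    finally show ?thesis .
  qed
  then show ?thesis by (rule that)
qed

lemma tempered_based:
  "tempered E \<sigma> \<longleftrightarrow> (\<exists>n::nat. \<forall>z. \<bar>\<sigma> z\<bar> \<le> real n * growth (real n) p z)"
proof
  assume "tempered E \<sigma>"
  then obtain q a C where q: "\<And>z. \<bar>\<sigma> z\<bar> \<le> C * growth a q z"
    by (auto simp: tempered_def)
  obtain n :: nat where "\<And>z. \<bar>\<sigma> z\<bar> \<le> real n * growth (real n) p z"
    using exponential_growth_nat[of "UNIV :: unit set" "\<lambda>_ z. \<bar>\<sigma> z\<bar>" C a q p] q by auto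
  then show "\<exists>n::nat. \<forall>z. \<bar>\<sigma> z\<bar> \<le> real n * growth (real n) p z" by blast
qed (auto simp: tempered_def)

section \<open>A Gronwall inequality on the graph\<close>

text \<open>Net inflow into \<open>z\<close> up to time \<open>t\<close>. The drift of the process, the difference of two solutions, the forward
equation of the walk and the discrepancy between the last two all have this form.\<close>

abbreviation inflow :: "('v \<Rightarrow> real \<Rightarrow> real) \<Rightarrow> 'v \<Rightarrow> real \<Rightarrow> real" where
  "inflow f z t \<equiv> \<Sum>w\<in>nbrs E z. LBINT s:{0..t}. f w s - f z s"

text \<open>The bound with weight \<open>\<psi>\<close> only starts the iteration: inserting it \<open>n\<close> times into the inequality
leaves a multiple of \<open>t ^ n / fact n\<close>, so that in the limit only the datum, with its own weight \<open>\<phi>\<close>,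
counts. Some such bound is needed: on infinite graphs the heat equation can have nonzero
solutions with datum \<open>0\<close>, all of them of faster growth.\<close>

lemma graph_gronwall:
  fixes u :: "real \<Rightarrow> 'v \<Rightarrow> real"
  assumes nonneg: "0 \<le> K" "0 \<le> k" "0 \<le> l" "0 \<le> c" "0 \<le> C" "\<And>z. 0 \<le> \<phi> z" "\<And>z. 0 \<le> \<psi> z"
    and phi: "\<And>z w. w \<in> nbrs E z \<Longrightarrow> \<phi> w \<le> k * \<phi> z"
    and psi: "\<And>z w. w \<in> nbrs E z \<Longrightarrow> \<psi> w \<le> l * \<psi> z"
    and bound: "\<And>s z. 0 \<le> s \<Longrightarrow> s \<le> T \<Longrightarrow> u s z \<le> C * \<psi> z"
    and ineq: "\<And>t z. 0 \<le> t \<Longrightarrow> t \<le> T \<Longrightarrow>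
      u t z \<le> c * \<phi> z + (\<Sum>w\<in>nbrs E z. LBINT s:{0..t}. K * (u s w + u s z))"
    and t: "0 \<le> t" "t \<le> T"
  shows "u t z \<le> c * \<phi> z * exp (K * D * (k + 1) * t)"
proof -
  define \<kappa> where "\<kappa> = K * D * (k + 1)"
  define \<kappa>' where "\<kappa>' = K * D * (l + 1)"
  have kl: "0 \<le> \<kappa>" "0 \<le> \<kappa>'" using nonneg by (auto simp: \<kappa>_def \<kappa>'_def)
  let ?b = "\<lambda>n s z. c * \<phi> z * exp (\<kappa> * s) + C * \<psi> z * ((\<kappa>' * s) ^ n / fact n)"
  have main: "\<forall>s z. 0 \<le> s \<longrightarrow> s \<le> T \<longrightarrow> u s z \<le> ?b n s z" for n
  proof (induction n)
    case 0
    show ?case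
      using bound nonneg kl by (auto intro!: add_increasing)
  next
    case (Suc n)
    show ?case
    proof (intro allI impI)
      fix t z assume t: "0 \<le> (t::real)" "t \<le> T"
      have Iexp: "has_bochner_integral lborel (\<lambda>s. indicator {0..t} s *\<^sub>R (\<kappa> * exp (\<kappa> * s))) (exp (\<kappa> * t) - exp (\<kappa> * 0))"
        using t(1) by (intro has_bochner_integral_FTC_Icc)
          (auto intro!: derivative_eq_intros continuous_intros simp: has_real_derivative_iff_has_vector_derivative[symmetric])
      have Ipow: "has_bochner_integral lborel (\<lambda>s. indicator {0..t} s *\<^sub>R (\<kappa>' * ((\<kappa>' * s) ^ n / fact n)))
         ((\<kappa>' * t) ^ Suc n / fact (Suc n) - (\<kappa>' * 0) ^ Suc n / fact (Suc n))"
      proof (rule has_bochner_integral_FTC_Icc[OF t(1)])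
        fix s
        have "((\<lambda>x. (\<kappa>' * x) ^ Suc n / fact (Suc n)) has_real_derivative
           (real (Suc n) * (\<kappa>' * s) ^ n * \<kappa>') / fact (Suc n)) (at s within {0..t})"
          by (rule DERIV_cong[OF DERIV_cdivide[OF DERIV_power[OF DERIV_cmult_Id]]])
            (simp del: of_nat_Suc fact_Suc)
        also have "(real (Suc n) * (\<kappa>' * s) ^ n * \<kappa>') / fact (Suc n) = \<kappa>' * ((\<kappa>' * s) ^ n / fact n)"
          by (simp add: fact_Suc del: of_nat_Suc)
        finally show "((\<lambda>x. (\<kappa>' * x) ^ Suc n / fact (Suc n)) has_vector_derivative \<kappa>' * ((\<kappa>' * s) ^ n / fact n)) (at s within {0..t})"
          by (simp only: has_real_derivative_iff_has_vector_derivative)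
      qed (auto intro!: continuous_intros)
      define e where "e = (\<lambda>s. indicator {0..t} s * exp (\<kappa> * s) :: real)"
      define p where "p = (\<lambda>s. indicator {0..t} s * ((\<kappa>' * s) ^ n / fact n) :: real)"
      have ie: "integrable lborel e" and ip: "integrable lborel p"
      proof -
        have "set_integrable lborel {0..t} (\<lambda>s. exp (\<kappa> * s))"
          "set_integrable lborel {0..t} (\<lambda>s. (\<kappa>' * s) ^ n / fact n)"
          by (auto intro!: borel_integrable_atLeastAtMost' continuous_intros)
        then show "integrable lborel e" "integrable lborel p"
          by (simp_all add: set_integrable_def e_def p_def)
      qed
      have Ie: "\<kappa> * integral\<^sup>L lborel e = exp (\<kappa> * t) - 1"
        using has_bochner_integral_integral_eq[OF Iexp] unfolding e_def
        by (simp add: mult.left_commute)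
      have Ip: "\<kappa>' * integral\<^sup>L lborel p = (\<kappa>' * t) ^ Suc n / fact (Suc n)"
      proof -
        have "\<kappa>' * integral\<^sup>L lborel p = (\<integral>s. indicator {0..t} s *\<^sub>R (\<kappa>' * ((\<kappa>' * s) ^ n / fact n)) \<partial>lborel)"
          unfolding p_def by (subst integral_mult_right_zero[symmetric]) (simp add: mult.left_commute)
        then show ?thesis
          using has_bochner_integral_integral_eq[OF Ipow] by simp
      qed
      have e0: "0 \<le> e s" and p0: "0 \<le> p s" for s
        using kl by (auto simp: e_def p_def split: split_indicator)
      have step: "(LBINT s:{0..t}. K * (u s w + u s z))
          \<le> K * (c * ((k + 1) * \<phi> z)) * integral\<^sup>L lborel e + K * (C * ((l + 1) * \<psi> z)) * integral\<^sup>L lborel p"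
        if w: "w \<in> nbrs E z" for w
      proof -
        have "(LBINT s:{0..t}. K * (u s w + u s z))
          \<le> (\<integral>s. K * (c * ((k + 1) * \<phi> z)) * e s + K * (C * ((l + 1) * \<psi> z)) * p s \<partial>lborel)"
          unfolding set_lebesgue_integral_def
        proof (rule integral_mono')
          show "integrable lborel (\<lambda>s. K * (c * ((k + 1) * \<phi> z)) * e s + K * (C * ((l + 1) * \<psi> z)) * p s)"
            using ie ip by auto
          fix s :: real
          show "0 \<le> K * (c * ((k + 1) * \<phi> z)) * e s + K * (C * ((l + 1) * \<psi> z)) * p s"
            using nonneg e0 p0 by (intro add_nonneg_nonneg mult_nonneg_nonneg) auto
          show "indicat_real {0..t} s *\<^sub>R (K * (u s w + u s z))
              \<le> K * (c * ((k + 1) * \<phi> z)) * e s + K * (C * ((l + 1) * \<psi> z)) * p s"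
          proof (cases "s \<in> {0..t}")
            case True
            then have s: "0 \<le> s" "s \<le> T" using t by auto
            have pow: "0 \<le> (\<kappa>' * s) ^ n / fact n" using kl s by auto
            have "u s w + u s z \<le> (c * (k * \<phi> z) * exp (\<kappa> * s) + C * (l * \<psi> z) * ((\<kappa>' * s) ^ n / fact n))
                 + ?b n s z"
            proof (rule add_mono)
              have "u s w \<le> ?b n s w" using Suc s by blast
              also have "\<dots> \<le> c * (k * \<phi> z) * exp (\<kappa> * s) + C * (l * \<psi> z) * ((\<kappa>' * s) ^ n / fact n)"
                using phi[OF w] psi[OF w] nonneg pow
                by (intro add_mono mult_right_mono mult_left_mono) auto
              finally show "u s w \<le> \<dots>" .
              show "u s z \<le> ?b n s z" using Suc s by blast
            qed
            then have "K * (u s w + u s z) \<le> K * ((c * (k * \<phi> z) * exp (\<kappa> * s) + C * (l * \<psi> z) * ((\<kappa>' * s) ^ n / fact n))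
                 + ?b n s z)"
              using nonneg by (intro mult_left_mono) auto
            then show ?thesis using True by (simp add: e_def p_def algebra_simps)
          qed (simp add: e_def p_def)
        qed
        also have "\<dots> = K * (c * ((k + 1) * \<phi> z)) * integral\<^sup>L lborel e + K * (C * ((l + 1) * \<psi> z)) * integral\<^sup>L lborel p"
          using ie ip by simp
        finally show ?thesis .
      qed
      have "u t z \<le> c * \<phi> z + (\<Sum>w\<in>nbrs E z. LBINT s:{0..t}. K * (u s w + u s z))"
        using ineq t by blast
      also have "\<dots> \<le> c * \<phi> z + (\<Sum>w\<in>nbrs E z.
           K * (c * ((k + 1) * \<phi> z)) * integral\<^sup>L lborel e + K * (C * ((l + 1) * \<psi> z)) * integral\<^sup>L lborel p)"
        by (intro add_left_mono sum_mono step)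
      also have "\<dots> \<le> c * \<phi> z + D *
           (K * (c * ((k + 1) * \<phi> z)) * integral\<^sup>L lborel e + K * (C * ((l + 1) * \<psi> z)) * integral\<^sup>L lborel p)"
        using nonneg e0 p0 degree(2)[of z]
        by (intro add_left_mono) (auto intro!: mult_right_mono add_nonneg_nonneg mult_nonneg_nonneg integral_nonneg)
      also have "\<dots> = c * \<phi> z + c * \<phi> z * (\<kappa> * integral\<^sup>L lborel e) + C * \<psi> z * (\<kappa>' * integral\<^sup>L lborel p)"
        by (simp add: \<kappa>_def \<kappa>'_def algebra_simps)
      also have "\<dots> = ?b (Suc n) t z"
        unfolding Ie Ip by (simp add: algebra_simps)
      finally show "u t z \<le> ?b (Suc n) t z" .
    qed
  qed
  have "(\<lambda>n. c * \<phi> z * exp (\<kappa> * t) + C * \<psi> z * ((\<kappa>' * t) ^ n / fact n))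
      \<longlonglongrightarrow> c * \<phi> z * exp (\<kappa> * t) + C * \<psi> z * 0"
    using summable_LIMSEQ_zero[OF summable_exp[of "\<kappa>' * t"]]
    by (intro tendsto_intros) (simp add: field_simps)
  then have "u t z \<le> c * \<phi> z * exp (\<kappa> * t) + C * \<psi> z * 0"
    using main t by (intro LIMSEQ_le_const) auto
  then show ?thesis by (simp add: \<kappa>_def)
qed

end

section \<open>Uniformly convex potentials on the line\<close>

locale convex_potential =
  fixes V :: "real \<Rightarrow> real" and M Cm Cp :: real
  assumes normalized: "has_bochner_integral lborel (\<lambda>s. exp (- V s)) 1"
    and mean: "has_bochner_integral lborel (\<lambda>s. s * exp (- V s)) M"
    and smooth: "C2_fun V"
    and constants: "0 < Cm" "Cm \<le> Cp"
    and bounds: "\<And>s. Cm \<le> deriv (deriv V) s \<and> deriv (deriv V) s \<le> Cp"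
begin

abbreviation \<nu> :: "real measure" where
  "\<nu> \<equiv> density lborel (\<lambda>s. ennreal (exp (- V s)))"

lemma DERIV_V: "(V has_real_derivative deriv V s) (at s)"
  using smooth by (simp add: C2_fun_def DERIV_deriv_iff_real_differentiable)

lemma DERIV_V': "(deriv V has_real_derivative deriv (deriv V) s) (at s)"
  using smooth by (simp add: C2_fun_def DERIV_deriv_iff_real_differentiable)

lemma continuous_V: "continuous_on A V"
  using DERIV_V DERIV_isCont continuous_at_imp_continuous_on by blast

lemma continuous_V': "continuous_on A (deriv V)"
  using DERIV_V' DERIV_isCont continuous_at_imp_continuous_on by blast

lemma continuous_V'': "continuous_on UNIV (deriv (deriv V))"
  using smooth by (simp add: C2_fun_def)

lemma borel_V [measurable]: "V \<in> borel_measurable borel"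
  "deriv V \<in> borel_measurable borel" "deriv (deriv V) \<in> borel_measurable borel"
  by (intro borel_measurable_continuous_onI continuous_V continuous_V' continuous_V'')+

lemma V'_lipschitz: "\<bar>deriv V s - deriv V r\<bar> \<le> Cp * \<bar>s - r\<bar>"
proof -
  have *: "\<bar>deriv V s - deriv V r\<bar> \<le> Cp * \<bar>s - r\<bar>" if rs: "r < s" for r s
  proof -
    obtain z where "deriv V s - deriv V r = (s - r) * deriv (deriv V) z"
      using MVT2[OF rs, of "deriv V" "deriv (deriv V)"] DERIV_V' by blast
    moreover have "0 \<le> deriv (deriv V) z" "deriv (deriv V) z \<le> Cp"
      using bounds[of z] constants by auto
    ultimately show ?thesis
      using rs by (simp add: abs_mult mult.commute mult_right_mono)
  qed
  show ?thesis
    using *[of r s] *[of s r] by (cases r s rule: linorder_cases) (auto simp: abs_minus_commute)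
qed

text \<open>What the two-sided bound on \<open>V''\<close> contributes to the correlation inequality.\<close>

lemma V'_ratio_mono:
  "mono (\<lambda>s. s - M - deriv V s / Cp)" "mono (\<lambda>s. - (s - M - deriv V s / Cm))"
proof -
  have C: "0 < Cm" "0 < Cp" using constants by auto
  show "mono (\<lambda>s. s - M - deriv V s / Cp)"
  proof (rule monoI)
    fix r s :: real assume "r \<le> s"
    then show "r - M - deriv V r / Cp \<le> s - M - deriv V s / Cp"
    proof (rule DERIV_nonneg_imp_nondecreasing)
      fix q
      have "((\<lambda>s. s - M - deriv V s / Cp) has_real_derivative 1 - deriv (deriv V) q / Cp) (at q)"
        using C by (auto intro!: derivative_eq_intros DERIV_V')
      moreover have "deriv (deriv V) q / Cp \<le> 1"
        using bounds[of q] C by (subst divide_le_eq_1_pos) auto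
      ultimately show "\<exists>y. ((\<lambda>s. s - M - deriv V s / Cp) has_real_derivative y) (at q) \<and> 0 \<le> y"
        by (intro exI conjI) auto
    qed
  qed
  show "mono (\<lambda>s. - (s - M - deriv V s / Cm))"
  proof (rule monoI)
    fix r s :: real assume "r \<le> s"
    then show "- (r - M - deriv V r / Cm) \<le> - (s - M - deriv V s / Cm)"
    proof (rule DERIV_nonneg_imp_nondecreasing)
      fix q
      have "((\<lambda>s. - (s - M - deriv V s / Cm)) has_real_derivative - (1 - deriv (deriv V) q / Cm)) (at q)"
        using C by (auto intro!: derivative_eq_intros DERIV_V')
      moreover have "1 \<le> deriv (deriv V) q / Cm"
        using bounds[of q] C by (subst le_divide_eq_1_pos) auto
      ultimately show "\<exists>y. ((\<lambda>s. - (s - M - deriv V s / Cm)) has_real_derivative y) (at q) \<and> 0 \<le> y"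
        by (intro exI conjI) auto
    qed
  qed
qed

text \<open>By convexity \<open>V\<close> lies above a parabola with leading coefficient \<open>Cm / 2\<close>; half of the quadratic term
absorbs the linear one.\<close>

lemma gaussian_bound: "\<exists>K\<ge>0. \<forall>s. exp (- V s) \<le> K * exp (- (Cm / 4 * s\<^sup>2))"
proof (intro exI conjI allI)
  let ?K = "exp ((deriv V 0)\<^sup>2 / Cm - V 0)"
  show "0 \<le> ?K" by simp
  fix s
  let ?g = "\<lambda>s. V s - Cm / 2 * s\<^sup>2"
  have g: "(?g has_real_derivative deriv V q - Cm * q) (at q)" for q
    by (auto intro!: derivative_eq_intros DERIV_V)
  have m: "deriv V q - Cm * q \<le> deriv V r - Cm * r" if "q \<le> r" for q r
    using that
  proof (rule DERIV_nonneg_imp_nondecreasing)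
    fix z
    have "((\<lambda>q. deriv V q - Cm * q) has_real_derivative deriv (deriv V) z - Cm) (at z)"
      by (auto intro!: derivative_eq_intros DERIV_V')
    then show "\<exists>y. ((\<lambda>q. deriv V q - Cm * q) has_real_derivative y) (at z) \<and> 0 \<le> y"
      using bounds[of z] by (intro exI conjI) auto
  qed
  have "V s - Cm / 2 * s\<^sup>2 \<ge> V 0 + deriv V 0 * s"
  proof (cases s "0::real" rule: linorder_cases)
    case less
    obtain z where z: "z < 0" "?g 0 - ?g s = (0 - s) * (deriv V z - Cm * z)"
      using MVT2[OF less, of ?g "\<lambda>q. deriv V q - Cm * q"] g by auto
    then have "deriv V z - Cm * z \<le> deriv V 0" using m[of z 0] by simp
    then have "(0 - s) * (deriv V z - Cm * z) \<le> (0 - s) * deriv V 0"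
      using less by (intro mult_left_mono) auto
    then show ?thesis using z by (simp add: algebra_simps)
  next
    case greater
    obtain z where z: "0 < z" "?g s - ?g 0 = (s - 0) * (deriv V z - Cm * z)"
      using MVT2[OF greater, of ?g "\<lambda>q. deriv V q - Cm * q"] g by auto
    then have "deriv V 0 \<le> deriv V z - Cm * z" using m[of 0 z] by simp
    then have "(s - 0) * deriv V 0 \<le> (s - 0) * (deriv V z - Cm * z)"
      using greater by (intro mult_left_mono) auto
    then show ?thesis using z by (simp add: algebra_simps)
  qed simp
  moreover have "Cm / 4 * s\<^sup>2 + deriv V 0 * s + (deriv V 0)\<^sup>2 / Cm = Cm / 4 * (s + 2 * deriv V 0 / Cm)\<^sup>2"
    using constants by (simp add: power2_eq_square field_simps)
  moreover have "0 \<le> Cm / 4 * (s + 2 * deriv V 0 / Cm)\<^sup>2"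
    using constants by simp
  ultimately have "- V s \<le> ((deriv V 0)\<^sup>2 / Cm - V 0) + - (Cm / 4 * s\<^sup>2)"
    by (simp add: algebra_simps)
  then show "exp (- V s) \<le> ?K * exp (- (Cm / 4 * s\<^sup>2))"
    by (simp flip: exp_add)
qed

lemma integrable_quadratic_growth:
  assumes [measurable]: "f \<in> borel_measurable borel" and f: "\<And>s. \<bar>f s\<bar> \<le> a + b * s\<^sup>2"
  shows "integrable \<nu> f"
proof -
  obtain K where K: "0 \<le> K" "\<And>s. exp (- V s) \<le> K * exp (- (Cm / 4 * s\<^sup>2))"
    using gaussian_bound by blast
  define \<sigma> where "\<sigma> = sqrt (2 / Cm)"
  have s2: "\<sigma>\<^sup>2 = 2 / Cm" using constants by (simp add: \<sigma>_def)
  define L where "L = K * sqrt (2 * pi * \<sigma>\<^sup>2)"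
  have e: "K * exp (- (Cm / 4 * s\<^sup>2)) = L * normal_density 0 \<sigma> s" for s
    using constants by (simp add: L_def normal_density_def s2)
  have "integrable lborel (\<lambda>s. L * (\<bar>a\<bar> * (normal_density 0 \<sigma> s * (s - 0)^0) + \<bar>b\<bar> * (normal_density 0 \<sigma> s * (s - 0)^2)))"
    using constants by (intro integrable_mult_right Bochner_Integration.integrable_add integrable_normal_moment) (simp add: \<sigma>_def)+
  then have "integrable lborel (\<lambda>s. f s * exp (- V s))"
  proof (rule Bochner_Integration.integrable_bound)
    show "AE s in lborel. norm (f s * exp (- V s))
       \<le> norm (L * (\<bar>a\<bar> * (normal_density 0 \<sigma> s * (s - 0)^0) + \<bar>b\<bar> * (normal_density 0 \<sigma> s * (s - 0)^2)))"
    proof (rule AE_I2)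
      fix s :: real
      have "\<bar>f s\<bar> \<le> \<bar>a\<bar> + \<bar>b\<bar> * s\<^sup>2"
        using f[of s] mult_right_mono[OF abs_ge_self[of b], of "s\<^sup>2"] abs_ge_self[of a] by auto
      then have "\<bar>f s\<bar> * exp (- V s) \<le> (\<bar>a\<bar> + \<bar>b\<bar> * s\<^sup>2) * (L * normal_density 0 \<sigma> s)"
        using K(2)[of s] unfolding e by (intro mult_mono) auto
      also have "\<dots> = L * (\<bar>a\<bar> * (normal_density 0 \<sigma> s * (s - 0)^0) + \<bar>b\<bar> * (normal_density 0 \<sigma> s * (s - 0)^2))"
        by (simp add: algebra_simps)
      finally have "norm (f s * exp (- V s)) \<le> \<dots>"
        by (simp add: abs_mult)
      then show "norm (f s * exp (- V s)) \<le> norm (L * (\<bar>a\<bar> * (normal_density 0 \<sigma> s * (s - 0)^0) + \<bar>b\<bar> * (normal_density 0 \<sigma> s * (s - 0)^2)))"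
        unfolding real_norm_def by (rule order_trans[OF _ abs_ge_self])
    qed
  qed simp
  then show ?thesis
    by (subst integrable_density) (auto simp: mult.commute)
qed

lemma integral_\<nu>: "f \<in> borel_measurable borel \<Longrightarrow> integral\<^sup>L \<nu> f = (\<integral>s. exp (- V s) * f s \<partial>lborel)"
  by (subst integral_density) auto

lemma prob_space_\<nu>: "prob_space \<nu>"
proof
  have "emeasure \<nu> (space \<nu>) = (\<integral>\<^sup>+s. ennreal (exp (- V s)) \<partial>lborel)"
    by (simp add: emeasure_density)
  also have "\<dots> = 1"
    using normalized by (subst nn_integral_eq_integral) (auto simp: has_bochner_integral_iff)
  finally show "emeasure \<nu> (space \<nu>) = 1" .
qed

sublocale \<nu>: prob_space \<nu> by (rule prob_space_\<nu>)

lemma total_mass [simp]: "measure \<nu> UNIV = 1"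
  using \<nu>.prob_space by simp

lemma integral_id: "(\<integral>s. s \<partial>\<nu>) = M"
  using mean by (subst integral_\<nu>) (auto simp: has_bochner_integral_iff mult.commute)

lemma abs_le_quadratic: "\<bar>a\<bar> * \<bar>s\<bar> \<le> \<bar>a\<bar> + \<bar>a\<bar> * (s::real)\<^sup>2"
proof -
  have "\<bar>s\<bar> \<le> 1 + s\<^sup>2"
    using zero_le_power2[of "\<bar>s\<bar> - 1/2"] by (simp add: power2_eq_square algebra_simps)
  then show ?thesis
    by (metis abs_ge_zero distrib_left mult.right_neutral mult_left_mono)
qed

lemma product_le_quadratic:
  assumes "\<bar>f\<bar> \<le> a + b * \<bar>s\<bar>" "\<bar>g\<bar> \<le> c + d * \<bar>s\<bar>" "0 \<le> a" "0 \<le> b" "0 \<le> c" "0 \<le> d"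
  shows "\<bar>f * g\<bar> \<le> (a + b) * (c + d) * 2 + (a + b) * (c + d) * 2 * (s::real)\<^sup>2"
proof -
  have "\<bar>f * g\<bar> \<le> (a + b * \<bar>s\<bar>) * (c + d * \<bar>s\<bar>)"
    unfolding abs_mult using assms by (intro mult_mono) auto
  also have "\<dots> \<le> ((a + b) * (1 + \<bar>s\<bar>)) * ((c + d) * (1 + \<bar>s\<bar>))"
    using assms by (intro mult_mono) (auto simp: algebra_simps)
  also have "\<dots> = (a + b) * (c + d) * (1 + \<bar>s\<bar>)\<^sup>2"
    by (simp add: power2_eq_square)
  also have "\<dots> \<le> (a + b) * (c + d) * (2 + 2 * s\<^sup>2)"
  proof (rule mult_left_mono)
    show "(1 + \<bar>s\<bar>)\<^sup>2 \<le> 2 + 2 * s\<^sup>2"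
      using zero_le_power2[of "\<bar>s\<bar> - 1"] by (simp add: power2_eq_square algebra_simps)
  qed (use assms in auto)
  finally show ?thesis by (simp add: algebra_simps)
qed

lemma V'_growth: "\<bar>deriv V s\<bar> \<le> \<bar>deriv V 0\<bar> + Cp * \<bar>s\<bar>"
  using V'_lipschitz[of s 0] by auto

text \<open>Since \<open>p\<close> is merely measurable, the fundamental theorem of calculus is used for the gauge integral,
which does not ask for a continuous derivative. The boundary terms vanish because \<open>f\<close> grows
linearly and the density has Gaussian tails.\<close>

lemma integration_by_parts:
  assumes f: "\<And>s. (f has_real_derivative p s) (at s)" and p: "\<And>s. 0 \<le> p s \<and> p s \<le> 1"
    and [measurable]: "p \<in> borel_measurable borel"
  shows "(\<integral>s. deriv V s * f s \<partial>\<nu>) = (\<integral>s. p s \<partial>\<nu>)"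
    and "mono f" and "\<bar>f s\<bar> \<le> \<bar>f 0\<bar> + \<bar>s\<bar>" and "f \<in> borel_measurable borel"
proof -
  have "continuous_on UNIV f"
    using f DERIV_isCont continuous_at_imp_continuous_on by blast
  then show [measurable]: "f \<in> borel_measurable borel"
    by (rule borel_measurable_continuous_onI)
  show "mono f"
    using f p by (intro monoI) (meson DERIV_nonneg_imp_nondecreasing)
  have le: "f s - f r \<le> s - r" if "r \<le> s" for r s
  proof -
    have "s - f s \<ge> r - f r"
      using that
    proof (rule DERIV_nonneg_imp_nondecreasing)
      fix q
      have "((\<lambda>s. s - f s) has_real_derivative 1 - p q) (at q)"
        by (auto intro!: derivative_eq_intros f)
      then show "\<exists>y. ((\<lambda>s. s - f s) has_real_derivative y) (at q) \<and> 0 \<le> y"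
        using p[of q] by (intro exI conjI) auto
    qed
    then show ?thesis by simp
  qed
  have growth: "\<bar>f s\<bar> \<le> \<bar>f 0\<bar> + \<bar>s\<bar>" for s
    using le[of 0 s] le[of s 0] \<open>mono f\<close>[THEN monoD, of 0 s] \<open>mono f\<close>[THEN monoD, of s 0]
    by (cases "0 \<le> s") auto
  then show "\<bar>f s\<bar> \<le> \<bar>f 0\<bar> + \<bar>s\<bar>" .
  define g where "g = (\<lambda>s. exp (- V s) * (p s - deriv V s * f s))"
  have i1: "integrable \<nu> p"
    using p by (intro integrable_quadratic_growth[where a = 1 and b = 0]) (auto simp: abs_le_iff intro: order_trans[of _ 0])
  have i2: "integrable \<nu> (\<lambda>s. deriv V s * f s)"
  proof (rule integrable_quadratic_growth)
    show "\<bar>deriv V s * f s\<bar> \<le> (\<bar>deriv V 0\<bar> + Cp) * (\<bar>f 0\<bar> + 1) * 2 + (\<bar>deriv V 0\<bar> + Cp) * (\<bar>f 0\<bar> + 1) * 2 * s\<^sup>2" for s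
      using growth[of s] V'_growth[of s] constants by (intro product_le_quadratic) auto
  qed simp
  have g_int: "integrable lborel g"
    using Bochner_Integration.integrable_diff[OF i1 i2] unfolding g_def by (subst (asm) integrable_density) auto
  have "(\<lambda>n. LBINT s:{- real n..real n}. g s) \<longlonglongrightarrow> (\<integral>s. g s \<partial>lborel)"
    unfolding set_lebesgue_integral_def
  proof (rule integral_dominated_convergence[where w = "\<lambda>s. \<bar>g s\<bar>"])
    show "AE s in lborel. (\<lambda>n. indicator {- real n..real n} s *\<^sub>R g s) \<longlonglongrightarrow> g s"
    proof (rule AE_I2)
      fix s :: real
      obtain n0 :: nat where "\<bar>s\<bar> \<le> n0" using real_arch_simple by blast
      then have "eventually (\<lambda>n. indicator {- real n..real n} s *\<^sub>R g s = g s) sequentially"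
        by (intro eventually_sequentiallyI[of n0]) (auto simp: indicator_def intro: order_trans)
      then show "(\<lambda>n. indicator {- real n..real n} s *\<^sub>R g s) \<longlonglongrightarrow> g s"
        by (rule tendsto_eventually)
    qed
    show "AE s in lborel. norm (indicator {- real n..real n} s *\<^sub>R g s) \<le> \<bar>g s\<bar>" for n
      by (auto split: split_indicator)
  qed (use g_int in auto)
  moreover have "(LBINT s:{- real n..real n}. g s)
      = f (real n) * exp (- V (real n)) - f (- real n) * exp (- V (- real n))" for n
  proof -
    have "((\<lambda>s. f s * exp (- V s)) has_real_derivative g s) (at s)" for s
      unfolding g_def by (auto intro!: derivative_eq_intros f DERIV_V simp: algebra_simps)
    then have "(g has_integral f (real n) * exp (- V (real n)) - f (- real n) * exp (- V (- real n))) {- real n..real n}"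
      by (intro fundamental_theorem_of_calculus)
        (auto simp: has_real_derivative_iff_has_vector_derivative[symmetric] intro: DERIV_subset)
    moreover have "set_integrable lborel {- real n..real n} g"
      using g_int unfolding set_integrable_def by (intro integrable_mult_indicator) auto
    ultimately show ?thesis
      using set_borel_integral_eq_integral(2) integral_unique by metis
  qed
  moreover have "(\<lambda>n. f (real n) * exp (- V (real n)) - f (- real n) * exp (- V (- real n))) \<longlonglongrightarrow> 0 - 0"
  proof -
    obtain K where K: "0 \<le> K" "\<And>s. exp (- V s) \<le> K * exp (- (Cm / 4 * s\<^sup>2))"
      using gaussian_bound by blast
    let ?q = "\<lambda>n. Cm / 4 * (real n)\<^sup>2"
    have q: "filterlim ?q at_top sequentially"
      using constants
      by (intro filterlim_tendsto_pos_mult_at_top[OF tendsto_const] filterlim_pow_at_top filterlim_real_sequentially) auto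
    have l0: "(\<lambda>n. ?q n ^ 1 / exp (?q n)) \<longlonglongrightarrow> 0" "(\<lambda>n. ?q n ^ 0 / exp (?q n)) \<longlonglongrightarrow> 0"
      using filterlim_compose[OF tendsto_power_div_exp_0 q] by blast+
    define R where "R = (\<lambda>n. (\<bar>f 0\<bar> + 1) * K * (?q n ^ 0 / exp (?q n) + 4 / Cm * (?q n ^ 1 / exp (?q n))))"
    \<comment> \<open>With \<open>q = Cm / 4 * s\<^sup>2\<close> the boundary terms are bounded by a combination of \<open>exp (- q)\<close> and \<open>q * exp (- q)\<close>.\<close>
    have R: "R \<longlonglongrightarrow> (\<bar>f 0\<bar> + 1) * K * (0 + 4 / Cm * 0)"
      unfolding R_def by (intro tendsto_intros l0)
    have b: "\<bar>f s * exp (- V s)\<bar> \<le> R n" if "s = real n \<or> s = - real n" for s n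
    proof -
      have s2: "s\<^sup>2 = (real n)\<^sup>2" using that by auto
      have "\<bar>f s\<bar> \<le> (\<bar>f 0\<bar> + 1) * (1 + s\<^sup>2)"
      proof -
        have "\<bar>s\<bar> \<le> 1 + s\<^sup>2" using abs_le_quadratic[of 1 s] by simp
        moreover have "0 \<le> \<bar>f 0\<bar> * s\<^sup>2" by simp
        ultimately have "\<bar>f 0\<bar> + \<bar>s\<bar> \<le> \<bar>f 0\<bar> + \<bar>f 0\<bar> * s\<^sup>2 + (1 + s\<^sup>2)" by linarith
        then show ?thesis using growth[of s] by (simp add: algebra_simps)
      qed
      then have "\<bar>f s\<bar> * exp (- V s) \<le> ((\<bar>f 0\<bar> + 1) * (1 + s\<^sup>2)) * (K * exp (- (Cm / 4 * s\<^sup>2)))"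
        using K by (intro mult_mono) auto
      also have "\<dots> = R n"
        using constants unfolding R_def s2 by (simp add: exp_minus field_simps)
      finally show ?thesis by (simp add: abs_mult)
    qed
    have R0: "R \<longlonglongrightarrow> 0" using R by simp
    have "(\<lambda>n. f (real n) * exp (- V (real n))) \<longlonglongrightarrow> 0"
      using b by (intro Lim_null_comparison[OF _ R0]) auto
    moreover have "(\<lambda>n. f (- real n) * exp (- V (- real n))) \<longlonglongrightarrow> 0"
      using b by (intro Lim_null_comparison[OF _ R0]) auto
    ultimately show ?thesis by (intro tendsto_diff)
  qed
  ultimately have "(\<integral>s. g s \<partial>lborel) = 0"
    using LIMSEQ_unique by fastforce
  then have "(\<integral>s. p s - deriv V s * f s \<partial>\<nu>) = 0"
    unfolding g_def by (subst integral_\<nu>) auto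
  then show "(\<integral>s. deriv V s * f s \<partial>\<nu>) = (\<integral>s. p s \<partial>\<nu>)"
    using i1 i2 by simp
qed

lemma integrable_affine_growth:
  assumes [measurable]: "f \<in> borel_measurable borel" and f: "\<And>s. \<bar>f s\<bar> \<le> a + b * \<bar>s\<bar>" "0 \<le> b"
  shows "integrable \<nu> f"
proof (rule integrable_quadratic_growth)
  show "\<bar>f s\<bar> \<le> (a + b) + b * s\<^sup>2" for s
    using f(1)[of s] abs_le_quadratic[of b s] f(2) by auto
qed simp

lemma integral_V': "(\<integral>s. deriv V s \<partial>\<nu>) = 0"
  using integration_by_parts(1)[of "\<lambda>_. 1" "\<lambda>_. 0"] by simp

lemma integrable_V': "integrable \<nu> (deriv V)"
  using V'_growth constants by (intro integrable_affine_growth) auto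

lemma integrable_id: "integrable \<nu> (\<lambda>s. s)"
  by (intro integrable_affine_growth[of _ 0 1]) auto

text \<open>A continuous function with mean \<open>0\<close> has a zero \<open>r\<close>, and there \<open>k s\<close> and \<open>f s - f r\<close> have the same sign;
this avoids the product measure of the usual proof.\<close>

lemma chebyshev:
  fixes k f :: "real \<Rightarrow> real"
  assumes k: "mono k" "continuous_on UNIV k" "(\<integral>s. k s \<partial>\<nu>) = 0" "integrable \<nu> k"
    and f: "mono f" "integrable \<nu> (\<lambda>s. k s * f s)"
  shows "0 \<le> (\<integral>s. k s * f s \<partial>\<nu>)"
proof -
  obtain r where r: "k r = 0"
  proof -
    have "\<exists>s. k s \<le> 0"
      using \<nu>.expectation_greater[OF k(4), of 0] k(3) by (metis AE_I2 less_irrefl not_le)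
    then obtain p where p: "k p \<le> 0" by blast
    have "\<exists>s. 0 \<le> k s"
      using \<nu>.expectation_less[OF k(4), of 0] k(3) by (metis AE_I2 less_irrefl not_le)
    then obtain q where q: "0 \<le> k q" by blast
    show ?thesis
    proof (cases "p \<le> q")
      case True
      then show ?thesis
        using IVT'[of k p 0 q, OF p q True continuous_on_subset[OF k(2) subset_UNIV]] that by auto
    next
      case False
      then have "k q \<le> k p" by (intro monoD[OF k(1)]) simp
      then have "k q = 0" using p q by simp
      then show ?thesis by (rule that)
    qed
  qed
  have "0 \<le> k s * (f s - f r)" for s
  proof (cases "r \<le> s")
    case True
    then show ?thesis
      using monoD[OF k(1) True] monoD[OF f(1) True] r by simp
  next
    case False
    then have "s \<le> r" by simp
    then show ?thesis
      using monoD[OF k(1), of s r] monoD[OF f(1), of s r] r by (intro mult_nonpos_nonpos) auto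
  qed
  then have "0 \<le> (\<integral>s. k s * (f s - f r) \<partial>\<nu>)" by simp
  also have "\<dots> = (\<integral>s. k s * f s \<partial>\<nu>) - (\<integral>s. k s \<partial>\<nu>) * f r"
    using f(2) k(4) by (simp add: right_diff_distrib)
  finally show ?thesis using k(3) by simp
qed

text \<open>Both bounds are the correlation inequality for \<open>s - M - V' s / C\<close>, with \<open>C = Cp\<close> and, after a change
of sign, \<open>C = Cm\<close>.\<close>

lemma covariance_sandwich:
  assumes f: "\<And>s. (f has_real_derivative p s) (at s)" and p: "\<And>s. 0 \<le> p s \<and> p s \<le> 1"
    and [measurable]: "p \<in> borel_measurable borel"
  shows "1 / Cp * (\<integral>s. p s \<partial>\<nu>) \<le> (\<integral>s. (s - M) * f s \<partial>\<nu>)"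
    "(\<integral>s. (s - M) * f s \<partial>\<nu>) \<le> 1 / Cm * (\<integral>s. p s \<partial>\<nu>)"
proof -
  note ibp = integration_by_parts[OF f p]
  have [measurable]: "f \<in> borel_measurable borel" by (rule ibp(4)) simp_all
  have iVf: "integrable \<nu> (\<lambda>s. deriv V s * f s)"
  proof (rule integrable_quadratic_growth)
    show "\<bar>deriv V s * f s\<bar> \<le> (\<bar>deriv V 0\<bar> + Cp) * (\<bar>f 0\<bar> + 1) * 2 + (\<bar>deriv V 0\<bar> + Cp) * (\<bar>f 0\<bar> + 1) * 2 * s\<^sup>2" for s
      using ibp(3)[of s] V'_growth[of s] constants by (intro product_le_quadratic) auto
  qed simp
  have ief: "integrable \<nu> (\<lambda>s. (s - M) * f s)"
  proof (rule integrable_quadratic_growth)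
    show "\<bar>(s - M) * f s\<bar> \<le> (\<bar>M\<bar> + 1) * (\<bar>f 0\<bar> + 1) * 2 + (\<bar>M\<bar> + 1) * (\<bar>f 0\<bar> + 1) * 2 * s\<^sup>2" for s
      using ibp(3)[of s] by (intro product_le_quadratic) auto
  qed simp
  have *: "0 \<le> (\<integral>s. e * (s - M - deriv V s / C) * f s \<partial>\<nu>)" if "mono (\<lambda>s. e * (s - M - deriv V s / C))" for e C
  proof (rule chebyshev[OF that])
    show "continuous_on UNIV (\<lambda>s. e * (s - M - deriv V s / C))"
      by (cases "C = 0") (auto intro!: continuous_intros continuous_V')
    show "(\<integral>s. e * (s - M - deriv V s / C) \<partial>\<nu>) = 0" "integrable \<nu> (\<lambda>s. e * (s - M - deriv V s / C))"
      using integrable_V' integrable_id by (simp_all add: integral_id integral_V' \<nu>.prob_space)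
    have "integrable \<nu> (\<lambda>s. e * ((s - M) * f s - deriv V s * f s / C))"
      using ief iVf by auto
    then show "integrable \<nu> (\<lambda>s. e * (s - M - deriv V s / C) * f s)"
      by (simp add: algebra_simps)
    show "mono f" by (rule ibp(2)) simp
  qed
  have eq: "(\<integral>s. e * (s - M - deriv V s / C) * f s \<partial>\<nu>) = e * ((\<integral>s. (s - M) * f s \<partial>\<nu>) - (\<integral>s. p s \<partial>\<nu>) / C)" for e C
  proof -
    have "(\<integral>s. e * (s - M - deriv V s / C) * f s \<partial>\<nu>) = (\<integral>s. e * ((s - M) * f s - deriv V s * f s / C) \<partial>\<nu>)"
      by (simp add: algebra_simps)
    also have "\<dots> = e * ((\<integral>s. (s - M) * f s \<partial>\<nu>) - (\<integral>s. deriv V s * f s \<partial>\<nu>) / C)"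
      using ief iVf by simp
    finally show ?thesis using ibp(1) by simp
  qed
  show "1 / Cp * (\<integral>s. p s \<partial>\<nu>) \<le> (\<integral>s. (s - M) * f s \<partial>\<nu>)"
    using *[of 1 Cp] eq[of 1 Cp] V'_ratio_mono(1) by simp
  show "(\<integral>s. (s - M) * f s \<partial>\<nu>) \<le> 1 / Cm * (\<integral>s. p s \<partial>\<nu>)"
    using *[of "-1" Cm] eq[of "-1" Cm] V'_ratio_mono(2) by simp
qed

lemma integrable_square: "integrable \<nu> (\<lambda>s. s\<^sup>2)"
  by (intro integrable_quadratic_growth[of _ 0 1]) auto

text \<open>This is the upper bound of \<open>covariance_sandwich\<close> for the identity. Together with the two lemmas below it
gives estimates that depend only on \<open>M\<close>, \<open>Cm\<close> and \<open>Cp\<close>, hence are uniform over the graph.\<close>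

lemma second_moment_le: "(\<integral>s. s\<^sup>2 \<partial>\<nu>) \<le> 1 / Cm + M\<^sup>2"
proof -
  have "(\<integral>s. (s - M) * s \<partial>\<nu>) \<le> 1 / Cm * (\<integral>s. 1 \<partial>\<nu>)"
    by (rule covariance_sandwich(2)) (auto intro!: derivative_eq_intros)
  moreover have "(\<integral>s. (s - M) * s \<partial>\<nu>) = (\<integral>s. s\<^sup>2 \<partial>\<nu>) - M * M"
    using integrable_square integrable_id
    by (simp add: left_diff_distrib integral_id flip: power2_eq_square)
  ultimately show ?thesis
    using \<nu>.prob_space by (simp add: power2_eq_square)
qed

lemma abs_moment_le: "(\<integral>s. \<bar>s\<bar> \<partial>\<nu>) \<le> 1 + 1 / Cm + M\<^sup>2"
proof -
  have "(\<integral>s. \<bar>s\<bar> \<partial>\<nu>) \<le> (\<integral>s. 1 + s\<^sup>2 \<partial>\<nu>)"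
    using integrable_square integrable_id abs_le_quadratic[of 1] by (intro integral_mono) auto
  also have "\<dots> = 1 + (\<integral>s. s\<^sup>2 \<partial>\<nu>)"
    using integrable_square \<nu>.prob_space by simp
  finally show ?thesis using second_moment_le by simp
qed

text \<open>\<open>V' 0\<close> is the mean of \<open>V' 0 - V' s\<close>, which is at most \<open>Cp * \<bar>s\<bar>\<close> in absolute value.\<close>

lemma abs_V'_0_le: "\<bar>deriv V 0\<bar> \<le> Cp * (1 + 1 / Cm + M\<^sup>2)"
proof -
  have "\<bar>deriv V 0\<bar> = \<bar>\<integral>s. deriv V 0 - deriv V s \<partial>\<nu>\<bar>"
    using integrable_V' integral_V' \<nu>.prob_space by simp
  also have "\<dots> \<le> (\<integral>s. \<bar>deriv V 0 - deriv V s\<bar> \<partial>\<nu>)"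
    by (rule integral_abs_bound)
  also have "\<dots> \<le> (\<integral>s. Cp * \<bar>s\<bar> \<partial>\<nu>)"
    using integrable_V' integrable_id V'_lipschitz[of 0] by (intro integral_mono) auto
  also have "\<dots> = Cp * (\<integral>s. \<bar>s\<bar> \<partial>\<nu>)" by simp
  finally show ?thesis
    using abs_moment_le constants by (smt (verit) mult_left_mono)
qed

end

section \<open>Random paths as functions of time\<close>

text \<open>The approximations evaluate the process at the first grid point strictly to the right of the
current time. Negative times are mapped to \<open>0\<close>, because nothing is known about the process there;
on the intervals \<open>{0..t}\<close> over which it is integrated this makes no difference.\<close>

lemma right_continuous_joint_measurable:
  fixes f :: "real \<Rightarrow> 'w \<Rightarrow> real"
  assumes meas: "\<And>t. 0 \<le> t \<Longrightarrow> f t \<in> borel_measurable N"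
    and rc: "\<And>\<omega> t. \<omega> \<in> space N \<Longrightarrow> 0 \<le> t \<Longrightarrow> ((\<lambda>s. f s \<omega>) \<longlongrightarrow> f t \<omega>) (at_right t)"
  shows "(\<lambda>(t, \<omega>). f (max 0 t) \<omega>) \<in> borel_measurable (borel \<Otimes>\<^sub>M N)"
proof -
  define \<tau> where "\<tau> = (\<lambda>(n::nat) (k::nat). (real k + 1) / (real n + 1))"
  define g where "g = (\<lambda>(n::nat) (t::real). nat \<lfloor>(real n + 1) * max 0 t\<rfloor>)"
  have gt: "max 0 t < \<tau> n (g n t)" and le: "\<tau> n (g n t) \<le> max 0 t + 1 / (real n + 1)" for n and t :: real
  proof -
    have r: "real (g n t) = of_int \<lfloor>(real n + 1) * max 0 t\<rfloor>"
      unfolding g_def by (subst of_nat_nat) auto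
    define m where "m = max 0 t"
    have "(real n + 1) * m < real (g n t) + 1" "real (g n t) \<le> (real n + 1) * m"
      unfolding r m_def by linarith+
    then have "m < (real (g n t) + 1) / (real n + 1)" "real (g n t) / (real n + 1) \<le> m"
      by (simp_all add: pos_less_divide_eq pos_divide_le_eq mult.commute)
    then show "max 0 t < \<tau> n (g n t)" "\<tau> n (g n t) \<le> max 0 t + 1 / (real n + 1)"
      unfolding \<tau>_def m_def by (simp_all add: add_divide_distrib)
  qed
  have [measurable]: "g n \<in> borel \<rightarrow>\<^sub>M count_space UNIV" for n
    unfolding g_def by measurable
  show ?thesis
  proof (rule borel_measurable_LIMSEQ_real)
    show "(\<lambda>(t, \<omega>). f (\<tau> n (g n t)) \<omega>) \<in> borel_measurable (borel \<Otimes>\<^sub>M N)" for n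
    proof -
      have "(\<lambda>x. (\<lambda>k x. f (\<tau> n k) (snd x)) (g n (fst x)) x) \<in> borel_measurable (borel \<Otimes>\<^sub>M N)"
      proof (rule measurable_compose_countable)
        fix k
        have [measurable]: "f (\<tau> n k) \<in> borel_measurable N"
          by (intro meas) (auto simp: \<tau>_def)
        show "(\<lambda>x. f (\<tau> n k) (snd x)) \<in> borel_measurable (borel \<Otimes>\<^sub>M N)"
          by measurable
      qed measurable
      then show ?thesis by (simp add: split_beta')
    qed
    fix x :: "real \<times> 'w" assume "x \<in> space (borel \<Otimes>\<^sub>M N)"
    then obtain t \<omega> where x: "x = (t, \<omega>)" and \<omega>: "\<omega> \<in> space N"
      by (auto simp: space_pair_measure)
    have "filterlim (\<lambda>n. \<tau> n (g n t)) (at_right (max 0 t)) sequentially"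
    proof (rule tendsto_imp_filterlim_at_right)
      show "(\<lambda>n. \<tau> n (g n t)) \<longlonglongrightarrow> max 0 t"
      proof (rule tendsto_sandwich)
        show "\<forall>\<^sub>F n in sequentially. max 0 t \<le> \<tau> n (g n t)"
          using gt[of t] by (intro always_eventually allI less_imp_le)
        show "\<forall>\<^sub>F n in sequentially. \<tau> n (g n t) \<le> max 0 t + 1 / (real n + 1)"
          using le[of _ t] by (intro always_eventually allI)
        have "(\<lambda>n. 1 / (real n + 1)) \<longlonglongrightarrow> 0"
          using LIMSEQ_inverse_real_of_nat by (simp add: inverse_eq_divide add.commute)
        from tendsto_add[OF tendsto_const this, of "max 0 t"]
        show "(\<lambda>n. max 0 t + 1 / (real n + 1)) \<longlonglongrightarrow> max 0 t" by simp
      qed auto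
    qed (use gt in auto)
    then have "(\<lambda>n. f (\<tau> n (g n t)) \<omega>) \<longlonglongrightarrow> f (max 0 t) \<omega>"
      using rc[OF \<omega>, of "max 0 t"] by (auto intro: filterlim_compose)
    then show "(\<lambda>n. case x of (t, \<omega>) \<Rightarrow> f (\<tau> n (g n t)) \<omega>) \<longlonglongrightarrow> (case x of (t, \<omega>) \<Rightarrow> f (max 0 t) \<omega>)"
      by (simp add: x)
  qed
qed

lemma right_continuous_joint_measurable':
  fixes f :: "real \<Rightarrow> 'w \<Rightarrow> real"
  assumes "\<And>t. 0 \<le> t \<Longrightarrow> f t \<in> borel_measurable N"
    and "\<And>\<omega>. \<omega> \<in> space N \<Longrightarrow> continuous_on {0..} (\<lambda>t. f t \<omega>)"
  shows "(\<lambda>(t, \<omega>). f (max 0 t) \<omega>) \<in> borel_measurable (borel \<Otimes>\<^sub>M N)"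
proof (rule right_continuous_joint_measurable)
  fix \<omega> t assume *: "\<omega> \<in> space N" "0 \<le> (t::real)"
  then have "((\<lambda>s. f s \<omega>) \<longlongrightarrow> f t \<omega>) (at t within {0..})"
    using assms(2) by (auto simp: continuous_on_def)
  then show "((\<lambda>s. f s \<omega>) \<longlongrightarrow> f t \<omega>) (at_right t)"
    using * by (elim tendsto_within_subset) auto
qed fact

section \<open>Step functions of time and their jumps\<close>

definition jumps :: "(real \<Rightarrow> 'v) \<Rightarrow> 'v \<Rightarrow> 'v \<Rightarrow> real \<Rightarrow> real \<Rightarrow> real set" where
  "jumps p u v a b = {r \<in> {a<..b}. (\<forall>\<^sub>F q in at_left r. p q = u) \<and> p r = v}"

definition discontinuities :: "(real \<Rightarrow> 'v) \<Rightarrow> real \<Rightarrow> real \<Rightarrow> real set" where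
  "discontinuities p a b = {r \<in> {a<..b}. \<not> (\<forall>\<^sub>F q in at_left r. p q = p r)}"

lemma jump_count_eq: "jump_count X u v a b \<omega> = card (jumps (\<lambda>q. X q \<omega>) u v a b)"
  by (simp add: jump_count_def jumps_def)

lemma eventually_at_left_unique:
  assumes "\<forall>\<^sub>F q in at_left (r::real). p q = u" "\<forall>\<^sub>F q in at_left r. p q = v"
  shows "u = v"
proof -
  have "\<forall>\<^sub>F q in at_left r. u = v"
    using assms by eventually_elim simp
  then show ?thesis by (simp add: trivial_limit_at_left_real)
qed

lemma jumps_subset_discontinuities: "u \<noteq> v \<Longrightarrow> jumps p u v a b \<subseteq> discontinuities p a b"
proof
  fix r assume uv: "u \<noteq> v" and r: "r \<in> jumps p u v a b"
  then have "\<not> (\<forall>\<^sub>F q in at_left r. p q = p r)"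
    using eventually_at_left_unique[of p u r "p r"] by (auto simp: jumps_def)
  with r show "r \<in> discontinuities p a b" by (auto simp: jumps_def discontinuities_def)
qed

text \<open>The regularity of the paths of the walk. Statements about an interval follow from their local versions and
additivity by bisection (\<open>Bolzano\<close>).\<close>

locale jump_path =
  fixes p :: "real \<Rightarrow> 'v"
  assumes right_cont: "0 \<le> t \<Longrightarrow> \<forall>\<^sub>F q in at_right t. p q = p t"
    and left_lim: "0 < t \<Longrightarrow> \<exists>u. \<forall>\<^sub>F q in at_left t. p q = u"
begin

lemma locally_constant:
  assumes "0 \<le> x"
  obtains d u where "0 < d" "\<And>q. x \<le> q \<Longrightarrow> q < x + d \<Longrightarrow> p q = p x"
    "\<And>q. 0 \<le> q \<Longrightarrow> x - d < q \<Longrightarrow> q < x \<Longrightarrow> p q = u"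
proof -
  from right_cont[OF assms] obtain b where b: "x < b" "\<And>q. x < q \<Longrightarrow> q < b \<Longrightarrow> p q = p x"
    by (auto simp: eventually_at_right_field)
  show ?thesis
  proof (cases "x = 0")
    case True
    show ?thesis
    proof (rule that[of "b - x" "p x"])
      show "p q = p x" if "x \<le> q" "q < x + (b - x)" for q
        using b(2)[of q] that by (cases "q = x") auto
    qed (use b(1) True in simp_all)
  next
    case False
    with assms obtain u where "\<forall>\<^sub>F q in at_left x. p q = u"
      using left_lim[of x] by auto
    then obtain c where c: "c < x" "\<And>q. c < q \<Longrightarrow> q < x \<Longrightarrow> p q = u"
      by (auto simp: eventually_at_left_field)
    show ?thesis
    proof (rule that[of "min (b - x) (x - c)" u])
      show "p q = p x" if "x \<le> q" "q < x + min (b - x) (x - c)" for q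
        using b(2)[of q] that by (cases "q = x") auto
    qed (use b(1) c in simp_all)
  qed
qed

lemma isolated_discontinuities:
  assumes x: "0 \<le> x"
  shows "\<exists>d>0. \<forall>a b. a \<le> x \<and> x \<le> b \<and> b - a < d \<longrightarrow> 0 \<le> a \<longrightarrow> discontinuities p a b \<subseteq> {x}"
proof -
  obtain d u where d: "0 < d" and r: "\<And>q. x \<le> q \<Longrightarrow> q < x + d \<Longrightarrow> p q = p x"
    and l: "\<And>q. 0 \<le> q \<Longrightarrow> x - d < q \<Longrightarrow> q < x \<Longrightarrow> p q = u"
    using locally_constant[OF x] by metis
  have "discontinuities p a b \<subseteq> {x}" if ab: "a \<le> x" "x \<le> b" "b - a < d" "0 \<le> a" for a b
  proof (rule subsetI, rule ccontr)
    fix z assume z: "z \<in> discontinuities p a b" "z \<notin> {x}"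
    then have za: "a < z" "z \<le> b" and not: "\<not> (\<forall>\<^sub>F q in at_left z. p q = p z)"
      by (auto simp: discontinuities_def)
    have "\<forall>\<^sub>F q in at_left z. p q = p z"
    proof (cases "z < x")
      case True
      have "p q = p z" if "a < q" "q < z" for q
        using l[of q] l[of z] that za ab True by auto
      then show ?thesis using za by (auto simp: eventually_at_left_field)
    next
      case False
      have "p q = p z" if "x < q" "q < z" for q
        using r[of q] r[of z] that za ab False by auto
      then show ?thesis using z False by (auto simp: eventually_at_left_field intro!: exI[of _ x])
    qed
    with not show False by simp
  qed
  with d show ?thesis by blast
qed

lemma discontinuities_split:
  "a \<le> b \<Longrightarrow> b \<le> c \<Longrightarrow> discontinuities p a c = discontinuities p a b \<union> discontinuities p b c"
  by (auto simp: discontinuities_def)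

lemma finite_discontinuities:
  assumes "0 \<le> a" "a \<le> b"
  shows "finite (discontinuities p a b)"
proof -
  have "0 \<le> a \<longrightarrow> finite (discontinuities p a b)"
    using assms(2)
  proof (rule Bolzano)
    fix a b c :: real assume "0 \<le> a \<longrightarrow> finite (discontinuities p a b)"
      "0 \<le> b \<longrightarrow> finite (discontinuities p b c)" "a \<le> b" "b \<le> c"
    then show "0 \<le> a \<longrightarrow> finite (discontinuities p a c)"
      using discontinuities_split[of a b c] by simp
  next
    fix x assume "a \<le> x" "x \<le> b"
    then have "0 \<le> x" using assms(1) by simp
    from isolated_discontinuities[OF this] obtain d where "0 < d"
      and d: "\<And>a b. a \<le> x \<Longrightarrow> x \<le> b \<Longrightarrow> b - a < d \<Longrightarrow> 0 \<le> a \<Longrightarrow> discontinuities p a b \<subseteq> {x}"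
      by auto
    have "finite (discontinuities p a b)" if "a \<le> x \<and> x \<le> b \<and> b - a < d" "0 \<le> a" for a b
      using d[of a b] that by (meson finite.emptyI finite_insert finite_subset)
    with \<open>0 < d\<close> show "\<exists>d>0. \<forall>a b. a \<le> x \<and> x \<le> b \<and> b - a < d \<longrightarrow> 0 \<le> a \<longrightarrow> finite (discontinuities p a b)"
      by (intro exI[of _ d] conjI allI impI) simp_all
  qed
  with assms show ?thesis by simp
qed

lemma finite_jumps:
  assumes "0 \<le> a" "a \<le> b" "u \<noteq> v"
  shows "finite (jumps p u v a b)"
  using finite_subset[OF jumps_subset_discontinuities finite_discontinuities] assms by blast

lemma card_jumps_split:
  assumes "0 \<le> a" "a \<le> b" "b \<le> c" "u \<noteq> v"
  shows "card (jumps p u v a c) = card (jumps p u v a b) + card (jumps p u v b c)"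
proof -
  have "jumps p u v a c = jumps p u v a b \<union> jumps p u v b c" "jumps p u v a b \<inter> jumps p u v b c = {}"
    using assms by (auto simp: jumps_def)
  then show ?thesis
    using assms finite_jumps by (simp add: card_Un_disjoint)
qed

lemma constant_between_discontinuities:
  assumes "0 \<le> a" "a \<le> b" "discontinuities p a b = {}"
  shows "p a = p b"
proof -
  have "0 \<le> a \<longrightarrow> discontinuities p a b = {} \<longrightarrow> p a = p b"
    using assms(2)
  proof (rule Bolzano)
    fix a b c :: real assume "0 \<le> a \<longrightarrow> discontinuities p a b = {} \<longrightarrow> p a = p b"
      "0 \<le> b \<longrightarrow> discontinuities p b c = {} \<longrightarrow> p b = p c" "a \<le> b" "b \<le> c"
    then show "0 \<le> a \<longrightarrow> discontinuities p a c = {} \<longrightarrow> p a = p c"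
      using discontinuities_split[of a b c] by simp
  next
    fix x assume "a \<le> x" "x \<le> b"
    then have x: "0 \<le> x" using assms by simp
    obtain d u where d: "0 < d" and r: "\<And>q. x \<le> q \<Longrightarrow> q < x + d \<Longrightarrow> p q = p x"
      and l: "\<And>q. 0 \<le> q \<Longrightarrow> x - d < q \<Longrightarrow> q < x \<Longrightarrow> p q = u"
      using locally_constant[OF x] by metis
    have "p a = p b" if ab: "a \<le> x" "x \<le> b" "b - a < d" "0 \<le> a" "discontinuities p a b = {}" for a b
    proof -
      have "p b = p x" using r[of b] ab by auto
      moreover have "p a = p x"
      proof (cases "a = x")
        case False
        then have "a < x" using ab by simp
        then have "\<forall>\<^sub>F q in at_left x. p q = p x"
          using ab(2,5) by (auto simp: discontinuities_def)
        moreover have "p q = u" if "a < q" "q < x" for q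
          using l[of q] that ab by auto
        then have "\<forall>\<^sub>F q in at_left x. p q = u"
          unfolding eventually_at_left_field using \<open>a < x\<close> by blast
        ultimately have "p x = u" using eventually_at_left_unique by metis
        moreover have "p a = u" using l[of a] \<open>a < x\<close> ab by auto
        ultimately show ?thesis by simp
      qed simp
      ultimately show ?thesis by simp
    qed
    then show "\<exists>d>0. \<forall>a b. a \<le> x \<and> x \<le> b \<and> b - a < d \<longrightarrow> 0 \<le> a \<longrightarrow> discontinuities p a b = {} \<longrightarrow> p a = p b"
      using d by (intro exI[of _ d] conjI allI impI) simp_all
  qed
  with assms show ?thesis by simp
qed

lemma card_jumps_single:
  assumes ab: "0 \<le> a" "a \<le> b" and one: "discontinuities p a b \<subseteq> {x}" and uv: "u \<noteq> v"
  shows "card (jumps p u v a b) = (if p a = u \<and> p b = v then 1 else 0)"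
proof (cases "discontinuities p a b = {}")
  case True
  then have "jumps p u v a b = {}" using jumps_subset_discontinuities[OF uv, of p a b] by simp
  moreover have "p a = p b" using constant_between_discontinuities ab True by blast
  ultimately show ?thesis using uv by simp
next
  case False
  with one have dx: "discontinuities p a b = {x}" by auto
  then have x: "a < x" "x \<le> b" by (auto simp: discontinuities_def)
  have "discontinuities p x b \<subseteq> discontinuities p a b" "x \<notin> discontinuities p x b"
    using x(1) by (auto simp: discontinuities_def)
  then have "discontinuities p x b = {}"
    using subset_singletonD[of "discontinuities p x b" x] dx by auto
  then have pb: "p x = p b" using constant_between_discontinuities[of x b] x ab by simp
  have const: "p a = p q" if "a < q" "q < x" for q
  proof (rule constant_between_discontinuities)
    have "discontinuities p a q \<subseteq> discontinuities p a b" "x \<notin> discontinuities p a q"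
      using x that by (auto simp: discontinuities_def)
    then show "discontinuities p a q = {}"
      using subset_singletonD[of "discontinuities p a q" x] dx by auto
  qed (use that ab in auto)
  have ev: "\<forall>\<^sub>F q in at_left x. p q = p a"
    unfolding eventually_at_left_field using x const by metis
  show ?thesis
  proof (cases "p a = u \<and> p b = v")
    case True
    then have "x \<in> jumps p u v a b" using ev x pb by (simp add: jumps_def)
    then have "jumps p u v a b = {x}" using jumps_subset_discontinuities[OF uv, of p a b] dx by blast
    then show ?thesis using True by simp
  next
    case F: False
    have "jumps p u v a b = {}"
    proof (rule ccontr)
      assume "jumps p u v a b \<noteq> {}"
      then have "x \<in> jumps p u v a b"
        using subset_singletonD[of "jumps p u v a b" x] jumps_subset_discontinuities[OF uv, of p a b] dx by auto
      then have "\<forall>\<^sub>F q in at_left x. p q = u" "p x = v" by (auto simp: jumps_def)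
      then have "u = p a" using eventually_at_left_unique ev by metis
      with \<open>p x = v\<close> pb F show False by simp
    qed
    then show ?thesis using F by simp
  qed
qed

text \<open>Every path enters a state as often as it leaves it, up to its position at the two ends. The finite set
\<open>W\<close> contains the states at the ends of a partition that separates the jumps, so that the sums over
\<open>S\<close> miss none of them.\<close>

lemma flow_balance:
  assumes ab: "0 \<le> a" "a \<le> b"
  shows "\<exists>W. finite W \<and> (\<forall>S. finite S \<longrightarrow> W \<subseteq> S \<longrightarrow>
    of_bool (p b = v) + (\<Sum>u\<in>S - {v}. card (jumps p v u a b))
    = of_bool (p a = v) + (\<Sum>u\<in>S - {v}. card (jumps p u v a b)))" 
proof -
  let ?P = "\<lambda>a b W. finite W \<and> (\<forall>S. finite S \<longrightarrow> W \<subseteq> S \<longrightarrow>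
    of_bool (p b = v) + (\<Sum>u\<in>S - {v}. card (jumps p v u a b))
    = of_bool (p a = v) + (\<Sum>u\<in>S - {v}. card (jumps p u v a b)))"
  have "0 \<le> a \<longrightarrow> (\<exists>W. ?P a b W)"
    using ab(2)
  proof (rule Bolzano)
    fix a b c :: real
    assume 1: "0 \<le> a \<longrightarrow> (\<exists>W. ?P a b W)" and 2: "0 \<le> b \<longrightarrow> (\<exists>W. ?P b c W)"
      and abc: "a \<le> b" "b \<le> c"
    show "0 \<le> a \<longrightarrow> (\<exists>W. ?P a c W)"
    proof
      assume a: "0 \<le> a"
      with 1 2 abc obtain W1 W2 where W: "?P a b W1" "?P b c W2" by (meson order_trans)
      have "?P a c (W1 \<union> W2)"
      proof (intro conjI allI impI)
        fix S assume S: "finite S" "W1 \<union> W2 \<subseteq> S"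
        have "(\<Sum>u\<in>S - {v}. card (jumps p v u a c)) = (\<Sum>u\<in>S - {v}. card (jumps p v u a b)) + (\<Sum>u\<in>S - {v}. card (jumps p v u b c))"
          unfolding sum.distrib[symmetric] using a abc by (intro sum.cong card_jumps_split) auto
        moreover have "(\<Sum>u\<in>S - {v}. card (jumps p u v a c)) = (\<Sum>u\<in>S - {v}. card (jumps p u v a b)) + (\<Sum>u\<in>S - {v}. card (jumps p u v b c))"
          unfolding sum.distrib[symmetric] using a abc by (intro sum.cong card_jumps_split) auto
        moreover have "of_bool (p b = v) + (\<Sum>u\<in>S - {v}. card (jumps p v u a b))
            = of_bool (p a = v) + (\<Sum>u\<in>S - {v}. card (jumps p u v a b))"
          using W(1) S by simp
        moreover have "of_bool (p c = v) + (\<Sum>u\<in>S - {v}. card (jumps p v u b c))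
            = of_bool (p b = v) + (\<Sum>u\<in>S - {v}. card (jumps p u v b c))"
          using W(2) S by simp
        ultimately show "of_bool (p c = v) + (\<Sum>u\<in>S - {v}. card (jumps p v u a c))
            = of_bool (p a = v) + (\<Sum>u\<in>S - {v}. card (jumps p u v a c))"
          by linarith
      qed (use W in auto)
      then show "\<exists>W. ?P a c W" by blast
    qed
  next
    fix x assume "a \<le> x" "x \<le> b"
    then have "0 \<le> x" using ab by simp
    from isolated_discontinuities[OF this] obtain d where d: "0 < d"
      "\<And>a b. a \<le> x \<Longrightarrow> x \<le> b \<Longrightarrow> b - a < d \<Longrightarrow> 0 \<le> a \<Longrightarrow> discontinuities p a b \<subseteq> {x}"
      by auto
    \<comment> \<open>A short interval contains at most one jump, from \<open>p a\<close> to \<open>p b\<close>.\<close>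
    have W: "?P a b {p a, p b}" if "a \<le> x" "x \<le> b" "b - a < d" "0 \<le> a" for a b
    proof (intro conjI allI impI)
      fix S assume S: "finite S" "{p a, p b} \<subseteq> S"
      have c: "card (jumps p u w a b) = (if p a = u \<and> p b = w then 1 else 0)" if "u \<noteq> w" for u w
        using card_jumps_single[OF _ _ d(2) that] \<open>a \<le> x\<close> \<open>x \<le> b\<close> \<open>b - a < d\<close> \<open>0 \<le> a\<close> by simp
      have "(\<Sum>u\<in>S - {v}. card (jumps p v u a b)) = (\<Sum>u\<in>S - {v}. if p b = u then of_bool (p a = v) else 0)"
        by (intro sum.cong refl) (auto simp: c)
      also have "\<dots> = of_bool (p a = v \<and> p b \<noteq> v)"
        using S by (subst sum.delta') auto
      finally have 1: "(\<Sum>u\<in>S - {v}. card (jumps p v u a b)) = of_bool (p a = v \<and> p b \<noteq> v)" .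
      have "(\<Sum>u\<in>S - {v}. card (jumps p u v a b)) = (\<Sum>u\<in>S - {v}. if p a = u then of_bool (p b = v) else 0)"
        by (intro sum.cong refl) (auto simp: c)
      also have "\<dots> = of_bool (p b = v \<and> p a \<noteq> v)"
        using S by (subst sum.delta') auto
      finally have 2: "(\<Sum>u\<in>S - {v}. card (jumps p u v a b)) = of_bool (p b = v \<and> p a \<noteq> v)" .
      show "of_bool (p b = v) + (\<Sum>u\<in>S - {v}. card (jumps p v u a b))
          = of_bool (p a = v) + (\<Sum>u\<in>S - {v}. card (jumps p u v a b))"
        unfolding 1 2 by auto
    qed auto
    show "\<exists>d>0. \<forall>a b. a \<le> x \<and> x \<le> b \<and> b - a < d \<longrightarrow> 0 \<le> a \<longrightarrow> (\<exists>W. ?P a b W)"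
    proof (intro exI[of _ d] conjI allI impI d(1))
      fix a b assume "a \<le> x \<and> x \<le> b \<and> b - a < d" "0 \<le> a"
      then have "?P a b {p a, p b}" by (intro W) auto
      then show "\<exists>W. ?P a b W" by (rule exI)
    qed
  qed
  with ab show ?thesis by simp
qed

definition grid_count :: "'v \<Rightarrow> 'v \<Rightarrow> real \<Rightarrow> real \<Rightarrow> nat \<Rightarrow> nat" where
  "grid_count u v a b n = (\<Sum>k<n. of_bool (p (a + (b - a) / n * real k) = u \<and> p (a + (b - a) / n * real (Suc k)) = v))"

text \<open>Once the mesh is smaller than the gaps between discontinuities, each cell contains at most one
of them, and the values at its ends reveal the jump. This makes the number of jumps a
measurable function of the path.\<close>

lemma eventually_grid_count:
  assumes ab: "0 \<le> a" "a \<le> b" and uv: "u \<noteq> v"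
  shows "\<forall>\<^sub>F n in sequentially. grid_count u v a b n = card (jumps p u v a b)"
proof -
  let ?S = "discontinuities p a b"
  have fin: "finite ?S" using finite_discontinuities ab by simp
  have "\<exists>\<delta>>0. \<forall>r\<in>?S. \<forall>r'\<in>?S. r \<noteq> r' \<longrightarrow> \<delta> \<le> \<bar>r - r'\<bar>"
  proof -
    let ?T = "insert 1 ((\<lambda>(r, r'). \<bar>r - r'\<bar>) ` {(r, r') \<in> ?S \<times> ?S. r \<noteq> r'})"
    have "finite {(r, r') \<in> ?S \<times> ?S. r \<noteq> r'}"
      by (rule finite_subset[of _ "?S \<times> ?S"]) (use fin in auto)
    then have f: "finite ?T" by simp
    show ?thesis
    proof (intro exI conjI ballI impI)
      show "0 < Min ?T" using f by (subst Min_gr_iff) auto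
      fix r r' assume "r \<in> ?S" "r' \<in> ?S" "r \<noteq> r'"
      then show "Min ?T \<le> \<bar>r - r'\<bar>" by (intro Min_le[OF f]) force
    qed
  qed
  then obtain \<delta> where \<delta>: "0 < \<delta>" "\<And>r r'. r \<in> ?S \<Longrightarrow> r' \<in> ?S \<Longrightarrow> r \<noteq> r' \<Longrightarrow> \<delta> \<le> \<bar>r - r'\<bar>"
    by blast
  obtain n0 :: nat where n0: "(b - a) / \<delta> < real n0"
    using reals_Archimedean2 by blast
  have "grid_count u v a b n = card (jumps p u v a b)" if n: "Suc n0 \<le> n" for n
  proof -
    define h where "h = (b - a) / n"
    have h0: "0 \<le> h" using ab by (simp add: h_def)
    have npos: "0 < real n" using n by auto
    have "(b - a) / \<delta> < real n" using n n0 by linarith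
    then have hd: "h < \<delta>" using \<delta>(1) npos by (simp add: h_def field_simps)
    have hn: "a + h * real n = b" using npos by (simp add: h_def)
    have "card (jumps p u v a (a + h * real m)) = (\<Sum>k<m. of_bool (p (a + h * real k) = u \<and> p (a + h * real (Suc k)) = v))"
      if "m \<le> n" for m
      using that
    proof (induction m)
      case 0
      have "jumps p u v a a = {}" by (auto simp: jumps_def)
      then show ?case by simp
    next
      case (Suc m)
      let ?c = "a + h * real m" and ?d = "a + h * real (Suc m)"
      have cd: "a \<le> ?c" "?c \<le> ?d" using h0 by (auto intro: mult_left_mono)
      have "h * real (Suc m) \<le> h * real n" using Suc.prems h0 by (intro mult_left_mono) auto
      then have db: "?d \<le> b" using hn by simp
      have sub: "discontinuities p ?c ?d \<subseteq> ?S"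
        using cd db by (auto simp: discontinuities_def)
      have "\<exists>x. discontinuities p ?c ?d \<subseteq> {x}"
      proof (rule ccontr)
        assume "\<not> ?thesis"
        then obtain r r' where rr: "r \<in> discontinuities p ?c ?d" "r' \<in> discontinuities p ?c ?d" "r \<noteq> r'"
          by (metis empty_subsetI insertI1 singletonD subsetI)
        then have "\<bar>r - r'\<bar> < ?d - ?c + 0 + \<delta> - h" using hd by (auto simp: discontinuities_def algebra_simps)
        moreover have "\<bar>r - r'\<bar> < h \<or> \<bar>r - r'\<bar> \<le> h" using rr by (auto simp: discontinuities_def algebra_simps)
        moreover have "\<delta> \<le> \<bar>r - r'\<bar>" using \<delta>(2) rr sub by blast
        ultimately show False using hd by linarith
      qed
      then obtain x where x: "discontinuities p ?c ?d \<subseteq> {x}" by blast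
      have c0: "0 \<le> ?c" using ab cd by linarith
      have "card (jumps p u v a ?d) = card (jumps p u v a ?c) + card (jumps p u v ?c ?d)"
        using card_jumps_split[OF ab(1) cd uv] .
      also have "card (jumps p u v ?c ?d) = of_bool (p ?c = u \<and> p ?d = v)"
        unfolding card_jumps_single[OF c0 cd(2) x uv] by simp
      finally show ?case using Suc by simp
    qed
    from this[of n] hn show ?thesis
      by (simp add: grid_count_def h_def)
  qed
  then show ?thesis
    by (intro eventually_sequentiallyI[of "Suc n0"])
qed

end

lemma jump_count_measurable:
  assumes X: "\<And>t. 0 \<le> t \<Longrightarrow> X t \<in> N \<rightarrow>\<^sub>M count_space UNIV"
    and path: "\<And>\<omega>. \<omega> \<in> space N \<Longrightarrow> jump_path (\<lambda>t. X t \<omega>)"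
    and ab: "0 \<le> a" "a \<le> b" and uv: "u \<noteq> v"
  shows "(\<lambda>\<omega>. real (jump_count X u v a b \<omega>)) \<in> borel_measurable N"
proof (rule borel_measurable_LIMSEQ_real)
  let ?g = "\<lambda>n \<omega>. jump_path.grid_count (\<lambda>t. X t \<omega>) u v a b n"
  fix \<omega> assume \<omega>: "\<omega> \<in> space N"
  interpret jump_path "\<lambda>t. X t \<omega>" by (rule path[OF \<omega>])
  show "(\<lambda>n. \<Sum>k<n. of_bool (X (a + (b - a) / n * real k) \<omega> = u \<and> X (a + (b - a) / n * real (Suc k)) \<omega> = v))
     \<longlonglongrightarrow> real (jump_count X u v a b \<omega>)"
    using eventually_grid_count[OF ab uv] unfolding jump_count_eq grid_count_def
    by (intro tendsto_eventually) (auto elim!: eventually_mono simp flip: of_nat_sum)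
next
  fix n :: nat
  have t: "0 \<le> a + (b - a) / n * real k" for k using ab by auto
  have [measurable]: "{\<omega> \<in> space N. X (a + (b - a) / n * real k) \<omega> = w} \<in> sets N" for k w
    using measurable_sets[OF X[OF t[of k]], of "{w}"] by (simp add: vimage_def Int_def conj_commute)
  have "(\<lambda>\<omega>. \<Sum>k<n. indicator ({\<omega> \<in> space N. X (a + (b - a) / n * real k) \<omega> = u} \<inter> {\<omega> \<in> space N. X (a + (b - a) / n * real (Suc k)) \<omega> = v}) \<omega> :: real)
    \<in> borel_measurable N"
    by (intro borel_measurable_sum borel_measurable_indicator sets.Int) measurable
  then show "(\<lambda>\<omega>. \<Sum>k<n. of_bool (X (a + (b - a) / n * real k) \<omega> = u \<and> X (a + (b - a) / n * real (Suc k)) \<omega> = v) :: real)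
    \<in> borel_measurable N"
    by (rule measurable_cong[THEN iffD1, rotated]) (auto intro!: sum.cong simp: indicator_def)
qed

text \<open>Fubini's theorem in the form in which it is used for processes on \<open>{0..t}\<close>.\<close>

lemma (in prob_space) time_fubini:
  fixes f :: "real \<Rightarrow> 'a \<Rightarrow> real"
  assumes meas: "(\<lambda>(s, \<omega>). f (max 0 s) \<omega>) \<in> borel_measurable (borel \<Otimes>\<^sub>M M)"
    and bound: "AE \<omega> in M. \<forall>s\<in>{0..t}. \<bar>f s \<omega>\<bar> \<le> C"
  shows "integrable M (\<lambda>\<omega>. LBINT s:{0..t}. f s \<omega>)"
    and "set_integrable lborel {0..t} (\<lambda>s. \<integral>\<omega>. f s \<omega> \<partial>M)"
    and "(\<integral>\<omega>. (LBINT s:{0..t}. f s \<omega>) \<partial>M) = (LBINT s:{0..t}. \<integral>\<omega>. f s \<omega> \<partial>M)"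
proof -
  interpret pair_sigma_finite lborel M ..
  let ?g = "\<lambda>(s, \<omega>). indicator {0..t} s *\<^sub>R f (max 0 s) \<omega>"
  have meas': "(\<lambda>(s, \<omega>). f (max 0 s) \<omega>) \<in> borel_measurable (lborel \<Otimes>\<^sub>M M)"
    using meas by (simp cong: measurable_cong_sets)
  have g[measurable]: "?g \<in> borel_measurable (lborel \<Otimes>\<^sub>M M)"
    using meas' by (auto simp: split_beta')
  have [measurable]: "f (max 0 s) \<in> borel_measurable M" for s
    using measurable_compose[OF measurable_Pair1' meas', of s] by simp
  have gf: "?g (s, \<omega>) = indicator {0..t} s *\<^sub>R f s \<omega>" for s \<omega>
    by (auto split: split_indicator)
  have AEs: "AE \<omega> in M. \<bar>f s \<omega>\<bar> \<le> C" if "s \<in> {0..t}" for s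
    using bound by eventually_elim (use that in auto)
  have int1: "integrable M (\<lambda>\<omega>. ?g (s, \<omega>))" for s
  proof (cases "s \<in> {0..t}")
    case True
    have "f (max 0 s) \<in> borel_measurable M" by measurable
    then have "integrable M (f s)"
      using True by (intro integrable_const_bound[OF AEs[OF True, folded real_norm_def]]) (simp add: max_def split: if_splits)
    then show ?thesis using True unfolding gf by simp
  qed simp
  have I: "integrable (lborel \<Otimes>\<^sub>M M) ?g"
  proof (rule Fubini_integrable)
    show "AE s in lborel. integrable M (\<lambda>\<omega>. ?g (s, \<omega>))" using int1 by simp
    show "integrable lborel (\<lambda>s. \<integral>\<omega>. norm (?g (s, \<omega>)) \<partial>M)"
    proof (rule Bochner_Integration.integrable_bound)
      show "integrable lborel (\<lambda>s. indicator {0..t} s *\<^sub>R \<bar>C\<bar>)"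
        using borel_integrable_atLeastAtMost'[of 0 t "\<lambda>_. \<bar>C\<bar>"] by (simp add: set_integrable_def)
      show "AE s in lborel. norm (\<integral>\<omega>. norm (?g (s, \<omega>)) \<partial>M) \<le> norm (indicator {0..t} s *\<^sub>R \<bar>C\<bar>)"
      proof (rule AE_I2)
        fix s
        show "norm (\<integral>\<omega>. norm (?g (s, \<omega>)) \<partial>M) \<le> norm (indicator {0..t} s *\<^sub>R \<bar>C\<bar>)"
        proof (cases "s \<in> {0..t}")
          case True
          have "(\<integral>\<omega>. norm (?g (s, \<omega>)) \<partial>M) \<le> \<bar>C\<bar>"
            using AEs[OF True] int1[of s] True unfolding gf
            by (intro integral_le_const) (auto elim!: eventually_mono)
          then show ?thesis using True by simp
        qed simp
      qed
      show "(\<lambda>s. \<integral>\<omega>. norm (?g (s, \<omega>)) \<partial>M) \<in> borel_measurable lborel"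
        by measurable
    qed
  qed measurable
  show "integrable M (\<lambda>\<omega>. LBINT s:{0..t}. f s \<omega>)"
    using integrable_snd[OF I] unfolding set_lebesgue_integral_def gf[symmetric] by simp
  have e: "indicator {0..t} s *\<^sub>R (\<integral>\<omega>. f s \<omega> \<partial>M) = (\<integral>\<omega>. ?g (s, \<omega>) \<partial>M)" for s
    unfolding gf by simp
  show "set_integrable lborel {0..t} (\<lambda>s. \<integral>\<omega>. f s \<omega> \<partial>M)"
    unfolding set_integrable_def e using integrable_fst[OF I] by simp
  show "(\<integral>\<omega>. (LBINT s:{0..t}. f s \<omega>) \<partial>M) = (LBINT s:{0..t}. \<integral>\<omega>. f s \<omega> \<partial>M)"
    unfolding set_lebesgue_integral_def e unfolding gf[symmetric] using Fubini_integral[OF I] by simp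
qed

section \<open>The Ginzburg-Landau equations\<close>

locale gl_system = bounded_graph E D + N: prob_space N
  for E :: "'v set set" and D :: nat and N :: "'w measure" +
  fixes A :: "('v \<times> 'v) set" and U :: "'v \<Rightarrow> real \<Rightarrow> real" and M Cm Cp :: real
    and B :: "'v \<times> 'v \<Rightarrow> real \<Rightarrow> 'w \<Rightarrow> real"
    and \<eta> :: "('v \<Rightarrow> real) \<Rightarrow> real \<Rightarrow> 'w \<Rightarrow> 'v \<Rightarrow> real"
  assumes orient: "orientation E A"
    and potential: "\<And>z. convex_potential (U z) M Cm Cp"
    and noise: "independent_BMs N A B"
    and process: "\<And>\<sigma>. tempered E \<sigma> \<Longrightarrow> gl_process E A U N B \<sigma> (\<eta> \<sigma>)"
begin

sublocale pot: convex_potential "U z" M Cm Cp for z by (rule potential)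

lemma Cp_pos: "0 < Cp" "0 \<le> Cp" "0 < Cm"
  using pot.constants by auto

definition incident :: "'v \<Rightarrow> ('v \<times> 'v) set" where
  "incident z = {b \<in> A. fst b = z \<or> snd b = z}"

definition other_end :: "'v \<Rightarrow> 'v \<times> 'v \<Rightarrow> 'v" where
  "other_end z b = (if fst b = z then snd b else fst b)"

lemma incident_bij: "bij_betw (other_end z) (incident z) (nbrs E z)"
proof -
  have bij: "bij_betw (\<lambda>(y, z). {y, z}) A E" using orient by (simp add: orientation_def)
  have e: "(\<lambda>(y, z). {y, z}) b = {z, other_end z b}" if "b \<in> incident z" for b
    using that by (cases b) (auto simp: incident_def other_end_def)
  show ?thesis
  proof (rule bij_betwI')
    fix b c assume bc: "b \<in> incident z" "c \<in> incident z"
    show "other_end z b = other_end z c \<longleftrightarrow> b = c"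
    proof
      assume "other_end z b = other_end z c"
      then have "(\<lambda>(y, z). {y, z}) b = (\<lambda>(y, z). {y, z}) c" using e bc by simp
      then show "b = c"
        using bij_betw_imp_inj_on[OF bij] bc by (intro inj_onD[of "\<lambda>(y, z). {y, z}" A]) (simp_all add: incident_def)
    qed simp
  next
    fix b assume b: "b \<in> incident z"
    then have "(\<lambda>(y, z). {y, z}) b \<in> E"
      by (intro bij_betwE[OF bij, rule_format]) (simp add: incident_def)
    then show "other_end z b \<in> nbrs E z" using e[OF b] by (simp add: nbrs_def)
  next
    fix w assume "w \<in> nbrs E z"
    then have "{z, w} \<in> E" by (simp add: nbrs_def)
    then have "{z, w} \<in> (\<lambda>(y, z). {y, z}) ` A"
      by (simp only: bij_betw_imp_surj_on[OF bij])
    then obtain b where b: "{z, w} = (\<lambda>(y, z). {y, z}) b" "b \<in> A"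
      by (rule imageE)
    then have "{z, w} = {fst b, snd b}" by (simp add: split_beta)
    then have "b \<in> incident z" "w = other_end z b"
      using b(2) by (auto simp: incident_def other_end_def doubleton_eq_iff)
    then show "\<exists>b\<in>incident z. w = other_end z b" by blast
  qed
qed

lemma finite_incident: "finite (incident z)" "card (incident z) \<le> D"
  using bij_betw_finite[OF incident_bij] bij_betw_same_card[OF incident_bij] degree[of z] by simp_all

lemma incident_not_loop: "b \<in> incident z \<Longrightarrow> other_end z b \<noteq> z"
  using bij_betwE[OF incident_bij[of z]] nbrs_irrefl[of z] by auto

definition site_noise :: "'v \<Rightarrow> real \<Rightarrow> 'w \<Rightarrow> real" where
  "site_noise z t \<omega> = (\<Sum>b\<in>incident z. sgn_at z b * (sqrt 2 * B b t \<omega>))"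

definition force :: "('v \<Rightarrow> real) \<Rightarrow> 'v \<Rightarrow> real \<Rightarrow> 'w \<Rightarrow> real" where
  "force \<sigma> w s \<omega> = deriv (U w) (\<eta> \<sigma> s \<omega> w)"

lemma path_measurable:
  "tempered E \<sigma> \<Longrightarrow> 0 \<le> t \<Longrightarrow> (\<lambda>\<omega>. \<eta> \<sigma> t \<omega> z) \<in> borel_measurable N"
  using process[of \<sigma>] by (auto simp: gl_process_def)

lemma path_continuous:
  "tempered E \<sigma> \<Longrightarrow> \<omega> \<in> space N \<Longrightarrow> continuous_on {0..} (\<lambda>t. \<eta> \<sigma> t \<omega> z)"
  using process[of \<sigma>] by (auto simp: gl_process_def)

lemma path_joint_measurable:
  assumes "tempered E \<sigma>"
  shows "(\<lambda>(t, \<omega>). \<eta> \<sigma> (max 0 t) \<omega> z) \<in> borel_measurable (borel \<Otimes>\<^sub>M N)"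
  by (rule right_continuous_joint_measurable') (use assms path_measurable path_continuous in auto)

lemma force_continuous:
  assumes "tempered E \<sigma>" "\<omega> \<in> space N"
  shows "continuous_on {0..} (\<lambda>t. force \<sigma> w t \<omega>)"
  unfolding force_def
  by (rule continuous_on_compose2[OF pot.continuous_V'[of UNIV] path_continuous[OF assms]]) auto

lemma force_set_integrable:
  assumes "tempered E \<sigma>" "\<omega> \<in> space N"
  shows "set_integrable lborel {0..t} (\<lambda>s. force \<sigma> w s \<omega>)"
  by (intro borel_integrable_atLeastAtMost' continuous_on_subset[OF force_continuous[OF assms]]) auto

lemma force_joint_measurable:
  assumes "tempered E \<sigma>"
  shows "(\<lambda>(t, \<omega>). force \<sigma> w (max 0 t) \<omega>) \<in> borel_measurable (borel \<Otimes>\<^sub>M N)"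
proof -
  note [measurable] = path_joint_measurable[OF assms]
  show ?thesis unfolding force_def split_beta'
    by (rule measurable_compose[OF _ pot.borel_V(2)])
      (use path_joint_measurable[OF assms, of w] in \<open>simp add: split_beta'\<close>)
qed

text \<open>Summing over neighbours instead of oriented edges removes the orientation: an edge between
\<open>z\<close> and \<open>w\<close> contributes \<open>force w - force z\<close> to the drift at \<open>z\<close> whichever way it points.\<close>

lemma path_equation:
  assumes \<sigma>: "tempered E \<sigma>"
  shows "AE \<omega> in N. \<forall>z. \<forall>t\<ge>0. \<eta> \<sigma> t \<omega> z = \<sigma> z
    + inflow (\<lambda>w s. force \<sigma> w s \<omega>) z t + site_noise z t \<omega>"
proof -
  have "AE \<omega> in N. \<forall>x. \<forall>t\<ge>0.
        \<eta> \<sigma> t \<omega> x = \<sigma> x + (\<Sum>b\<in>{b \<in> A. fst b = x \<or> snd b = x}.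
          sgn_at x b * ((LBINT s:{0..t}. dH_edge U b (\<eta> \<sigma> s \<omega>)) + sqrt 2 * B b t \<omega>))"
    using process[OF \<sigma>] by (simp add: gl_process_def)
  then show ?thesis
  proof eventually_elim
    case (elim \<omega>)
    note eq = elim(1)
    have neg: "- (LBINT s:{0..t}. f s - g s) = (LBINT s:{0..t}. g s - f s)" for f g :: "real \<Rightarrow> real" and t
      unfolding set_lebesgue_integral_def by (simp flip: Bochner_Integration.integral_minus add: algebra_simps)
    show "\<forall>z. \<forall>t\<ge>0. \<eta> \<sigma> t \<omega> z = \<sigma> z
      + inflow (\<lambda>w s. force \<sigma> w s \<omega>) z t + site_noise z t \<omega>"
    proof (intro allI impI)
      fix z and t :: real assume "0 \<le> t"
      have "sgn_at z b * (LBINT s:{0..t}. dH_edge U b (\<eta> \<sigma> s \<omega>))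
          = (LBINT s:{0..t}. (force \<sigma> (other_end z b) s \<omega> - force \<sigma> z s \<omega>))" if b: "b \<in> incident z" for b
        using b incident_not_loop[OF b]
        by (auto simp: sgn_at_def dH_edge_def dH_def force_def other_end_def incident_def neg)
      then have "(\<Sum>b\<in>incident z. sgn_at z b * (LBINT s:{0..t}. dH_edge U b (\<eta> \<sigma> s \<omega>)))
          = (\<Sum>b\<in>incident z. LBINT s:{0..t}. (force \<sigma> (other_end z b) s \<omega> - force \<sigma> z s \<omega>))"
        by (intro sum.cong) auto
      also have "\<dots> = inflow (\<lambda>w s. force \<sigma> w s \<omega>) z t"
        by (rule sum.reindex_bij_betw[OF incident_bij])
      finally show "\<eta> \<sigma> t \<omega> z = \<sigma> z
        + inflow (\<lambda>w s. force \<sigma> w s \<omega>) z t + site_noise z t \<omega>"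
        using eq \<open>0 \<le> t\<close> by (simp add: incident_def[symmetric] site_noise_def distrib_left sum.distrib)
    qed
  qed
qed

lemma path_growth:
  assumes \<sigma>: "tempered E \<sigma>" and T: "0 \<le> T"
  shows "AE \<omega> in N. \<exists>n::nat. \<forall>s\<in>{0..T}. \<forall>z. \<bar>\<eta> \<sigma> s \<omega> z\<bar> \<le> real n * growth (real n) p z"
proof -
  have "AE \<omega> in N. \<forall>T\<ge>0. \<exists>z a C. \<forall>s\<in>{0..T}. \<forall>x.
        \<bar>\<eta> \<sigma> s \<omega> x\<bar> \<le> C * growth a z x"
    using process[OF \<sigma>] by (simp add: gl_process_def)
  then show ?thesis
  proof eventually_elim
    fix \<omega> assume "\<forall>T\<ge>0. \<exists>z a C. \<forall>s\<in>{0..T}. \<forall>x.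
        \<bar>\<eta> \<sigma> s \<omega> x\<bar> \<le> C * growth a z x"
    then obtain q a C where "\<And>s x. s \<in> {0..T} \<Longrightarrow> \<bar>\<eta> \<sigma> s \<omega> x\<bar> \<le> C * growth a q x"
      using T by blast
    then obtain n :: nat where "\<And>s x. s \<in> {0..T} \<Longrightarrow> \<bar>\<eta> \<sigma> s \<omega> x\<bar> \<le> real n * growth (real n) p x"
      using exponential_growth_nat[of "{0..T}" "\<lambda>s x. \<bar>\<eta> \<sigma> s \<omega> x\<bar>" C a q p] by blast
    then show "\<exists>n::nat. \<forall>s\<in>{0..T}. \<forall>z. \<bar>\<eta> \<sigma> s \<omega> z\<bar> \<le> real n * growth (real n) p z"
      by blast
  qed
qed

section \<open>Dependence on the initial configuration\<close>

text \<open>The exponent given by \<open>graph_gronwall\<close> for the weight \<open>exp (b * d)\<close>, which changes by a factor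
of at most \<open>exp b\<close> across an edge.\<close>

definition growth_rate :: "real \<Rightarrow> real" where
  "growth_rate b = Cp * D * (exp b + 1)"

lemma growth_rate_nonneg: "0 \<le> growth_rate b"
  using Cp_pos by (simp add: growth_rate_def)

lemma difference_equation:
  assumes \<sigma>: "tempered E \<sigma>" and \<sigma>': "tempered E \<sigma>'"
  shows "AE \<omega> in N. \<forall>z. \<forall>t\<ge>0. \<eta> \<sigma>' t \<omega> z - \<eta> \<sigma> t \<omega> z = \<sigma>' z - \<sigma> z
    + inflow (\<lambda>w s. force \<sigma>' w s \<omega> - force \<sigma> w s \<omega>) z t"
  using path_equation[OF \<sigma>] path_equation[OF \<sigma>'] AE_space
proof eventually_elim
  case (elim \<omega>)
  note 1 = elim(1) and 2 = elim(2) and \<omega> = elim(3)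
  note i = force_set_integrable[OF \<sigma> \<omega>] force_set_integrable[OF \<sigma>' \<omega>]
  show "\<forall>z. \<forall>t\<ge>0. \<eta> \<sigma>' t \<omega> z - \<eta> \<sigma> t \<omega> z = \<sigma>' z - \<sigma> z
    + inflow (\<lambda>w s. force \<sigma>' w s \<omega> - force \<sigma> w s \<omega>) z t"
  proof (intro allI impI)
    fix z and t :: real assume t: "0 \<le> t"
    have "inflow (\<lambda>w s. force \<sigma>' w s \<omega> - force \<sigma> w s \<omega>) z t
        = (\<Sum>w\<in>nbrs E z. (LBINT s:{0..t}. (force \<sigma>' w s \<omega> - force \<sigma>' z s \<omega>)) - (LBINT s:{0..t}. (force \<sigma> w s \<omega> - force \<sigma> z s \<omega>)))"
      using i by (intro sum.cong) simp_all
    then show "\<eta> \<sigma>' t \<omega> z - \<eta> \<sigma> t \<omega> z = \<sigma>' z - \<sigma> z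
      + inflow (\<lambda>w s. force \<sigma>' w s \<omega> - force \<sigma> w s \<omega>) z t"
      using 1[rule_format, OF t, of z] 2[rule_format, OF t, of z] by (simp only: sum_subtractf)
  qed
qed

text \<open>The noise cancels and the forces are Lipschitz, so the distance between two solutions satisfies the
hypothesis of \<open>graph_gronwall\<close>. The bound is deterministic, although the growth of the individual paths is not.\<close>

lemma difference_bound:
  assumes \<sigma>: "tempered E \<sigma>" and \<sigma>': "tempered E \<sigma>'" and T: "0 \<le> T" and bc: "0 \<le> b" "0 \<le> c"
    and init: "\<And>z. \<bar>\<sigma>' z - \<sigma> z\<bar> \<le> c * growth b p z"
  shows "AE \<omega> in N. \<forall>t\<in>{0..T}. \<forall>z. \<bar>\<eta> \<sigma>' t \<omega> z - \<eta> \<sigma> t \<omega> z\<bar>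
    \<le> c * growth b p z * exp (growth_rate b * t)"
  using difference_equation[OF \<sigma> \<sigma>'] path_growth[OF \<sigma> T, of p] path_growth[OF \<sigma>' T, of p] AE_space
proof eventually_elim
  case (elim \<omega>)
  note eq = elim(1) and g = elim(2) and g' = elim(3) and \<omega> = elim(4)
  from g g' obtain n n' :: nat
    where n: "\<And>s z. s \<in> {0..T} \<Longrightarrow> \<bar>\<eta> \<sigma> s \<omega> z\<bar> \<le> real n * growth (real n) p z"
    and n': "\<And>s z. s \<in> {0..T} \<Longrightarrow> \<bar>\<eta> \<sigma>' s \<omega> z\<bar> \<le> real n' * growth (real n') p z"
    by blast
  let ?u = "\<lambda>s z. \<bar>\<eta> \<sigma>' s \<omega> z - \<eta> \<sigma> s \<omega> z\<bar>"
  have force: "\<bar>force \<sigma>' w s \<omega> - force \<sigma> w s \<omega>\<bar> \<le> Cp * ?u s w" for w s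
    unfolding force_def by (rule pot.V'_lipschitz)
  have cont: "continuous_on {0..} (\<lambda>s. ?u s z)" for z
    by (intro continuous_intros path_continuous \<sigma> \<sigma>' \<omega>)
  note i = force_set_integrable[OF \<sigma> \<omega>] force_set_integrable[OF \<sigma>' \<omega>]
  show "\<forall>t\<in>{0..T}. \<forall>z. \<bar>\<eta> \<sigma>' t \<omega> z - \<eta> \<sigma> t \<omega> z\<bar>
    \<le> c * growth b p z * exp (growth_rate b * t)"
  proof (intro ballI allI)
    fix t z assume t: "t \<in> {0..T}"
    show "?u t z \<le> c * growth b p z * exp (growth_rate b * t)"
      unfolding growth_rate_def
    proof (rule graph_gronwall[where K = Cp and u = ?u and T = T and k = "exp b" and l = "exp (real (n + n'))"
          and C = "real (n + n')" and c = c
          and \<phi> = "\<lambda>z. growth b p z" and \<psi> = "\<lambda>z. growth (real (n + n')) p z"])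
      fix s z assume s: "0 \<le> s" "s \<le> T"
      have "?u s z \<le> \<bar>\<eta> \<sigma>' s \<omega> z\<bar> + \<bar>\<eta> \<sigma> s \<omega> z\<bar>" by simp
      also have "\<dots> \<le> real n' * growth (real (n + n')) p z + real n * growth (real (n + n')) p z"
        by (intro add_mono order_trans[OF n] order_trans[OF n'] mult_left_mono) (use s in \<open>auto intro!: mult_right_mono\<close>)
      finally show "?u s z \<le> real (n + n') * growth (real (n + n')) p z"
        by (simp add: algebra_simps)
    next
      fix t z assume t: "0 \<le> t" "t \<le> T"
      have "\<bar>LBINT s:{0..t}. ((force \<sigma>' w s \<omega> - force \<sigma> w s \<omega>) - (force \<sigma>' z s \<omega> - force \<sigma> z s \<omega>))\<bar>
          \<le> (LBINT s:{0..t}. Cp * (?u s w + ?u s z))" for w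
      proof -
        let ?f = "\<lambda>s. (force \<sigma>' w s \<omega> - force \<sigma> w s \<omega>) - (force \<sigma>' z s \<omega> - force \<sigma> z s \<omega>)"
        have f: "set_integrable lborel {0..t} ?f" using i by (intro set_integral_diff)
        have "\<bar>LBINT s:{0..t}. ?f s\<bar> \<le> (LBINT s:{0..t}. \<bar>?f s\<bar>)"
          using set_integral_norm_bound[OF f] by simp
        also have "\<dots> \<le> (LBINT s:{0..t}. Cp * (?u s w + ?u s z))"
        proof (rule set_integral_mono)
          show "set_integrable lborel {0..t} (\<lambda>s. \<bar>?f s\<bar>)"
            using set_integrable_norm[OF f] by simp
          show "set_integrable lborel {0..t} (\<lambda>s. Cp * (?u s w + ?u s z))"
            by (rule borel_integrable_atLeastAtMost', rule continuous_on_subset[where s = "{0..}"])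
              (auto intro!: continuous_intros path_continuous \<sigma> \<sigma>' \<omega>)
          show "\<bar>?f s\<bar> \<le> Cp * (?u s w + ?u s z)" for s
            using force[of w s] force[of z s] by (simp add: distrib_left)
        qed
        finally show ?thesis .
      qed
      then have "\<bar>\<Sum>w\<in>nbrs E z. LBINT s:{0..t}. ((force \<sigma>' w s \<omega> - force \<sigma> w s \<omega>) - (force \<sigma>' z s \<omega> - force \<sigma> z s \<omega>))\<bar>
          \<le> (\<Sum>w\<in>nbrs E z. LBINT s:{0..t}. Cp * (?u s w + ?u s z))"
        by (intro order_trans[OF sum_abs] sum_mono)
      then show "?u t z \<le> c * growth b p z + (\<Sum>w\<in>nbrs E z. LBINT s:{0..t}. Cp * (?u s w + ?u s z))"
        using eq t init[of z] by auto
    qed (use t Cp_pos bc in \<open>auto intro!: exp_gdist_nbr\<close>)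
  qed
qed

end

section \<open>Integrability of the solutions\<close>

context gl_system
begin

text \<open>Any bound that is uniform in the edge would do; this one follows from \<open>\<bar>u\<bar> \<le> 1 + u\<^sup>2\<close>.\<close>

lemma brownian_moment:
  assumes b: "b \<in> A" and t: "0 \<le> t"
  shows "integrable N (B b t)" "(\<integral>\<omega>. \<bar>B b t \<omega>\<bar> \<partial>N) \<le> 1 + t"
proof -
  have bm: "standard_BM N (B b)" using noise b by (simp add: independent_BMs_def)
  have [measurable]: "B b t \<in> borel_measurable N" "B b 0 \<in> borel_measurable N"
    using bm t by (auto simp: standard_BM_def)
  have z: "AE \<omega> in N. B b 0 \<omega> = 0"
    using bm by (auto simp: standard_BM_def)
  have "integrable N (B b t) \<and> (\<integral>\<omega>. \<bar>B b t \<omega>\<bar> \<partial>N) \<le> 1 + t"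
  proof (cases "t = 0")
    case True
    have "integrable N (B b 0) \<longleftrightarrow> integrable N (\<lambda>_. 0::real)"
      using z by (intro integrable_cong_AE) auto
    moreover have "(\<integral>\<omega>. \<bar>B b 0 \<omega>\<bar> \<partial>N) = (\<integral>\<omega>. 0 \<partial>N)"
      using z by (intro integral_cong_AE) auto
    ultimately show ?thesis using True by simp
  next
    case False
    then have t: "0 < t" using \<open>0 \<le> t\<close> by simp
    let ?d = "normal_density 0 (sqrt t)"
    let ?W = "\<lambda>\<omega>. B b t \<omega> - B b 0 \<omega>"
    have d: "distributed N lborel ?W (\<lambda>u. ennreal (?d u))"
      using bm[unfolded standard_BM_def, THEN conjunct2, THEN conjunct2, rule_format, of 0 t] t by simp
    have i0: "integrable lborel ?d" and i2: "integrable lborel (\<lambda>u. ?d u * u\<^sup>2)"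
      using integrable_normal_moment[of "sqrt t" 0 0] integrable_normal_moment[of "sqrt t" 0 2] t by simp_all
    have i1: "integrable lborel (\<lambda>u. ?d u * \<bar>u\<bar>)"
      using integrable_normal_moment_abs[of "sqrt t" 0 1] t by simp
    have "integrable N (\<lambda>\<omega>. \<bar>?W \<omega>\<bar>)"
      using distributed_integrable[OF d, of abs] i1 by simp
    then have "integrable N (\<lambda>\<omega>. \<bar>B b t \<omega>\<bar>)"
      by (rule integrable_cong_AE[THEN iffD1, rotated -1]) (use z in auto)
    then have 1: "integrable N (B b t)"
      by (subst (asm) integrable_abs_iff) auto
    have "(\<integral>\<omega>. \<bar>B b t \<omega>\<bar> \<partial>N) = (\<integral>\<omega>. \<bar>?W \<omega>\<bar> \<partial>N)"
      using z by (intro integral_cong_AE) auto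
    also have "\<dots> = (\<integral>u. ?d u * \<bar>u\<bar> \<partial>lborel)"
      by (rule distributed_integral[OF d, symmetric]) auto
    also have "\<dots> \<le> (\<integral>u. ?d u + ?d u * u\<^sup>2 \<partial>lborel)"
    proof (rule integral_mono[OF i1])
      show "integrable lborel (\<lambda>u. ?d u + ?d u * u\<^sup>2)" using i0 i2 by simp
      fix u :: real
      have "\<bar>u\<bar> \<le> 1 + u\<^sup>2" using pot.abs_le_quadratic[of 1 u] by simp
      from mult_left_mono[OF this, of "?d u"] show "?d u * \<bar>u\<bar> \<le> ?d u + ?d u * u\<^sup>2"
        by (simp add: distrib_left)
    qed
    also have "\<dots> = 1 + t"
      using i0 i2 t integral_normal_moment_even[of "sqrt t" 0 1] by (simp add: fact_numeral)
    finally show ?thesis using 1 by simp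
  qed
  then show "integrable N (B b t)" "(\<integral>\<omega>. \<bar>B b t \<omega>\<bar> \<partial>N) \<le> 1 + t" by auto
qed

lemma site_noise_moment:
  assumes t: "0 \<le> t"
  shows "integrable N (site_noise z t)" "(\<integral>\<omega>. \<bar>site_noise z t \<omega>\<bar> \<partial>N) \<le> D * (sqrt 2 * (1 + t))"
proof -
  have b: "b \<in> A" if "b \<in> incident z" for b using that by (simp add: incident_def)
  note i = brownian_moment(1)[OF b t]
  show int: "integrable N (site_noise z t)"
    unfolding site_noise_def using i by (intro Bochner_Integration.integrable_sum integrable_mult_right) auto
  have "(\<integral>\<omega>. \<bar>site_noise z t \<omega>\<bar> \<partial>N) \<le> (\<integral>\<omega>. (\<Sum>b\<in>incident z. sqrt 2 * \<bar>B b t \<omega>\<bar>) \<partial>N)"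
  proof (rule integral_mono)
    show "integrable N (\<lambda>\<omega>. \<bar>site_noise z t \<omega>\<bar>)" using int by simp
    show "integrable N (\<lambda>\<omega>. \<Sum>b\<in>incident z. sqrt 2 * \<bar>B b t \<omega>\<bar>)"
      using i by (intro Bochner_Integration.integrable_sum integrable_mult_right integrable_abs) auto
    fix \<omega>
    have "\<bar>sgn_at z b * (sqrt 2 * B b t \<omega>)\<bar> \<le> sqrt 2 * \<bar>B b t \<omega>\<bar>" for b
      by (simp add: sgn_at_def abs_mult)
    then show "\<bar>site_noise z t \<omega>\<bar> \<le> (\<Sum>b\<in>incident z. sqrt 2 * \<bar>B b t \<omega>\<bar>)"
      unfolding site_noise_def by (intro order_trans[OF sum_abs] sum_mono)
  qed
  also have "\<dots> = (\<Sum>b\<in>incident z. sqrt 2 * (\<integral>\<omega>. \<bar>B b t \<omega>\<bar> \<partial>N))"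
    using i by (subst Bochner_Integration.integral_sum) auto
  also have "\<dots> \<le> (\<Sum>b\<in>incident z. sqrt 2 * (1 + t))"
    using brownian_moment(2)[OF b t] by (intro sum_mono mult_left_mono) auto
  also have "\<dots> \<le> D * (sqrt 2 * (1 + t))"
    using finite_incident(2)[of z] t by (auto intro!: mult_right_mono)
  finally show "(\<integral>\<omega>. \<bar>site_noise z t \<omega>\<bar> \<partial>N) \<le> D * (sqrt 2 * (1 + t))" .
qed

definition force_bound :: real where
  "force_bound = Cp * (1 + 1 / Cm + M\<^sup>2)"

lemma force_growth: "\<bar>force \<sigma> w s \<omega>\<bar> \<le> force_bound + Cp * \<bar>\<eta> \<sigma> s \<omega> w\<bar>"
  unfolding force_def force_bound_def
  using pot.V'_growth[of w "\<eta> \<sigma> s \<omega> w"] pot.abs_V'_0_le[of w] by linarith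

lemma force_bound_nonneg: "0 \<le> force_bound"
  using Cp_pos by (auto simp: force_bound_def intro!: mult_nonneg_nonneg add_nonneg_nonneg)

text \<open>On the event \<open>S m\<close>, on which the path obeys the growth bound with constants \<open>m\<close>, the expectations of
\<open>\<bar>\<eta> s z\<bar>\<close> are finite and satisfy an integral inequality whose data have first moments bounded
independently of \<open>m\<close>. Hence \<open>graph_gronwall\<close> bounds them by a constant \<open>Q\<close> free of \<open>m\<close>, and Fatou's
lemma removes the restriction to \<open>S m\<close>.\<close>

lemma path_integrable:
  assumes \<sigma>: "tempered E \<sigma>" and T: "0 \<le> T"
  shows "integrable N (\<lambda>\<omega>. \<eta> \<sigma> T \<omega> p)"
proof -
  obtain n0 :: nat where n0: "\<And>z. \<bar>\<sigma> z\<bar> \<le> real n0 * growth (real n0) p z"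
    using \<sigma> tempered_based[of \<sigma> p] by blast
  define S where "S = (\<lambda>m::nat. {\<omega> \<in> space N. \<forall>v\<in>UNIV. \<forall>q\<in>\<rat>.
    \<bar>\<eta> \<sigma> (max 0 (min T q)) \<omega> v\<bar> \<le> real m * growth (real m) p v})"
  \<comment> \<open>Rational times suffice by continuity. They are clipped to \<open>{0..T}\<close> rather than chosen in it, so that \<open>T = 0\<close> is no special case.\<close>
  have S_sets[measurable]: "S m \<in> sets N" for m
    unfolding S_def
  proof (intro sets.sets_Collect_countable_All' countable_vertices countable_rat)
    fix v and q :: real
    have [measurable]: "(\<lambda>\<omega>. \<eta> \<sigma> (max 0 (min T q)) \<omega> v) \<in> borel_measurable N"
      by (rule path_measurable[OF \<sigma>]) simp
    show "{\<omega> \<in> space N. \<bar>\<eta> \<sigma> (max 0 (min T q)) \<omega> v\<bar> \<le> real m * growth (real m) p v} \<in> sets N"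
      by measurable
  qed
  have S_bound: "\<bar>\<eta> \<sigma> s \<omega> v\<bar> \<le> real m * growth (real m) p v"
    if "\<omega> \<in> S m" "s \<in> {0..T}" for \<omega> m s v
  proof -
    have \<omega>: "\<omega> \<in> space N" using that by (simp add: S_def)
    have c: "continuous_on UNIV (\<lambda>q. \<bar>\<eta> \<sigma> (max 0 (min T q)) \<omega> v\<bar>)"
      by (intro continuous_on_rabs continuous_on_compose2[OF path_continuous[OF \<sigma> \<omega>, of v]])
        (auto intro!: continuous_intros)
    have "\<bar>\<eta> \<sigma> (max 0 (min T s)) \<omega> v\<bar> \<le> real m * growth (real m) p v"
    proof (rule continuous_le_on_closure[where S = "\<rat>" and f = "\<lambda>q. \<bar>\<eta> \<sigma> (max 0 (min T q)) \<omega> v\<bar>"])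
      show "\<bar>\<eta> \<sigma> (max 0 (min T q)) \<omega> v\<bar> \<le> real m * growth (real m) p v" if "q \<in> \<rat>" for q
        using that \<open>\<omega> \<in> S m\<close> by (simp add: S_def)
    qed (use c in \<open>simp_all add: Rats_closure_real\<close>)
    moreover have "max 0 (min T s) = s" using that by auto
    ultimately show ?thesis by simp
  qed
  \<comment> \<open>Initial configuration, noise, and the constant part of the drift.\<close>
  define c where "c = real n0 + D * (sqrt 2 * (1 + T)) + D * (T * (2 * force_bound))"
  define Q where "Q = c * exp (growth_rate n0 * T)"
  have fb: "0 \<le> force_bound" by (rule force_bound_nonneg)
  have S_moment: "(\<integral>\<omega>. indicator (S m) \<omega> * \<bar>\<eta> \<sigma> T \<omega> p\<bar> \<partial>N) \<le> Q" for m
  proof -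
    define g where "g = (\<lambda>v s \<omega>. indicator (S m) \<omega> * \<bar>\<eta> \<sigma> s \<omega> v\<bar>)"
    define e where "e = (\<lambda>s v. \<integral>\<omega>. g v s \<omega> \<partial>N)"
    have g0: "0 \<le> g v s \<omega>" for v s \<omega> by (simp add: g_def)
    have g_bound: "g v s \<omega> \<le> real m * growth (real m) p v" if "s \<in> {0..T}" for v s \<omega>
      using S_bound[OF _ that] by (auto simp: g_def split: split_indicator)
    have g_joint: "(\<lambda>(s, \<omega>). g v (max 0 s) \<omega>) \<in> borel_measurable (borel \<Otimes>\<^sub>M N)" for v
    proof -
      note [measurable] = path_joint_measurable[OF \<sigma>, of v, unfolded split_beta']
      show ?thesis unfolding g_def split_beta' by measurable
    qed
    have g_meas: "g v s \<in> borel_measurable N" if "0 \<le> s" for v s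
      using measurable_compose[OF measurable_Pair1' g_joint, of s v] that by simp
    have g_int: "integrable N (g v s)" if "s \<in> {0..T}" for v s
      using g_bound[OF that, of v] g0[of v s] that
      by (intro N.integrable_const_bound[of _ "real m * growth (real m) p v"] g_meas AE_I2) auto
    have "e T p \<le> c * growth (real n0) p p * exp (Cp * D * (exp (real n0) + 1) * T)"
    proof (rule graph_gronwall[where K = Cp and u = e and T = T and k = "exp (real n0)" and l = "exp (real m)"
          and C = "real m" and c = c
          and \<phi> = "\<lambda>z. growth (real n0) p z" and \<psi> = "\<lambda>z. growth (real m) p z"])
      fix s v assume s: "0 \<le> s" "s \<le> T"
      show "e s v \<le> real m * growth (real m) p v"
        unfolding e_def using g_int[of s v] g_bound[of s v] s by (intro N.integral_le_const) auto
    next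
      fix t v assume t: "0 \<le> t" "t \<le> T"
      have fub: "integrable N (\<lambda>\<omega>. LBINT s:{0..t}. Cp * (g w s \<omega> + g v s \<omega>))"
        "set_integrable lborel {0..t} (\<lambda>s. \<integral>\<omega>. Cp * (g w s \<omega> + g v s \<omega>) \<partial>N)"
        "(\<integral>\<omega>. (LBINT s:{0..t}. Cp * (g w s \<omega> + g v s \<omega>)) \<partial>N) = (LBINT s:{0..t}. \<integral>\<omega>. Cp * (g w s \<omega> + g v s \<omega>) \<partial>N)" for w
      proof -
        note [measurable] = g_joint[of w, unfolded split_beta'] g_joint[of v, unfolded split_beta']
        have m: "(\<lambda>(s, \<omega>). Cp * (g w (max 0 s) \<omega> + g v (max 0 s) \<omega>)) \<in> borel_measurable (borel \<Otimes>\<^sub>M N)"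
          unfolding split_beta' by measurable
        have "AE \<omega> in N. \<forall>s\<in>{0..t}. \<bar>Cp * (g w s \<omega> + g v s \<omega>)\<bar>
           \<le> Cp * (real m * growth (real m) p w + real m * growth (real m) p v)"
        proof (intro AE_I2 ballI)
          fix \<omega> s assume "s \<in> {0..t}"
          then have "s \<in> {0..T}" using t by auto
          then show "\<bar>Cp * (g w s \<omega> + g v s \<omega>)\<bar>
           \<le> Cp * (real m * growth (real m) p w + real m * growth (real m) p v)"
            using g0[of w s \<omega>] g0[of v s \<omega>] g_bound[of s w \<omega>] g_bound[of s v \<omega>] Cp_pos
            by (auto simp: abs_mult intro!: mult_left_mono add_mono)
        qed
        from N.time_fubini[OF m this] show "integrable N (\<lambda>\<omega>. LBINT s:{0..t}. Cp * (g w s \<omega> + g v s \<omega>))"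
          "set_integrable lborel {0..t} (\<lambda>s. \<integral>\<omega>. Cp * (g w s \<omega> + g v s \<omega>) \<partial>N)"
          "(\<integral>\<omega>. (LBINT s:{0..t}. Cp * (g w s \<omega> + g v s \<omega>)) \<partial>N) = (LBINT s:{0..t}. \<integral>\<omega>. Cp * (g w s \<omega> + g v s \<omega>) \<partial>N)" .
      qed
      let ?R = "\<lambda>\<omega>. \<bar>\<sigma> v\<bar> + \<bar>site_noise v t \<omega>\<bar> + (\<Sum>w\<in>nbrs E v. T * (2 * force_bound) + (LBINT s:{0..t}. Cp * (g w s \<omega> + g v s \<omega>)))"
      have "AE \<omega> in N. g v t \<omega> \<le> ?R \<omega>"
        using path_equation[OF \<sigma>] AE_space
      proof eventually_elim
        case (elim \<omega>)
        note eq = elim(1) and \<omega> = elim(2)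
        show "g v t \<omega> \<le> ?R \<omega>"
        proof (cases "\<omega> \<in> S m")
          case False
          have "0 \<le> (LBINT s:{0..t}. Cp * (g w s \<omega> + g v s \<omega>))" for w
            unfolding set_lebesgue_integral_def using Cp_pos g0
            by (intro Bochner_Integration.integral_nonneg) (auto intro!: mult_nonneg_nonneg add_nonneg_nonneg)
          then show ?thesis using False fb T by (auto simp: g_def intro!: add_nonneg_nonneg sum_nonneg)
        next
          case True
          have gS: "g w s \<omega> = \<bar>\<eta> \<sigma> s \<omega> w\<bar>" for w s using True by (simp add: g_def)
          note i = force_set_integrable[OF \<sigma> \<omega>]
          have b: "\<bar>LBINT s:{0..t}. (force \<sigma> w s \<omega> - force \<sigma> v s \<omega>)\<bar>
              \<le> T * (2 * force_bound) + (LBINT s:{0..t}. Cp * (g w s \<omega> + g v s \<omega>))" for w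
          proof -
            let ?f = "\<lambda>s. force \<sigma> w s \<omega> - force \<sigma> v s \<omega>"
            have f: "set_integrable lborel {0..t} ?f" using i by (intro set_integral_diff)
            have "\<bar>LBINT s:{0..t}. ?f s\<bar> \<le> (LBINT s:{0..t}. \<bar>?f s\<bar>)"
              using set_integral_norm_bound[OF f] by simp
            have gi: "set_integrable lborel {0..t} (\<lambda>s. Cp * (g w s \<omega> + g v s \<omega>))"
              unfolding gS by (rule borel_integrable_atLeastAtMost', rule continuous_on_subset[where s = "{0..}"])
                (auto intro!: continuous_intros path_continuous \<sigma> \<omega>)
            have ci: "set_integrable lborel {0..t} (\<lambda>s. 2 * force_bound)"
              by (rule borel_integrable_atLeastAtMost') simp
            have "\<bar>LBINT s:{0..t}. ?f s\<bar> \<le> (LBINT s:{0..t}. 2 * force_bound + Cp * (g w s \<omega> + g v s \<omega>))"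
            proof (rule order_trans[OF \<open>_ \<le> (LBINT s:{0..t}. \<bar>?f s\<bar>)\<close> set_integral_mono])
              show "set_integrable lborel {0..t} (\<lambda>s. \<bar>?f s\<bar>)"
                using set_integrable_norm[OF f] by simp
              show "set_integrable lborel {0..t} (\<lambda>s. 2 * force_bound + Cp * (g w s \<omega> + g v s \<omega>))"
                using ci gi by (rule set_integral_add)
              show "\<bar>?f s\<bar> \<le> 2 * force_bound + Cp * (g w s \<omega> + g v s \<omega>)" for s
                using force_growth[of \<sigma> w s \<omega>] force_growth[of \<sigma> v s \<omega>] by (simp add: gS distrib_left)
            qed
            also have "\<dots> = (LBINT s:{0..t}. 2 * force_bound) + (LBINT s:{0..t}. Cp * (g w s \<omega> + g v s \<omega>))"
              using ci gi by (rule set_integral_add)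
            also have "(LBINT s:{0..t}. 2 * force_bound) = t * (2 * force_bound)"
              using t by (simp add: set_lebesgue_integral_def)
            also have "\<dots> \<le> T * (2 * force_bound)"
              using t fb by (intro mult_right_mono) auto
            finally show ?thesis by simp
          qed
          have "\<bar>\<Sum>w\<in>nbrs E v. LBINT s:{0..t}. (force \<sigma> w s \<omega> - force \<sigma> v s \<omega>)\<bar>
              \<le> (\<Sum>w\<in>nbrs E v. T * (2 * force_bound) + (LBINT s:{0..t}. Cp * (g w s \<omega> + g v s \<omega>)))"
            using b by (intro order_trans[OF sum_abs] sum_mono)
          then show ?thesis
            unfolding gS[of v t] using eq[rule_format, OF t(1), of v] by linarith
        qed
      qed
      moreover have Rint: "integrable N ?R"
        using fub(1) site_noise_moment(1)[OF t(1), of v]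
        by (intro Bochner_Integration.integrable_add Bochner_Integration.integrable_sum integrable_abs) auto
      ultimately have "e t v \<le> integral\<^sup>L N ?R"
        unfolding e_def using g_int[of t v] t by (intro integral_mono_AE) auto
      also have "integral\<^sup>L N ?R = \<bar>\<sigma> v\<bar> + (\<integral>\<omega>. \<bar>site_noise v t \<omega>\<bar> \<partial>N)
          + (\<Sum>w\<in>nbrs E v. T * (2 * force_bound) + (LBINT s:{0..t}. \<integral>\<omega>. Cp * (g w s \<omega> + g v s \<omega>) \<partial>N))"
        using fub(1,3) site_noise_moment(1)[OF t(1), of v] Cp_pos(1) by (simp add: N.prob_space)
      also have "(\<Sum>w\<in>nbrs E v. T * (2 * force_bound) + (LBINT s:{0..t}. \<integral>\<omega>. Cp * (g w s \<omega> + g v s \<omega>) \<partial>N))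
          = card (nbrs E v) * (T * (2 * force_bound)) + (\<Sum>w\<in>nbrs E v. LBINT s:{0..t}. Cp * (e s w + e s v))"
      proof -
        have "(LBINT s:{0..t}. \<integral>\<omega>. Cp * (g w s \<omega> + g v s \<omega>) \<partial>N) = (LBINT s:{0..t}. Cp * (e s w + e s v))" for w
        proof (rule set_lebesgue_integral_cong)
          show "\<forall>s. s \<in> {0..t} \<longrightarrow> (\<integral>\<omega>. Cp * (g w s \<omega> + g v s \<omega>) \<partial>N) = Cp * (e s w + e s v)"
            using g_int t by (auto simp: e_def)
        qed simp
        then show ?thesis using Cp_pos(1) by (simp add: sum.distrib)
      qed
      also have "\<bar>\<sigma> v\<bar> + (\<integral>\<omega>. \<bar>site_noise v t \<omega>\<bar> \<partial>N) + (card (nbrs E v) * (T * (2 * force_bound)) + (\<Sum>w\<in>nbrs E v. LBINT s:{0..t}. Cp * (e s w + e s v)))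
          \<le> c * growth (real n0) p v + (\<Sum>w\<in>nbrs E v. LBINT s:{0..t}. Cp * (e s w + e s v))"
      proof -
        have "\<bar>\<sigma> v\<bar> \<le> real n0 * growth (real n0) p v" by (rule n0)
        moreover have "(\<integral>\<omega>. \<bar>site_noise v t \<omega>\<bar> \<partial>N) \<le> D * (sqrt 2 * (1 + T))"
          using site_noise_moment(2)[OF t(1), of v] t
          by (elim order_trans) (intro mult_left_mono; simp)
        moreover have "card (nbrs E v) * (T * (2 * force_bound)) \<le> D * (T * (2 * force_bound))"
          using degree(2)[of v] T fb by (intro mult_right_mono) auto
        moreover have "D * (sqrt 2 * (1 + T)) + D * (T * (2 * force_bound))
            \<le> (D * (sqrt 2 * (1 + T)) + D * (T * (2 * force_bound))) * growth (real n0) p v"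
        proof -
          have "0 \<le> D * (sqrt 2 * (1 + T)) + D * (T * (2 * force_bound))"
            using T fb by (intro add_nonneg_nonneg mult_nonneg_nonneg) auto
          from mult_left_mono[OF _ this, of 1 "growth (real n0) p v"] show ?thesis by simp
        qed
        ultimately show ?thesis unfolding c_def distrib_right by linarith
      qed
      finally show "e t v \<le> c * growth (real n0) p v + (\<Sum>w\<in>nbrs E v. LBINT s:{0..t}. Cp * (e s w + e s v))" .
    qed (use T Cp_pos fb in \<open>auto simp: c_def intro!: exp_gdist_nbr\<close>)
    also have "gdist E p p = 0" using gdist_le[of p p 0] by simp
    finally show ?thesis by (simp add: Q_def growth_rate_def e_def g_def)
  qed
  have [measurable]: "(\<lambda>\<omega>. \<eta> \<sigma> T \<omega> p) \<in> borel_measurable N"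
    by (rule path_measurable[OF \<sigma> T])
  have "(\<integral>\<^sup>+\<omega>. ennreal \<bar>\<eta> \<sigma> T \<omega> p\<bar> \<partial>N) \<le> (\<integral>\<^sup>+\<omega>. liminf (\<lambda>m. ennreal (indicator (S m) \<omega> * \<bar>\<eta> \<sigma> T \<omega> p\<bar>)) \<partial>N)"
  proof (rule nn_integral_mono_AE)
    show "AE \<omega> in N. ennreal \<bar>\<eta> \<sigma> T \<omega> p\<bar> \<le> liminf (\<lambda>m. ennreal (indicator (S m) \<omega> * \<bar>\<eta> \<sigma> T \<omega> p\<bar>))"
      using path_growth[OF \<sigma> T, of p] AE_space
    proof eventually_elim
      fix \<omega> assume "\<exists>n::nat. \<forall>s\<in>{0..T}. \<forall>z. \<bar>\<eta> \<sigma> s \<omega> z\<bar> \<le> real n * growth (real n) p z"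
        and \<omega>: "\<omega> \<in> space N"
      then obtain n :: nat where n: "\<And>s z. s \<in> {0..T} \<Longrightarrow> \<bar>\<eta> \<sigma> s \<omega> z\<bar> \<le> real n * growth (real n) p z"
        by blast
      have "\<omega> \<in> S m" if "n \<le> m" for m
        unfolding S_def
      proof (intro CollectI conjI ballI \<omega>)
        fix v and q :: real
        have "max 0 (min T q) \<in> {0..T}" using T by auto
        from n[OF this, of v] show "\<bar>\<eta> \<sigma> (max 0 (min T q)) \<omega> v\<bar> \<le> real m * growth (real m) p v"
          by (rule order_trans) (use that in \<open>auto intro!: mult_mono mult_right_mono\<close>)
      qed
      then have "\<forall>\<^sub>F m in sequentially. ennreal \<bar>\<eta> \<sigma> T \<omega> p\<bar> \<le> ennreal (indicator (S m) \<omega> * \<bar>\<eta> \<sigma> T \<omega> p\<bar>)"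
        by (intro eventually_sequentiallyI[of n]) simp
      then show "ennreal \<bar>\<eta> \<sigma> T \<omega> p\<bar> \<le> liminf (\<lambda>m. ennreal (indicator (S m) \<omega> * \<bar>\<eta> \<sigma> T \<omega> p\<bar>))"
        by (rule Liminf_bounded)
    qed
  qed
  also have "\<dots> \<le> liminf (\<lambda>m. \<integral>\<^sup>+\<omega>. ennreal (indicator (S m) \<omega> * \<bar>\<eta> \<sigma> T \<omega> p\<bar>) \<partial>N)"
    by (rule nn_integral_liminf) measurable
  also have "\<dots> \<le> ennreal Q"
  proof (rule Liminf_le)
    show "\<forall>\<^sub>F m in sequentially. (\<integral>\<^sup>+\<omega>. ennreal (indicator (S m) \<omega> * \<bar>\<eta> \<sigma> T \<omega> p\<bar>) \<partial>N) \<le> ennreal Q"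
    proof (intro always_eventually allI)
      fix m
      have "integrable N (\<lambda>\<omega>. indicator (S m) \<omega> * \<bar>\<eta> \<sigma> T \<omega> p\<bar>)"
        using S_bound[of _ m T p] T
        by (intro N.integrable_const_bound[of _ "real m * growth (real m) p p"] AE_I2)
          (auto split: split_indicator)
      then have "(\<integral>\<^sup>+\<omega>. ennreal (indicator (S m) \<omega> * \<bar>\<eta> \<sigma> T \<omega> p\<bar>) \<partial>N)
          = ennreal (\<integral>\<omega>. indicator (S m) \<omega> * \<bar>\<eta> \<sigma> T \<omega> p\<bar> \<partial>N)"
        by (intro nn_integral_eq_integral) auto
      then show "(\<integral>\<^sup>+\<omega>. ennreal (indicator (S m) \<omega> * \<bar>\<eta> \<sigma> T \<omega> p\<bar>) \<partial>N) \<le> ennreal Q"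
        using S_moment[of m] by (simp add: ennreal_leI)
    qed
  qed simp
  finally show ?thesis
    by (intro integrableI_bounded) (auto simp: less_top[symmetric] top_unique)
qed

definition mean_flow :: "real \<Rightarrow> 'v \<Rightarrow> ('v \<Rightarrow> real) \<Rightarrow> real" where
  "mean_flow t y \<sigma> = (\<integral>\<omega>. \<eta> \<sigma> t \<omega> y \<partial>N)"

text \<open>The weights may grow at any exponential rate: the influence of a distant site decays faster than that.\<close>

lemma mean_flow_lipschitz:
  assumes \<sigma>: "tempered E \<sigma>" and \<sigma>': "tempered E \<sigma>'" and t: "0 \<le> t" and bc: "0 \<le> b" "0 \<le> c"
    and init: "\<And>z. \<bar>\<sigma>' z - \<sigma> z\<bar> \<le> c * growth b y z"
  shows "\<bar>mean_flow t y \<sigma>' - mean_flow t y \<sigma>\<bar> \<le> c * exp (growth_rate b * t)"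
proof -
  have i: "integrable N (\<lambda>\<omega>. \<eta> \<sigma> t \<omega> y)" "integrable N (\<lambda>\<omega>. \<eta> \<sigma>' t \<omega> y)"
    using path_integrable \<sigma> \<sigma>' t by auto
  have "gdist E y y = 0" using gdist_le[of y y 0] by simp
  have b: "AE \<omega> in N. \<bar>\<eta> \<sigma>' t \<omega> y - \<eta> \<sigma> t \<omega> y\<bar> \<le> c * exp (growth_rate b * t)"
    using difference_bound[OF \<sigma> \<sigma>' t bc init]
  proof eventually_elim
    fix \<omega> assume "\<forall>s\<in>{0..t}. \<forall>z. \<bar>\<eta> \<sigma>' s \<omega> z - \<eta> \<sigma> s \<omega> z\<bar>
      \<le> c * growth b y z * exp (growth_rate b * s)"
    then have "\<bar>\<eta> \<sigma>' t \<omega> y - \<eta> \<sigma> t \<omega> y\<bar> \<le> c * growth b y y * exp (growth_rate b * t)"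
      using t by simp
    then show "\<bar>\<eta> \<sigma>' t \<omega> y - \<eta> \<sigma> t \<omega> y\<bar> \<le> c * exp (growth_rate b * t)"
      by (simp add: \<open>gdist E y y = 0\<close>)
  qed
  have "\<bar>mean_flow t y \<sigma>' - mean_flow t y \<sigma>\<bar> = \<bar>\<integral>\<omega>. \<eta> \<sigma>' t \<omega> y - \<eta> \<sigma> t \<omega> y \<partial>N\<bar>"
    using i by (simp add: mean_flow_def)
  also have "\<dots> \<le> (\<integral>\<omega>. \<bar>\<eta> \<sigma>' t \<omega> y - \<eta> \<sigma> t \<omega> y\<bar> \<partial>N)"
    by (rule integral_abs_bound)
  also have "\<dots> \<le> c * exp (growth_rate b * t)"
    using i b by (intro N.integral_le_const) auto
  finally show ?thesis .
qed

end

section \<open>The forward equation of the walk\<close>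

locale gl_walk = gl_system E D N A U M Cm Cp B \<eta>
  for E :: "'v set set" and D :: nat and N :: "'w measure"
    and A :: "('v \<times> 'v) set" and U :: "'v \<Rightarrow> real \<Rightarrow> real" and M Cm Cp :: real
    and B :: "'v \<times> 'v \<Rightarrow> real \<Rightarrow> 'w \<Rightarrow> real"
    and \<eta> :: "('v \<Rightarrow> real) \<Rightarrow> real \<Rightarrow> 'w \<Rightarrow> 'v \<Rightarrow> real" +
  fixes X :: "'v \<Rightarrow> ('v \<Rightarrow> real) \<Rightarrow> real \<Rightarrow> 'w \<Rightarrow> 'v"
  assumes walk: "\<And>x \<sigma>. tempered E \<sigma> \<Longrightarrow> walk_in_env E U N (\<eta> \<sigma>) x (X x \<sigma>)"

text \<open>The starting point of the walk and the initial configuration are fixed as well.\<close>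

locale gl_walk_from = gl_walk E D N A U M Cm Cp B \<eta> X
  for E :: "'v set set" and D :: nat and N :: "'w measure"
    and A :: "('v \<times> 'v) set" and U :: "'v \<Rightarrow> real \<Rightarrow> real" and M Cm Cp :: real
    and B :: "'v \<times> 'v \<Rightarrow> real \<Rightarrow> 'w \<Rightarrow> real"
    and \<eta> :: "('v \<Rightarrow> real) \<Rightarrow> real \<Rightarrow> 'w \<Rightarrow> 'v \<Rightarrow> real"
    and X :: "'v \<Rightarrow> ('v \<Rightarrow> real) \<Rightarrow> real \<Rightarrow> 'w \<Rightarrow> 'v" +
  fixes x :: 'v and \<sigma> :: "'v \<Rightarrow> real"
  assumes tempered_start: "tempered E \<sigma>"
begin

abbreviation Y :: "real \<Rightarrow> 'w \<Rightarrow> 'v" where "Y \<equiv> X x \<sigma>"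

lemma walk_measurable [measurable]: "0 \<le> t \<Longrightarrow> Y t \<in> N \<rightarrow>\<^sub>M count_space UNIV"
  using walk[OF tempered_start, of x] by (auto simp: walk_in_env_def)

lemma walk_start: "AE \<omega> in N. Y 0 \<omega> = x"
  using walk[OF tempered_start, of x] by (auto simp: walk_in_env_def)

lemma walk_path: "\<omega> \<in> space N \<Longrightarrow> jump_path (\<lambda>t. Y t \<omega>)"
  using walk[OF tempered_start, of x] by unfold_locales (auto simp: walk_in_env_def)

lemma walk_indicator_measurable:
  assumes t: "0 \<le> t"
  shows "(\<lambda>\<omega>. of_bool (Y t \<omega> = v) :: real) \<in> borel_measurable N"
proof -
  have "Y t -` {v} \<inter> space N \<in> sets N"
    by (rule measurable_sets[OF walk_measurable[OF t]]) simp
  then have "(indicator (Y t -` {v} \<inter> space N) :: 'w \<Rightarrow> real) \<in> borel_measurable N"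
    by (rule borel_measurable_indicator)
  then show ?thesis
    by (rule measurable_cong[THEN iffD1, rotated]) (simp add: indicator_def)
qed

text \<open>The events determined by the whole environment path. The position of the walk at time \<open>0\<close>, also
recorded by \<open>history\<close>, is almost surely constant.\<close>

definition env :: "'w measure" where
  "env = sigma (space N) (history N (\<eta> \<sigma>) Y 0)"

lemma history_generators_sets:
  "{(\<lambda>\<omega>. \<eta> \<sigma> r \<omega> z) -` S \<inter> space N | r z S. 0 \<le> r \<and> S \<in> sets borel}
      \<union> {Y r -` S \<inter> space N | r S. 0 \<le> r \<and> r \<le> (0::real)} \<subseteq> sets N"
  using measurable_sets[OF path_measurable[OF tempered_start]] measurable_sets[OF walk_measurable] by auto

lemma sets_env: "sets env = history N (\<eta> \<sigma>) Y 0"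
proof -
  have "history N (\<eta> \<sigma>) Y 0 \<subseteq> Pow (space N)"
    using sets.sigma_sets_subset[OF history_generators_sets] sets.space_closed
    unfolding history_def by (rule subset_trans)
  moreover have "sigma_sets (space N) (history N (\<eta> \<sigma>) Y 0) = history N (\<eta> \<sigma>) Y 0"
    unfolding history_def
    by (rule sigma_sets_sigma_sets_eq) (use history_generators_sets sets.space_closed in blast)
  ultimately show ?thesis by (simp add: env_def sets_measure_of)
qed

lemma space_env: "space env = space N"
  by (simp add: env_def space_measure_of_conv)

lemma subalgebra_env: "subalgebra N env"
  unfolding subalgebra_def space_env sets_env history_def
  using sets.sigma_sets_subset[OF history_generators_sets] by simp

lemma env_measurable_N: "f \<in> borel_measurable env \<Longrightarrow> f \<in> borel_measurable N"
  by (rule measurable_from_subalg[OF subalgebra_env])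

lemma path_env_measurable: "0 \<le> r \<Longrightarrow> (\<lambda>\<omega>. \<eta> \<sigma> r \<omega> z) \<in> borel_measurable env"
proof (rule measurableI)
  fix S :: "real set" assume "0 \<le> r" "S \<in> sets borel"
  then show "(\<lambda>\<omega>. \<eta> \<sigma> r \<omega> z) -` S \<inter> space env \<in> sets env"
    unfolding sets_env space_env history_def by (intro sigma_sets.Basic UnI1) blast
qed simp

definition intensity :: "'v \<Rightarrow> real \<Rightarrow> 'w \<Rightarrow> real" where
  "intensity u r \<omega> = of_bool (Y r \<omega> = u) * deriv (deriv (U u)) (\<eta> \<sigma> r \<omega> u)"

lemma intensity_bounds: "0 \<le> intensity u r \<omega>" "intensity u r \<omega> \<le> Cp"
  using pot.bounds[of u "\<eta> \<sigma> r \<omega> u"] Cp_pos by (auto simp: intensity_def)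

lemma intensity_joint_measurable:
  "(\<lambda>(r, \<omega>). intensity u (max 0 r) \<omega>) \<in> borel_measurable (borel \<Otimes>\<^sub>M N)"
proof -
  have Y: "(\<lambda>(r, \<omega>). of_bool (Y (max 0 r) \<omega> = u) :: real) \<in> borel_measurable (borel \<Otimes>\<^sub>M N)"
  proof (rule right_continuous_joint_measurable[where f = "\<lambda>r \<omega>. of_bool (Y r \<omega> = u)"])
    show "(\<lambda>\<omega>. of_bool (Y t \<omega> = u) :: real) \<in> borel_measurable N" if "0 \<le> t" for t
      using that by (rule walk_indicator_measurable)
  next
    fix \<omega> and t :: real assume "\<omega> \<in> space N" "0 \<le> t"
    then have "\<forall>\<^sub>F s in at_right t. Y s \<omega> = Y t \<omega>"
      using jump_path.right_cont[OF walk_path] by blast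
    then show "((\<lambda>s. of_bool (Y s \<omega> = u) :: real) \<longlongrightarrow> of_bool (Y t \<omega> = u)) (at_right t)"
      by (intro tendsto_eventually) (auto elim: eventually_mono)
  qed
  have "(\<lambda>(r, \<omega>). deriv (deriv (U u)) (\<eta> \<sigma> (max 0 r) \<omega> u)) \<in> borel_measurable (borel \<Otimes>\<^sub>M N)"
    using measurable_compose[OF path_joint_measurable[OF tempered_start, of u] pot.borel_V(3)[of u]]
    by (simp add: split_beta')
  from borel_measurable_times[OF Y this] show ?thesis
    by (simp add: intensity_def split_beta')
qed

lemma intensity_measurable: "0 \<le> r \<Longrightarrow> intensity u r \<in> borel_measurable N"
  using measurable_compose[OF measurable_Pair1' intensity_joint_measurable, of r u] by simp

lemma intensity_set_integrable:
  assumes "\<omega> \<in> space N"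
  shows "set_integrable lborel {0..t} (\<lambda>r. intensity u r \<omega>)"
proof -
  have "(\<lambda>r. intensity u (max 0 r) \<omega>) \<in> borel_measurable borel"
    using measurable_compose[OF measurable_Pair2'[OF assms] intensity_joint_measurable[of u]] by simp
  then have m: "(\<lambda>r. indicator {0..t} r *\<^sub>R intensity u (max 0 r) \<omega>) \<in> borel_measurable lborel"
    by simp
  have "integrable lborel (\<lambda>r. indicator {0..t} r *\<^sub>R intensity u (max 0 r) \<omega>)"
  proof (rule Bochner_Integration.integrable_bound[OF _ m])
    show "integrable lborel (\<lambda>r. indicator {0..t} r *\<^sub>R Cp)"
      using borel_integrable_atLeastAtMost'[of 0 t "\<lambda>_. Cp"] by (simp add: set_integrable_def)
    show "AE r in lborel. norm (indicator {0..t} r *\<^sub>R intensity u (max 0 r) \<omega>) \<le> norm (indicator {0..t} r *\<^sub>R Cp)"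
    proof (rule AE_I2)
      fix r
      show "norm (indicator {0..t} r *\<^sub>R intensity u (max 0 r) \<omega>) \<le> norm (indicator {0..t} r *\<^sub>R Cp)"
        using intensity_bounds[of u r \<omega>] by (auto simp: indicator_def)
    qed
  qed
  then show ?thesis
    unfolding set_integrable_def
    by (rule Bochner_Integration.integrable_cong[THEN iffD1, rotated -1]) (auto split: split_indicator)
qed

lemma intensity_nn_integral:
  assumes "\<omega> \<in> space N" "v \<in> nbrs E u"
  shows "(\<integral>\<^sup>+r\<in>{0..t}. indicator {r. Y r \<omega> = u} r * ennreal (jump_rate E U u v (\<eta> \<sigma> r \<omega>)) \<partial>lborel)
    = ennreal (LBINT r:{0..t}. intensity u r \<omega>)"
proof -
  have "(\<integral>\<^sup>+r\<in>{0..t}. indicator {r. Y r \<omega> = u} r * ennreal (jump_rate E U u v (\<eta> \<sigma> r \<omega>)) \<partial>lborel)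
     = (\<integral>\<^sup>+r. ennreal (indicator {0..t} r *\<^sub>R intensity u r \<omega>) \<partial>lborel)"
    using assms(2) by (intro nn_integral_cong) (auto simp: intensity_def jump_rate_def split: split_indicator)
  also have "\<dots> = ennreal (LBINT r:{0..t}. intensity u r \<omega>)"
    unfolding set_lebesgue_integral_def
    using intensity_set_integrable[OF assms(1), of t u] intensity_bounds
    by (intro nn_integral_eq_integral) (auto simp: set_integrable_def)
  finally show ?thesis .
qed

lemma jump_count_borel:
  "u \<noteq> v \<Longrightarrow> 0 \<le> t \<Longrightarrow> (\<lambda>\<omega>. real (jump_count Y u v 0 t \<omega>)) \<in> borel_measurable N"
  by (rule jump_count_measurable) (auto intro: walk_measurable walk_path)

lemma jump_compensator:
  assumes "u \<noteq> v" "0 \<le> t" "F \<in> sets env"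
  shows "(\<integral>\<^sup>+\<omega>. of_nat (jump_count Y u v 0 t \<omega>) * indicator F \<omega> \<partial>N)
        = (\<integral>\<^sup>+\<omega>. (\<integral>\<^sup>+r\<in>{0..t}.
              indicator {r. Y r \<omega> = u} r * ennreal (jump_rate E U u v (\<eta> \<sigma> r \<omega>)) \<partial>lborel) * indicator F \<omega> \<partial>N)"
proof -
  have "\<forall>u v s t. u \<noteq> v \<and> 0 \<le> s \<and> s \<le> t \<longrightarrow> (\<forall>F \<in> history N (\<eta> \<sigma>) Y s.
        (\<integral>\<^sup>+\<omega>\<in>F. of_nat (jump_count Y u v s t \<omega>) \<partial>N)
        = (\<integral>\<^sup>+\<omega>\<in>F. (\<integral>\<^sup>+r\<in>{s..t}.
              indicator {r. Y r \<omega> = u} r * ennreal (jump_rate E U u v (\<eta> \<sigma> r \<omega>)) \<partial>lborel) \<partial>N))"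
    using walk[OF tempered_start, of x] unfolding walk_in_env_def by (elim conjE)
  from this[rule_format, of u v 0 t F] show ?thesis
    using assms by (simp add: sets_env)
qed

text \<open>The compensator of such jumps is \<open>0\<close>, and a nonnegative function with integral \<open>0\<close> vanishes almost everywhere.\<close>

lemma no_jumps_to_non_neighbours:
  assumes uv: "u \<noteq> v" and t: "0 \<le> t" and n: "v \<notin> nbrs E u"
  shows "AE \<omega> in N. jump_count Y u v 0 t \<omega> = 0"
proof -
  have [measurable]: "(\<lambda>\<omega>. real (jump_count Y u v 0 t \<omega>)) \<in> borel_measurable N"
    by (rule jump_count_borel[OF uv t])
  have "space N \<in> sets env" using space_env sets.top by metis
  from jump_compensator[OF uv t this]
  have "(\<integral>\<^sup>+\<omega>. ennreal (real (jump_count Y u v 0 t \<omega>)) * indicator (space N) \<omega> \<partial>N) = 0"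
    using n by (simp add: jump_rate_def ennreal_of_nat_eq_real_of_nat)
  then have "(\<integral>\<^sup>+\<omega>. ennreal (real (jump_count Y u v 0 t \<omega>)) \<partial>N) = 0"
    by (subst (asm) nn_integral_cong[where v = "\<lambda>\<omega>. ennreal (real (jump_count Y u v 0 t \<omega>))"]) auto
  then show ?thesis
    by (subst (asm) nn_integral_0_iff_AE) auto
qed

text \<open>From indicators of environment events to nonnegative functions of the environment.\<close>

lemma jump_compensator_weighted:
  assumes vu: "v \<in> nbrs E u" and t: "0 \<le> t"
    and Z: "Z \<in> borel_measurable env" 
  shows "(\<integral>\<^sup>+\<omega>. Z \<omega> * ennreal (real (jump_count Y u v 0 t \<omega>)) \<partial>N)
    = (\<integral>\<^sup>+\<omega>. Z \<omega> * ennreal (LBINT r:{0..t}. intensity u r \<omega>) \<partial>N)"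
proof -
  have uv: "u \<noteq> v" using vu nbrs_irrefl by blast
  have J[measurable]: "(\<lambda>\<omega>. real (jump_count Y u v 0 t \<omega>)) \<in> borel_measurable N"
    by (rule jump_count_borel[OF uv t])
  have I[measurable]: "(\<lambda>\<omega>. LBINT r:{0..t}. intensity u r \<omega>) \<in> borel_measurable N"
    using N.time_fubini(1)[OF intensity_joint_measurable[of u], of t Cp] intensity_bounds[of u]
    by (auto intro: borel_measurable_integrable)
  show ?thesis using Z
  proof (induction rule: borel_measurable_induct)
    case (cong f g)
    then show ?case by (metis (mono_tags, lifting) nn_integral_cong space_env)
  next
    case (set F)
    have "(\<integral>\<^sup>+\<omega>. indicator F \<omega> * ennreal (real (jump_count Y u v 0 t \<omega>)) \<partial>N)
      = (\<integral>\<^sup>+\<omega>. of_nat (jump_count Y u v 0 t \<omega>) * indicator F \<omega> \<partial>N)"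
      by (simp add: mult.commute ennreal_of_nat_eq_real_of_nat)
    also have "\<dots> = (\<integral>\<^sup>+\<omega>. (\<integral>\<^sup>+r\<in>{0..t}.
              indicator {r. Y r \<omega> = u} r * ennreal (jump_rate E U u v (\<eta> \<sigma> r \<omega>)) \<partial>lborel) * indicator F \<omega> \<partial>N)"
      by (rule jump_compensator[OF uv t set])
    also have "\<dots> = (\<integral>\<^sup>+\<omega>. indicator F \<omega> * ennreal (LBINT r:{0..t}. intensity u r \<omega>) \<partial>N)"
      by (intro nn_integral_cong) (subst intensity_nn_integral[OF _ vu], simp, rule mult.commute)
    finally show ?case .
  next
    case (mult f c)
    note [measurable] = env_measurable_N[OF mult.hyps(2)]
    show ?case using mult by (simp add: mult.assoc nn_integral_cmult)
  next
    case (add f g)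
    note [measurable] = env_measurable_N[OF add.hyps(1)] env_measurable_N[OF add.hyps(3)]
    show ?case using add by (simp add: distrib_right nn_integral_add)
  next
    case (seq f)
    note [measurable] = env_measurable_N[OF seq.hyps(1)]
    have *: "(\<integral>\<^sup>+\<omega>. (SUP i. f i) \<omega> * g \<omega> \<partial>N) = (SUP i. \<integral>\<^sup>+\<omega>. f i \<omega> * g \<omega> \<partial>N)"
      if [measurable]: "g \<in> borel_measurable N" for g :: "'w \<Rightarrow> ennreal"
    proof -
      have "(\<integral>\<^sup>+\<omega>. (SUP i. f i) \<omega> * g \<omega> \<partial>N) = (\<integral>\<^sup>+\<omega>. (SUP i. f i \<omega> * g \<omega>) \<partial>N)"
        by (simp add: SUP_apply SUP_mult_right_ennreal image_image)
      also have "\<dots> = (SUP i. \<integral>\<^sup>+\<omega>. f i \<omega> * g \<omega> \<partial>N)"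
        using seq.hyps(3) by (intro nn_integral_monotone_convergence_SUP)
          (auto simp: incseq_def le_fun_def intro!: mult_right_mono)
      finally show ?thesis .
    qed
    have "(\<lambda>\<omega>. ennreal (real (jump_count Y u v 0 t \<omega>))) \<in> borel_measurable N"
      "(\<lambda>\<omega>. ennreal (LBINT r:{0..t}. intensity u r \<omega>)) \<in> borel_measurable N"
      by measurable
    then show ?case by (simp only: * seq.IH)
  qed
qed

lemma expected_jumps:
  assumes vu: "v \<in> nbrs E u" and t: "0 \<le> t"
    and Z: "Z \<in> borel_measurable env" "\<And>\<omega>. \<omega> \<in> space N \<Longrightarrow> 0 \<le> Z \<omega>" "\<And>\<omega>. \<omega> \<in> space N \<Longrightarrow> Z \<omega> \<le> c"
  shows "integrable N (\<lambda>\<omega>. Z \<omega> * real (jump_count Y u v 0 t \<omega>))"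
    and "(\<integral>\<omega>. Z \<omega> * real (jump_count Y u v 0 t \<omega>) \<partial>N) = (LBINT r:{0..t}. \<integral>\<omega>. Z \<omega> * intensity u r \<omega> \<partial>N)"
    and "set_integrable lborel {0..t} (\<lambda>r. \<integral>\<omega>. Z \<omega> * intensity u r \<omega> \<partial>N)"
proof -
  have uv: "u \<noteq> v" using vu nbrs_irrefl by blast
  have J[measurable]: "(\<lambda>\<omega>. real (jump_count Y u v 0 t \<omega>)) \<in> borel_measurable N"
    by (rule jump_count_borel[OF uv t])
  note [measurable] = env_measurable_N[OF Z(1)]
  have m: "(\<lambda>(r, \<omega>). Z \<omega> * intensity u (max 0 r) \<omega>) \<in> borel_measurable (borel \<Otimes>\<^sub>M N)"
  proof -
    note [measurable] = intensity_joint_measurable[of u, unfolded split_beta']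
    show ?thesis unfolding split_beta' by measurable
  qed
  have b: "AE \<omega> in N. \<forall>r\<in>{0..t}. \<bar>Z \<omega> * intensity u r \<omega>\<bar> \<le> c * Cp"
    using Z(2,3) intensity_bounds[of u] by (intro AE_I2 ballI) (auto simp: abs_mult intro!: mult_mono order_trans[OF Z(2) Z(3)])
  note F = N.time_fubini[OF m b]
  show "set_integrable lborel {0..t} (\<lambda>r. \<integral>\<omega>. Z \<omega> * intensity u r \<omega> \<partial>N)" by (rule F(2))
  have I0: "0 \<le> (LBINT r:{0..t}. intensity u r \<omega>)" for \<omega>
    unfolding set_lebesgue_integral_def using intensity_bounds by (intro Bochner_Integration.integral_nonneg) auto
  have "(\<integral>\<^sup>+\<omega>. ennreal (Z \<omega> * real (jump_count Y u v 0 t \<omega>)) \<partial>N)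
      = (\<integral>\<^sup>+\<omega>. ennreal (Z \<omega>) * ennreal (real (jump_count Y u v 0 t \<omega>)) \<partial>N)"
    using Z(2) by (intro nn_integral_cong ennreal_mult) auto
  also have "\<dots> = (\<integral>\<^sup>+\<omega>. ennreal (Z \<omega>) * ennreal (LBINT r:{0..t}. intensity u r \<omega>) \<partial>N)"
    using Z(1) by (intro jump_compensator_weighted[OF vu t]) auto
  also have "\<dots> = (\<integral>\<^sup>+\<omega>. ennreal (LBINT r:{0..t}. Z \<omega> * intensity u r \<omega>) \<partial>N)"
    using Z(2) I0 by (intro nn_integral_cong) (simp add: ennreal_mult)
  also have "\<dots> = ennreal (\<integral>\<omega>. (LBINT r:{0..t}. Z \<omega> * intensity u r \<omega>) \<partial>N)"
    using F(1) I0 Z(2) by (intro nn_integral_eq_integral AE_I2) auto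
  finally have eq: "(\<integral>\<^sup>+\<omega>. ennreal (Z \<omega> * real (jump_count Y u v 0 t \<omega>)) \<partial>N)
      = ennreal (\<integral>\<omega>. (LBINT r:{0..t}. Z \<omega> * intensity u r \<omega>) \<partial>N)" .
  show int: "integrable N (\<lambda>\<omega>. Z \<omega> * real (jump_count Y u v 0 t \<omega>))"
    using eq Z(2) by (intro integrableI_nonneg AE_I2) auto
  have "(\<integral>\<omega>. Z \<omega> * real (jump_count Y u v 0 t \<omega>) \<partial>N) = enn2real (\<integral>\<^sup>+\<omega>. ennreal (Z \<omega> * real (jump_count Y u v 0 t \<omega>)) \<partial>N)"
    using Z(2) by (intro integral_eq_nn_integral AE_I2) auto
  also have "\<dots> = (\<integral>\<omega>. (LBINT r:{0..t}. Z \<omega> * intensity u r \<omega>) \<partial>N)"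
    unfolding eq using I0 Z(2) by (intro enn2real_ennreal integral_nonneg_AE AE_I2) auto
  also have "\<dots> = (LBINT r:{0..t}. \<integral>\<omega>. Z \<omega> * intensity u r \<omega> \<partial>N)" by (rule F(3))
  finally show "(\<integral>\<omega>. Z \<omega> * real (jump_count Y u v 0 t \<omega>) \<partial>N) = (LBINT r:{0..t}. \<integral>\<omega>. Z \<omega> * intensity u r \<omega> \<partial>N)" .
qed

text \<open>The pathwise identity \<open>flow_balance\<close>, in which only jumps along edges remain.\<close>

lemma occupation_balance:
  assumes t: "0 \<le> t"
  shows "AE \<omega> in N. \<forall>v. of_bool (Y t \<omega> = v) + (\<Sum>u\<in>nbrs E v. jump_count Y v u 0 t \<omega>)
    = of_bool (x = v) + (\<Sum>u\<in>nbrs E v. jump_count Y u v 0 t \<omega>)"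
proof -
  have "AE \<omega> in N. \<forall>p\<in>{(u, v). u \<noteq> v \<and> v \<notin> nbrs E u}. jump_count Y (fst p) (snd p) 0 t \<omega> = 0"
  proof (subst AE_ball_countable)
    show "countable {(u, v). u \<noteq> v \<and> v \<notin> nbrs E u}"
      by (rule countable_subset[OF subset_UNIV]) (simp add: countable_SIGMA countable_vertices flip: UNIV_Times_UNIV)
  qed (auto intro: no_jumps_to_non_neighbours t)
  with walk_start AE_space show ?thesis
  proof eventually_elim
    case (elim \<omega>)
    note start = elim(1) and \<omega> = elim(2) and z = elim(3)
    interpret jump_path "\<lambda>t. Y t \<omega>" by (rule walk_path[OF \<omega>])
    show "\<forall>v. of_bool (Y t \<omega> = v) + (\<Sum>u\<in>nbrs E v. jump_count Y v u 0 t \<omega>)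
      = of_bool (x = v) + (\<Sum>u\<in>nbrs E v. jump_count Y u v 0 t \<omega>)"
    proof
      fix v
      obtain W where W: "finite W" "\<And>S. finite S \<Longrightarrow> W \<subseteq> S \<Longrightarrow>
          of_bool (Y t \<omega> = v) + (\<Sum>u\<in>S - {v}. jump_count Y v u 0 t \<omega>)
          = of_bool (Y 0 \<omega> = v) + (\<Sum>u\<in>S - {v}. jump_count Y u v 0 t \<omega>)"
        using flow_balance[of 0 t v] t unfolding jump_count_eq by auto
      let ?S = "W \<union> nbrs E v"
      have fin: "finite (?S - {v})" using W(1) degree(1) by simp
      have sub: "nbrs E v \<subseteq> ?S - {v}" using nbrs_irrefl[of v] by auto
      have "(\<Sum>u\<in>?S - {v}. jump_count Y v u 0 t \<omega>) = (\<Sum>u\<in>nbrs E v. jump_count Y v u 0 t \<omega>)"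
      proof (intro sum.mono_neutral_right[OF fin sub] ballI)
        fix u assume "u \<in> ?S - {v} - nbrs E v"
        then show "jump_count Y v u 0 t \<omega> = 0" using z[rule_format, of "(v, u)"] by auto
      qed
      moreover have "(\<Sum>u\<in>?S - {v}. jump_count Y u v 0 t \<omega>) = (\<Sum>u\<in>nbrs E v. jump_count Y u v 0 t \<omega>)"
      proof (intro sum.mono_neutral_right[OF fin sub] ballI)
        fix u assume "u \<in> ?S - {v} - nbrs E v"
        then show "jump_count Y u v 0 t \<omega> = 0" using z[rule_format, of "(u, v)"] nbrs_sym[of v u] by auto
      qed
      ultimately show "of_bool (Y t \<omega> = v) + (\<Sum>u\<in>nbrs E v. jump_count Y v u 0 t \<omega>)
        = of_bool (x = v) + (\<Sum>u\<in>nbrs E v. jump_count Y u v 0 t \<omega>)"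
        using W(2)[of ?S] W(1) degree(1) start by simp
    qed
  qed
qed

text \<open>The expectation of \<open>occupation_balance\<close> against \<open>Z\<close>, with jumps replaced by their intensities. It is not
closed, since \<open>intensity\<close> multiplies the indicator of the walk by a random rate; but this rate is a
function of the environment and can be absorbed into \<open>Z\<close>.\<close>

lemma forward_equation:
  assumes t: "0 \<le> t"
    and Z: "Z \<in> borel_measurable env" "\<And>\<omega>. \<omega> \<in> space N \<Longrightarrow> 0 \<le> Z \<omega>" "\<And>\<omega>. \<omega> \<in> space N \<Longrightarrow> Z \<omega> \<le> c"
  shows "(\<integral>\<omega>. Z \<omega> * of_bool (Y t \<omega> = v) \<partial>N) = (\<integral>\<omega>. Z \<omega> \<partial>N) * of_bool (x = v)
    + inflow (\<lambda>u r. \<integral>\<omega>. Z \<omega> * intensity u r \<omega> \<partial>N) v t"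
proof -
  note [measurable] = env_measurable_N[OF Z(1)]
  note Yt = walk_indicator_measurable[OF t, of v]
  have Zb: "\<bar>Z \<omega>\<bar> \<le> c" if "\<omega> \<in> space N" for \<omega> using Z(2,3) that by auto
  have iZ: "integrable N Z" using Zb by (intro N.integrable_const_bound[of _ c] AE_I2) auto
  have iY: "integrable N (\<lambda>\<omega>. Z \<omega> * of_bool (Y t \<omega> = v))"
    using Yt by (intro Bochner_Integration.integrable_bound[OF iZ] AE_I2) auto
  have ij: "integrable N (\<lambda>\<omega>. Z \<omega> * real (jump_count Y v u 0 t \<omega>))"
    "integrable N (\<lambda>\<omega>. Z \<omega> * real (jump_count Y u v 0 t \<omega>))" if "u \<in> nbrs E v" for u
    using expected_jumps(1)[OF _ t Z] that nbrs_sym by blast+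
  let ?L = "\<lambda>\<omega>. Z \<omega> * of_bool (Y t \<omega> = v) + (\<Sum>u\<in>nbrs E v. Z \<omega> * real (jump_count Y v u 0 t \<omega>))"
  let ?R = "\<lambda>\<omega>. Z \<omega> * of_bool (x = v) + (\<Sum>u\<in>nbrs E v. Z \<omega> * real (jump_count Y u v 0 t \<omega>))"
  have "integral\<^sup>L N ?L = integral\<^sup>L N ?R"
  proof (rule integral_cong_AE)
    show "AE \<omega> in N. ?L \<omega> = ?R \<omega>"
      using occupation_balance[OF t]
    proof eventually_elim
      fix \<omega> assume "\<forall>v. of_bool (Y t \<omega> = v) + (\<Sum>u\<in>nbrs E v. jump_count Y v u 0 t \<omega>)
        = of_bool (x = v) + (\<Sum>u\<in>nbrs E v. jump_count Y u v 0 t \<omega>)"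
      from arg_cong[OF this[rule_format, of v], of real]
      have "of_bool (Y t \<omega> = v) + (\<Sum>u\<in>nbrs E v. real (jump_count Y v u 0 t \<omega>))
        = of_bool (x = v) + (\<Sum>u\<in>nbrs E v. real (jump_count Y u v 0 t \<omega>))" by simp
      from arg_cong[OF this, of "\<lambda>q. Z \<omega> * q"] show "?L \<omega> = ?R \<omega>"
        unfolding distrib_left sum_distrib_left .
    qed
    show "?L \<in> borel_measurable N" "?R \<in> borel_measurable N"
      using iY ij iZ by (intro borel_measurable_integrable Bochner_Integration.integrable_add Bochner_Integration.integrable_sum; simp)+
  qed
  moreover have "integral\<^sup>L N ?L = (\<integral>\<omega>. Z \<omega> * of_bool (Y t \<omega> = v) \<partial>N) + (\<Sum>u\<in>nbrs E v. \<integral>\<omega>. Z \<omega> * real (jump_count Y v u 0 t \<omega>) \<partial>N)"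
    using iY ij by (subst Bochner_Integration.integral_add) (auto simp: Bochner_Integration.integral_sum)
  moreover have "integral\<^sup>L N ?R = (\<integral>\<omega>. Z \<omega> \<partial>N) * of_bool (x = v) + (\<Sum>u\<in>nbrs E v. \<integral>\<omega>. Z \<omega> * real (jump_count Y u v 0 t \<omega>) \<partial>N)"
    using iZ ij by (subst Bochner_Integration.integral_add) (auto simp: Bochner_Integration.integral_sum)
  moreover have "inflow (\<lambda>u r. \<integral>\<omega>. Z \<omega> * intensity u r \<omega> \<partial>N) v t
      = (\<Sum>u\<in>nbrs E v. \<integral>\<omega>. Z \<omega> * real (jump_count Y u v 0 t \<omega>) \<partial>N) - (\<Sum>u\<in>nbrs E v. \<integral>\<omega>. Z \<omega> * real (jump_count Y v u 0 t \<omega>) \<partial>N)"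
    unfolding sum_subtractf[symmetric]
  proof (rule sum.cong[OF refl])
    fix u assume u: "u \<in> nbrs E v"
    then have v: "v \<in> nbrs E u" using nbrs_sym by blast
    show "(LBINT r:{0..t}. (\<integral>\<omega>. Z \<omega> * intensity u r \<omega> \<partial>N) - (\<integral>\<omega>. Z \<omega> * intensity v r \<omega> \<partial>N))
      = (\<integral>\<omega>. Z \<omega> * real (jump_count Y u v 0 t \<omega>) \<partial>N) - (\<integral>\<omega>. Z \<omega> * real (jump_count Y v u 0 t \<omega>) \<partial>N)"
      using set_integral_diff(2)[OF expected_jumps(3)[OF v t Z] expected_jumps(3)[OF u t Z]]
        expected_jumps(2)[OF v t Z] expected_jumps(2)[OF u t Z] by simp
  qed
  ultimately show ?thesis by linarith
qed

end

section \<open>The derivative of the flow is the law of the walk\<close>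

lemma (in bounded_graph) tempered_upd:
  assumes "tempered E \<sigma>"
  shows "tempered E (\<sigma>(z := s))"
proof -
  obtain n :: nat where n: "\<And>v. \<bar>\<sigma> v\<bar> \<le> real n * growth (real n) z v"
    using assms tempered_based[of \<sigma> z] by blast
  have "\<bar>(\<sigma>(z := s)) v\<bar> \<le> (real n + \<bar>s\<bar>) * growth (real n) z v" for v
  proof (cases "v = z")
    case True
    have "\<bar>s\<bar> * 1 \<le> (real n + \<bar>s\<bar>) * growth (real n) z v"
      by (intro mult_mono) auto
    then show ?thesis using True by simp
  next
    case False
    have "real n * growth (real n) z v \<le> (real n + \<bar>s\<bar>) * growth (real n) z v"
      by (intro mult_right_mono) auto
    from order_trans[OF n[of v] this] show ?thesis using False by simp
  qed
  then show ?thesis unfolding tempered_def by blast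
qed

context gl_walk_from
begin

abbreviation shifted :: "real \<Rightarrow> 'v \<Rightarrow> real" where
  "shifted h \<equiv> \<sigma>(x := \<sigma> x + h)"

lemma tempered_shifted: "tempered E (shifted h)"
  by (rule tempered_upd[OF tempered_start])

text \<open>Displacements caused by shifting the initial configuration by \<open>h\<close> at \<open>x\<close>.\<close>

definition dpath :: "real \<Rightarrow> 'v \<Rightarrow> real \<Rightarrow> 'w \<Rightarrow> real" where
  "dpath h u r \<omega> = \<eta> (shifted h) r \<omega> u - \<eta> \<sigma> r \<omega> u"

definition dforce :: "real \<Rightarrow> 'v \<Rightarrow> real \<Rightarrow> 'w \<Rightarrow> real" where
  "dforce h u r \<omega> = force (shifted h) u r \<omega> - force \<sigma> u r \<omega>"

definition stiffness :: "'v \<Rightarrow> real \<Rightarrow> 'w \<Rightarrow> real" where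
  "stiffness u r \<omega> = deriv (deriv (U u)) (\<eta> \<sigma> r \<omega> u)"

lemma stiffness_bounds: "0 \<le> stiffness u r \<omega>" "stiffness u r \<omega> \<le> Cp"
  using pot.bounds[of u "\<eta> \<sigma> r \<omega> u"] Cp_pos by (auto simp: stiffness_def)

lemma intensity_eq: "intensity u r \<omega> = stiffness u r \<omega> * of_bool (Y r \<omega> = u)"
  by (simp add: intensity_def stiffness_def)

lemma dpath_joint_measurable:
  "(\<lambda>(r, \<omega>). dpath h u (max 0 r) \<omega>) \<in> borel_measurable (borel \<Otimes>\<^sub>M N)"
  using borel_measurable_diff[OF path_joint_measurable[OF tempered_shifted, of h u] path_joint_measurable[OF tempered_start, of u]]
  by (simp add: dpath_def split_beta')

lemma dforce_joint_measurable:
  "(\<lambda>(r, \<omega>). dforce h u (max 0 r) \<omega>) \<in> borel_measurable (borel \<Otimes>\<^sub>M N)"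
  using borel_measurable_diff[OF force_joint_measurable[OF tempered_shifted, of h u] force_joint_measurable[OF tempered_start, of u]]
  by (simp add: dforce_def split_beta')

lemma stiffness_joint_measurable:
  "(\<lambda>(r, \<omega>). stiffness u (max 0 r) \<omega>) \<in> borel_measurable (borel \<Otimes>\<^sub>M N)"
  using measurable_compose[OF path_joint_measurable[OF tempered_start, of u] pot.borel_V(3)[of u]]
  by (simp add: stiffness_def split_beta')

lemma section_measurable:
  assumes "(\<lambda>(r, \<omega>). f (max 0 r) \<omega>) \<in> borel_measurable (borel \<Otimes>\<^sub>M N)" "0 \<le> r"
  shows "f (r::real) \<in> borel_measurable N"
  using measurable_compose[OF measurable_Pair1' assms(1), of r] assms(2) by simp

lemma dforce_le: "\<bar>dforce h u r \<omega>\<bar> \<le> Cp * \<bar>dpath h u r \<omega>\<bar>"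
  unfolding dforce_def dpath_def force_def by (rule pot.V'_lipschitz)

text \<open>The factor by which a shift at a single site can grow, in the sup-norm over all sites, up to time \<open>T\<close>.\<close>

definition flow_bound :: "real \<Rightarrow> real" where
  "flow_bound T = exp (growth_rate 0 * T)"

lemma flow_bound_pos: "0 < flow_bound T"
  by (simp add: flow_bound_def)

text \<open>The shift is bounded by the constant weight, that is, by exponential growth at rate \<open>0\<close>.\<close>

lemma dpath_bound:
  assumes T: "0 \<le> T"
  shows "AE \<omega> in N. \<forall>r\<in>{0..T}. \<forall>u. \<bar>dpath h u r \<omega>\<bar> \<le> \<bar>h\<bar> * flow_bound T"
proof -
  have "AE \<omega> in N. \<forall>r\<in>{0..T}. \<forall>z. \<bar>\<eta> (shifted h) r \<omega> z - \<eta> \<sigma> r \<omega> z\<bar>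
      \<le> \<bar>h\<bar> * growth 0 x z * exp (growth_rate 0 * r)"
    by (rule difference_bound[OF tempered_start tempered_shifted T]) auto
  then show ?thesis
  proof eventually_elim
    case (elim \<omega>)
    note b = elim(1)
    show "\<forall>r\<in>{0..T}. \<forall>u. \<bar>dpath h u r \<omega>\<bar> \<le> \<bar>h\<bar> * flow_bound T"
    proof (intro ballI allI)
      fix r u assume r: "r \<in> {0..T}"
      have "\<bar>dpath h u r \<omega>\<bar> \<le> \<bar>h\<bar> * exp (growth_rate 0 * r)"
        using b r by (simp add: dpath_def)
      also have "\<dots> \<le> \<bar>h\<bar> * flow_bound T"
        unfolding flow_bound_def using r growth_rate_nonneg by (intro mult_left_mono) (auto intro!: mult_left_mono)
      finally show "\<bar>dpath h u r \<omega>\<bar> \<le> \<bar>h\<bar> * flow_bound T" .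
    qed
  qed
qed

text \<open>What the difference equation lacks to be the forward equation of the walk: the force is
replaced by its linearization.\<close>

definition lin_error :: "real \<Rightarrow> 'v \<Rightarrow> real \<Rightarrow> 'w \<Rightarrow> real" where
  "lin_error h u r \<omega> = stiffness u r \<omega> * dpath h u r \<omega> - dforce h u r \<omega>"

lemma lin_error_joint_measurable:
  "(\<lambda>(r, \<omega>). lin_error h u (max 0 r) \<omega>) \<in> borel_measurable (borel \<Otimes>\<^sub>M N)"
  using borel_measurable_diff[OF borel_measurable_times[OF stiffness_joint_measurable[of u] dpath_joint_measurable[of h u]] dforce_joint_measurable[of h u]]
  by (simp add: lin_error_def split_beta')

lemma lin_error_le: "\<bar>lin_error h u r \<omega>\<bar> \<le> 2 * Cp * \<bar>dpath h u r \<omega>\<bar>"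
proof -
  have "\<bar>stiffness u r \<omega> * dpath h u r \<omega>\<bar> \<le> Cp * \<bar>dpath h u r \<omega>\<bar>"
    unfolding abs_mult using stiffness_bounds by (intro mult_right_mono) auto
  then show ?thesis using dforce_le[of h u r \<omega>] by (simp add: lin_error_def)
qed

lemma lin_error_bound:
  assumes T: "0 \<le> T"
  shows "AE \<omega> in N. \<forall>r\<in>{0..T}. \<forall>u. \<bar>lin_error h u r \<omega>\<bar> \<le> 2 * Cp * (\<bar>h\<bar> * flow_bound T)"
  using dpath_bound[OF T, of h]
proof eventually_elim
  fix \<omega> assume b: "\<forall>r\<in>{0..T}. \<forall>u. \<bar>dpath h u r \<omega>\<bar> \<le> \<bar>h\<bar> * flow_bound T"
  show "\<forall>r\<in>{0..T}. \<forall>u. \<bar>lin_error h u r \<omega>\<bar> \<le> 2 * Cp * (\<bar>h\<bar> * flow_bound T)"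
  proof (intro ballI allI)
    fix r u assume "r \<in> {0..T}"
    then have "2 * Cp * \<bar>dpath h u r \<omega>\<bar> \<le> 2 * Cp * (\<bar>h\<bar> * flow_bound T)"
      using b Cp_pos by (intro mult_left_mono) auto
    then show "\<bar>lin_error h u r \<omega>\<bar> \<le> 2 * Cp * (\<bar>h\<bar> * flow_bound T)"
      using lin_error_le[of h u r \<omega>] by linarith
  qed
qed

definition mean_lin_error :: "real \<Rightarrow> 'v \<Rightarrow> real \<Rightarrow> real" where
  "mean_lin_error h u r = (\<integral>\<omega>. \<bar>lin_error h u r \<omega>\<bar> \<partial>N)"

definition total_lin_error :: "real \<Rightarrow> real \<Rightarrow> 'v \<Rightarrow> real" where
  "total_lin_error T h u = (LBINT r:{0..T}. mean_lin_error h u r / \<bar>h\<bar>)"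

lemma mean_lin_error_nonneg: "0 \<le> mean_lin_error h u r"
  by (simp add: mean_lin_error_def)

lemma lin_error_integrable:
  assumes "0 \<le> r"
  shows "integrable N (lin_error h u r)"
proof (rule N.integrable_const_bound)
  show "AE \<omega> in N. norm (lin_error h u r \<omega>) \<le> 2 * Cp * (\<bar>h\<bar> * flow_bound r)"
    using lin_error_bound[OF assms, of h] by eventually_elim (use assms in auto)
qed (rule section_measurable[OF lin_error_joint_measurable assms])

lemma mean_lin_error_le:
  assumes "r \<in> {0..T}"
  shows "mean_lin_error h u r \<le> 2 * Cp * (\<bar>h\<bar> * flow_bound T)"
proof -
  have T: "0 \<le> T" using assms by simp
  have "AE \<omega> in N. \<bar>lin_error h u r \<omega>\<bar> \<le> 2 * Cp * (\<bar>h\<bar> * flow_bound T)"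
    using lin_error_bound[OF T, of h] by eventually_elim (use assms in auto)
  then show ?thesis
    unfolding mean_lin_error_def using lin_error_integrable[of r h u] assms by (intro N.integral_le_const) auto
qed

lemma mean_lin_error_set_integrable: 
  assumes T: "0 \<le> T"
  shows "set_integrable lborel {0..T} (mean_lin_error h u)"
proof -
  have m: "(\<lambda>(r, \<omega>). \<bar>lin_error h u (max 0 r) \<omega>\<bar>) \<in> borel_measurable (borel \<Otimes>\<^sub>M N)"
    using borel_measurable_abs[OF lin_error_joint_measurable[of h u]] by (simp add: split_beta')
  have "AE \<omega> in N. \<forall>r\<in>{0..T}. \<bar>\<bar>lin_error h u r \<omega>\<bar>\<bar> \<le> 2 * Cp * (\<bar>h\<bar> * flow_bound T)"
    using lin_error_bound[OF T, of h] by eventually_elim auto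
  from N.time_fubini(2)[OF m this] show ?thesis
    by (simp add: mean_lin_error_def[abs_def])
qed

text \<open>Differentiability of \<open>U u'\<close> at the single point \<open>\<eta> \<sigma> r \<omega> u\<close> suffices, by dominated convergence.\<close>

lemma mean_lin_error_tendsto:
  assumes h: "\<And>k. h k \<noteq> 0" "h \<longlonglongrightarrow> 0" and r: "0 \<le> r"
  shows "(\<lambda>k. mean_lin_error (h k) u r / \<bar>h k\<bar>) \<longlonglongrightarrow> 0"
proof -
  have "(\<lambda>k. \<integral>\<omega>. \<bar>lin_error (h k) u r \<omega>\<bar> / \<bar>h k\<bar> \<partial>N) \<longlonglongrightarrow> (\<integral>\<omega>. 0 \<partial>N)"
  proof (rule integral_dominated_convergence[where w = "\<lambda>_. 2 * Cp * flow_bound r"])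
    have "AE \<omega> in N. \<forall>k. \<bar>dpath (h k) u r \<omega>\<bar> \<le> \<bar>h k\<bar> * flow_bound r"
    proof (subst AE_all_countable, rule allI)
      fix k
      show "AE \<omega> in N. \<bar>dpath (h k) u r \<omega>\<bar> \<le> \<bar>h k\<bar> * flow_bound r"
        using dpath_bound[OF r, of "h k"] by eventually_elim (use r in auto)
    qed
    then show "AE \<omega> in N. (\<lambda>k. \<bar>lin_error (h k) u r \<omega>\<bar> / \<bar>h k\<bar>) \<longlonglongrightarrow> 0"
    proof eventually_elim
      fix \<omega> assume b: "\<forall>k. \<bar>dpath (h k) u r \<omega>\<bar> \<le> \<bar>h k\<bar> * flow_bound r"
      let ?q = "\<eta> \<sigma> r \<omega> u"
      have d: "(deriv (U u) has_derivative (\<lambda>k. deriv (deriv (U u)) ?q * k)) (at ?q)"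
        using pot.DERIV_V'[of u ?q] by (simp add: has_field_derivative_def)
      show "(\<lambda>k. \<bar>lin_error (h k) u r \<omega>\<bar> / \<bar>h k\<bar>) \<longlonglongrightarrow> 0"
      proof (rule LIMSEQ_I)
        fix e :: real assume e: "0 < e"
        define e' where "e' = e / (2 * flow_bound r)"
        have e': "0 < e'" using e flow_bound_pos by (simp add: e'_def)
        obtain \<delta> where \<delta>: "0 < \<delta>" "\<And>q. \<bar>q - ?q\<bar> < \<delta> \<Longrightarrow>
            \<bar>deriv (U u) q - deriv (U u) ?q - deriv (deriv (U u)) ?q * (q - ?q)\<bar> \<le> e' * \<bar>q - ?q\<bar>"
          using d e' unfolding has_derivative_at_alt real_norm_def by metis
        have "(\<lambda>k. \<bar>h k\<bar> * flow_bound r) \<longlonglongrightarrow> \<bar>0\<bar> * flow_bound r"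
          using h by (intro tendsto_intros)
        then have "\<forall>\<^sub>F k in sequentially. \<bar>h k\<bar> * flow_bound r < \<delta>"
          using \<delta>(1) by (intro order_tendstoD) auto
        then obtain K where K: "\<And>k. K \<le> k \<Longrightarrow> \<bar>h k\<bar> * flow_bound r < \<delta>"
          by (auto simp: eventually_sequentially)
        have "norm (\<bar>lin_error (h k) u r \<omega>\<bar> / \<bar>h k\<bar> - 0) < e" if "K \<le> k" for k
        proof -
          have dk: "\<bar>dpath (h k) u r \<omega>\<bar> < \<delta>" using b K[OF that] by (meson le_less_trans)
          have "\<bar>lin_error (h k) u r \<omega>\<bar> \<le> e' * \<bar>dpath (h k) u r \<omega>\<bar>"
            using \<delta>(2)[of "\<eta> (shifted (h k)) r \<omega> u"] dk
            by (simp add: lin_error_def stiffness_def dforce_def force_def dpath_def abs_minus_commute)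
          also have "\<dots> \<le> e' * (\<bar>h k\<bar> * flow_bound r)"
            using b e' by (intro mult_left_mono) auto
          also have "\<dots> = e / 2 * \<bar>h k\<bar>"
            using flow_bound_pos[of r] by (simp add: e'_def)
          finally have "\<bar>lin_error (h k) u r \<omega>\<bar> / \<bar>h k\<bar> \<le> e / 2"
            using h(1)[of k] by (simp add: pos_divide_le_eq)
          with e have "\<bar>lin_error (h k) u r \<omega>\<bar> / \<bar>h k\<bar> < e" by linarith
          then show ?thesis by simp
        qed
        then show "\<exists>K. \<forall>k\<ge>K. norm (\<bar>lin_error (h k) u r \<omega>\<bar> / \<bar>h k\<bar> - 0) < e" by blast
      qed
    qed
    show "AE \<omega> in N. norm (\<bar>lin_error (h k) u r \<omega>\<bar> / \<bar>h k\<bar>) \<le> 2 * Cp * flow_bound r" for k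
      using lin_error_bound[OF r, of "h k"]
    proof eventually_elim
      fix \<omega> assume "\<forall>s\<in>{0..r}. \<forall>u. \<bar>lin_error (h k) u s \<omega>\<bar> \<le> 2 * Cp * (\<bar>h k\<bar> * flow_bound r)"
      then have "\<bar>lin_error (h k) u r \<omega>\<bar> \<le> 2 * Cp * (\<bar>h k\<bar> * flow_bound r)" using r by simp
      then show "norm (\<bar>lin_error (h k) u r \<omega>\<bar> / \<bar>h k\<bar>) \<le> 2 * Cp * flow_bound r"
        using h(1)[of k] by (simp add: pos_divide_le_eq mult_ac)
    qed
    show "(\<lambda>\<omega>. \<bar>lin_error (h k) u r \<omega>\<bar> / \<bar>h k\<bar>) \<in> borel_measurable N" for k
      using lin_error_integrable[OF r, of "h k" u] by (intro borel_measurable_integrable) simp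
  qed auto
  then show ?thesis by (simp add: mean_lin_error_def)
qed

lemma total_lin_error_tendsto:
  assumes h: "\<And>k. h k \<noteq> 0" "h \<longlonglongrightarrow> 0" and T: "0 \<le> T"
  shows "(\<lambda>k. total_lin_error T (h k) u) \<longlonglongrightarrow> 0"
proof -
  have "(\<lambda>k. \<integral>r. indicator {0..T} r *\<^sub>R (mean_lin_error (h k) u r / \<bar>h k\<bar>) \<partial>lborel) \<longlonglongrightarrow> (\<integral>r. 0 \<partial>(lborel :: real measure))"
  proof (rule integral_dominated_convergence[where w = "\<lambda>r. indicator {0..T} r *\<^sub>R (2 * Cp * flow_bound T)"])
    show "AE r in lborel. (\<lambda>k. indicator {0..T} r *\<^sub>R (mean_lin_error (h k) u r / \<bar>h k\<bar>)) \<longlonglongrightarrow> 0"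
    proof (rule AE_I2)
      fix r :: real
      show "(\<lambda>k. indicator {0..T} r *\<^sub>R (mean_lin_error (h k) u r / \<bar>h k\<bar>)) \<longlonglongrightarrow> 0"
        using mean_lin_error_tendsto[OF h, of r u] by (cases "r \<in> {0..T}") auto
    qed
    show "AE r in lborel. norm (indicator {0..T} r *\<^sub>R (mean_lin_error (h k) u r / \<bar>h k\<bar>)) \<le> indicator {0..T} r *\<^sub>R (2 * Cp * flow_bound T)" for k
    proof (rule AE_I2)
      fix r :: real
      show "norm (indicator {0..T} r *\<^sub>R (mean_lin_error (h k) u r / \<bar>h k\<bar>)) \<le> indicator {0..T} r *\<^sub>R (2 * Cp * flow_bound T)"
        using mean_lin_error_le[of r T "h k" u] mean_lin_error_nonneg[of "h k" u r] h(1)[of k]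
        by (cases "r \<in> {0..T}") (auto simp: pos_divide_le_eq mult_ac)
    qed
    show "integrable lborel (\<lambda>r. indicator {0..T} r *\<^sub>R (2 * Cp * flow_bound T))"
      using borel_integrable_atLeastAtMost'[of 0 T "\<lambda>_. 2 * Cp * flow_bound T"] by (simp add: set_integrable_def)
    show "(\<lambda>r. indicator {0..T} r *\<^sub>R (mean_lin_error (h k) u r / \<bar>h k\<bar>)) \<in> borel_measurable lborel" for k
      using borel_measurable_divide[OF borel_measurable_integrable[OF mean_lin_error_set_integrable[OF T, of "h k" u, unfolded set_integrable_def]] borel_measurable_const[of "\<bar>h k\<bar>"]]
      by simp
  qed simp
  then show ?thesis
    by (simp add: total_lin_error_def set_lebesgue_integral_def)
qed

text \<open>The quantity to be shown to be \<open>o(h)\<close> for \<open>Z = 1\<close>. General \<open>Z\<close> occur in the iteration.\<close>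

definition discrepancy :: "real \<Rightarrow> 'v \<Rightarrow> real \<Rightarrow> ('w \<Rightarrow> real) \<Rightarrow> real" where
  "discrepancy h v t Z = (\<integral>\<omega>. Z \<omega> * (h * of_bool (Y t \<omega> = v) - dpath h v t \<omega>) \<partial>N)"

definition weight :: "real \<Rightarrow> ('w \<Rightarrow> real) \<Rightarrow> bool" where
  "weight c Z \<longleftrightarrow> Z \<in> borel_measurable env \<and> (\<forall>\<omega>\<in>space N. 0 \<le> Z \<omega> \<and> Z \<omega> \<le> c)"

lemma weight_D:
  assumes "weight c Z"
  shows "Z \<in> borel_measurable env" "\<And>\<omega>. \<omega> \<in> space N \<Longrightarrow> 0 \<le> Z \<omega>" "\<And>\<omega>. \<omega> \<in> space N \<Longrightarrow> Z \<omega> \<le> c"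
    "Z \<in> borel_measurable N" "\<And>\<omega>. \<omega> \<in> space N \<Longrightarrow> \<bar>Z \<omega>\<bar> \<le> c" "0 \<le> c"
proof -
  show *: "Z \<in> borel_measurable env" "\<And>\<omega>. \<omega> \<in> space N \<Longrightarrow> 0 \<le> Z \<omega>" "\<And>\<omega>. \<omega> \<in> space N \<Longrightarrow> Z \<omega> \<le> c"
    using assms by (auto simp: weight_def)
  show "Z \<in> borel_measurable N" by (rule env_measurable_N[OF *(1)])
  show "\<And>\<omega>. \<omega> \<in> space N \<Longrightarrow> \<bar>Z \<omega>\<bar> \<le> c" using * by auto
  obtain \<omega> where "\<omega> \<in> space N" using N.not_empty by blast
  with * show "0 \<le> c" by force
qed

lemma weight_stiffness:
  assumes Z: "weight c Z" and r: "0 \<le> r"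
  shows "weight (c * Cp) (\<lambda>\<omega>. Z \<omega> * stiffness u r \<omega>)"
proof -
  have "(\<lambda>\<omega>. stiffness u r \<omega>) \<in> borel_measurable env"
    unfolding stiffness_def using measurable_compose[OF path_env_measurable[OF r, of u] pot.borel_V(3)[of u]] .
  then show ?thesis
    using weight_D[OF Z] stiffness_bounds[of u r] Cp_pos
    by (auto simp: weight_def intro!: mult_mono)
qed

lemma weighted_integrable:
  assumes Z: "weight c Z" and f: "f \<in> borel_measurable N" "AE \<omega> in N. \<bar>f \<omega>\<bar> \<le> K"
  shows "integrable N (\<lambda>\<omega>. Z \<omega> * f \<omega>)"
proof (rule N.integrable_const_bound)
  show "AE \<omega> in N. norm (Z \<omega> * f \<omega>) \<le> c * K"
    using f(2) AE_space
  proof eventually_elim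
    fix \<omega> assume "\<bar>f \<omega>\<bar> \<le> K" "\<omega> \<in> space N"
    then show "norm (Z \<omega> * f \<omega>) \<le> c * K"
      using weight_D(5,6)[OF Z] by (auto simp: abs_mult intro!: mult_mono)
  qed
  show "(\<lambda>\<omega>. Z \<omega> * f \<omega>) \<in> borel_measurable N"
    using weight_D(4)[OF Z] f(1) by (rule borel_measurable_times)
qed

lemma dpath_AE: "0 \<le> t \<Longrightarrow> AE \<omega> in N. \<bar>dpath h v t \<omega>\<bar> \<le> \<bar>h\<bar> * flow_bound t"
  using dpath_bound[of t h] by (auto elim!: eventually_mono)

lemma dforce_AE: "0 \<le> t \<Longrightarrow> AE \<omega> in N. \<bar>dforce h v t \<omega>\<bar> \<le> Cp * (\<bar>h\<bar> * flow_bound t)"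
  using dpath_AE[of t h v]
proof (rule eventually_mono)
  fix \<omega> assume "\<bar>dpath h v t \<omega>\<bar> \<le> \<bar>h\<bar> * flow_bound t"
  then have "Cp * \<bar>dpath h v t \<omega>\<bar> \<le> Cp * (\<bar>h\<bar> * flow_bound t)"
    using Cp_pos by (intro mult_left_mono) auto
  then show "\<bar>dforce h v t \<omega>\<bar> \<le> Cp * (\<bar>h\<bar> * flow_bound t)" using dforce_le[of h v t \<omega>] by linarith
qed

lemma weighted_path_integrable:
  assumes Z: "weight c Z" and t: "0 \<le> t"
  shows "integrable N (\<lambda>\<omega>. Z \<omega> * dpath h v t \<omega>)" "integrable N (\<lambda>\<omega>. Z \<omega> * dforce h v t \<omega>)"
    "integrable N (\<lambda>\<omega>. Z \<omega> * lin_error h v t \<omega>)" "integrable N (\<lambda>\<omega>. Z \<omega> * of_bool (Y t \<omega> = v))"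
    "integrable N (\<lambda>\<omega>. Z \<omega> * intensity v t \<omega>)" "integrable N Z"
proof -
  show "integrable N (\<lambda>\<omega>. Z \<omega> * dpath h v t \<omega>)"
    by (rule weighted_integrable[OF Z section_measurable[OF dpath_joint_measurable t] dpath_AE[OF t]])
  show "integrable N (\<lambda>\<omega>. Z \<omega> * dforce h v t \<omega>)"
    by (rule weighted_integrable[OF Z section_measurable[OF dforce_joint_measurable t] dforce_AE[OF t]])
  have "AE \<omega> in N. \<bar>lin_error h v t \<omega>\<bar> \<le> 2 * Cp * (\<bar>h\<bar> * flow_bound t)"
    using lin_error_bound[OF t, of h] by eventually_elim (use t in auto)
  then show "integrable N (\<lambda>\<omega>. Z \<omega> * lin_error h v t \<omega>)"
    by (rule weighted_integrable[OF Z section_measurable[OF lin_error_joint_measurable t]])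
  show "integrable N (\<lambda>\<omega>. Z \<omega> * of_bool (Y t \<omega> = v))"
    by (rule weighted_integrable[OF Z walk_indicator_measurable[OF t], where K = 1]) simp
  show "integrable N (\<lambda>\<omega>. Z \<omega> * intensity v t \<omega>)"
    using intensity_bounds[of v t] by (intro weighted_integrable[OF Z intensity_measurable[OF t], where K = Cp]) simp
  show "integrable N Z"
    using weighted_integrable[OF Z, of "\<lambda>_. 1" 1] by simp
qed

lemma weighted_forward_equation:
  assumes Z: "weight c Z" and t: "0 \<le> t"
  shows "(\<integral>\<omega>. Z \<omega> * of_bool (Y t \<omega> = v) \<partial>N) = (\<integral>\<omega>. Z \<omega> \<partial>N) * of_bool (x = v)
    + inflow (\<lambda>u r. \<integral>\<omega>. Z \<omega> * intensity u r \<omega> \<partial>N) v t"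
  using weight_D(2,3)[OF Z] by (intro forward_equation[OF t weight_D(1)[OF Z]])

lemma weighted_intensity_set_integrable:
  assumes Z: "weight c Z" and t: "0 \<le> t" and w: "w \<in> nbrs E u"
  shows "set_integrable lborel {0..t} (\<lambda>r. \<integral>\<omega>. Z \<omega> * intensity u r \<omega> \<partial>N)"
  using weight_D(2,3)[OF Z] by (intro expected_jumps(3)[OF w t weight_D(1)[OF Z]])

text \<open>The rate at which \<open>u\<close> feeds the discrepancies at its neighbours.\<close>

definition source :: "real \<Rightarrow> 'v \<Rightarrow> real \<Rightarrow> ('w \<Rightarrow> real) \<Rightarrow> real" where
  "source h u r Z = h * (\<integral>\<omega>. Z \<omega> * intensity u r \<omega> \<partial>N) - (\<integral>\<omega>. Z \<omega> * dforce h u r \<omega> \<partial>N)"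

lemma dforce_fubini:
  assumes Z: "weight c Z" and t: "0 \<le> t"
  shows "set_integrable lborel {0..t} (\<lambda>r. \<integral>\<omega>. Z \<omega> * dforce h u r \<omega> \<partial>N)"
    "integrable N (\<lambda>\<omega>. LBINT r:{0..t}. Z \<omega> * dforce h u r \<omega>)"
    "(\<integral>\<omega>. (LBINT r:{0..t}. Z \<omega> * dforce h u r \<omega>) \<partial>N) = (LBINT r:{0..t}. \<integral>\<omega>. Z \<omega> * dforce h u r \<omega> \<partial>N)"
proof -
  have m: "(\<lambda>(r, \<omega>). Z \<omega> * dforce h u (max 0 r) \<omega>) \<in> borel_measurable (borel \<Otimes>\<^sub>M N)"
  proof -
    note [measurable] = dforce_joint_measurable[of h u, unfolded split_beta'] weight_D(4)[OF Z]
    show ?thesis unfolding split_beta' by measurable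
  qed
  have b: "AE \<omega> in N. \<forall>r\<in>{0..t}. \<bar>Z \<omega> * dforce h u r \<omega>\<bar> \<le> c * (Cp * (\<bar>h\<bar> * flow_bound t))"
    using dpath_bound[OF t, of h] AE_space
  proof eventually_elim
    fix \<omega> assume d: "\<forall>r\<in>{0..t}. \<forall>u. \<bar>dpath h u r \<omega>\<bar> \<le> \<bar>h\<bar> * flow_bound t" and \<omega>: "\<omega> \<in> space N"
    show "\<forall>r\<in>{0..t}. \<bar>Z \<omega> * dforce h u r \<omega>\<bar> \<le> c * (Cp * (\<bar>h\<bar> * flow_bound t))"
    proof
      fix r assume r: "r \<in> {0..t}"
      have "Cp * \<bar>dpath h u r \<omega>\<bar> \<le> Cp * (\<bar>h\<bar> * flow_bound t)"
        using d r Cp_pos by (intro mult_left_mono) auto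
      then have "\<bar>dforce h u r \<omega>\<bar> \<le> Cp * (\<bar>h\<bar> * flow_bound t)"
        using dforce_le[of h u r \<omega>] by linarith
      then show "\<bar>Z \<omega> * dforce h u r \<omega>\<bar> \<le> c * (Cp * (\<bar>h\<bar> * flow_bound t))"
        unfolding abs_mult using weight_D(5,6)[OF Z] \<omega> by (intro mult_mono) auto
    qed
  qed
  show "set_integrable lborel {0..t} (\<lambda>r. \<integral>\<omega>. Z \<omega> * dforce h u r \<omega> \<partial>N)"
    "integrable N (\<lambda>\<omega>. LBINT r:{0..t}. Z \<omega> * dforce h u r \<omega>)"
    "(\<integral>\<omega>. (LBINT r:{0..t}. Z \<omega> * dforce h u r \<omega>) \<partial>N) = (LBINT r:{0..t}. \<integral>\<omega>. Z \<omega> * dforce h u r \<omega> \<partial>N)"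
    using N.time_fubini[OF m b] by auto
qed

lemma weighted_flow_equation:
  assumes Z: "weight c Z" and t: "0 \<le> t"
  shows "(\<integral>\<omega>. Z \<omega> * dpath h v t \<omega> \<partial>N) = h * (\<integral>\<omega>. Z \<omega> \<partial>N) * of_bool (x = v)
    + (\<Sum>u\<in>nbrs E v. (LBINT r:{0..t}. \<integral>\<omega>. Z \<omega> * dforce h u r \<omega> \<partial>N) - (LBINT r:{0..t}. \<integral>\<omega>. Z \<omega> * dforce h v r \<omega> \<partial>N))"
proof -
  let ?J = "\<lambda>u \<omega>. LBINT r:{0..t}. Z \<omega> * dforce h u r \<omega>"
  note F = dforce_fubini[OF Z t, of h]
  have "(\<integral>\<omega>. Z \<omega> * dpath h v t \<omega> \<partial>N) = (\<integral>\<omega>. h * of_bool (x = v) * Z \<omega> + (\<Sum>u\<in>nbrs E v. ?J u \<omega> - ?J v \<omega>) \<partial>N)"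
  proof (rule integral_cong_AE)
    show "AE \<omega> in N. Z \<omega> * dpath h v t \<omega> = h * of_bool (x = v) * Z \<omega> + (\<Sum>u\<in>nbrs E v. ?J u \<omega> - ?J v \<omega>)"
      using difference_equation[OF tempered_start tempered_shifted[of h]] AE_space
    proof eventually_elim
      case (elim \<omega>)
      note eq = elim(1) and \<omega> = elim(2)
      have i: "set_integrable lborel {0..t} (\<lambda>r. dforce h u r \<omega>)" for u
        unfolding dforce_def
        using force_set_integrable[OF tempered_shifted \<omega>] force_set_integrable[OF tempered_start \<omega>] by (rule set_integral_diff)
      have "dpath h v t \<omega> = h * of_bool (x = v) + inflow (\<lambda>u r. dforce h u r \<omega>) v t"
        using eq[rule_format, OF t, of v] by (auto simp: dpath_def dforce_def)
      also have "inflow (\<lambda>u r. dforce h u r \<omega>) v t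
          = (\<Sum>u\<in>nbrs E v. (LBINT r:{0..t}. dforce h u r \<omega>) - (LBINT r:{0..t}. dforce h v r \<omega>))"
        using i by (intro sum.cong refl set_integral_diff)
      finally show "Z \<omega> * dpath h v t \<omega> = h * of_bool (x = v) * Z \<omega> + (\<Sum>u\<in>nbrs E v. ?J u \<omega> - ?J v \<omega>)"
        by (simp add: distrib_left sum_distrib_left right_diff_distrib)
    qed
    show "(\<lambda>\<omega>. Z \<omega> * dpath h v t \<omega>) \<in> borel_measurable N"
      by (rule borel_measurable_integrable[OF weighted_path_integrable(1)[OF Z t]])
    show "(\<lambda>\<omega>. h * of_bool (x = v) * Z \<omega> + (\<Sum>u\<in>nbrs E v. ?J u \<omega> - ?J v \<omega>)) \<in> borel_measurable N"
      using F(2) weighted_path_integrable(6)[OF Z t]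
      by (intro borel_measurable_integrable Bochner_Integration.integrable_add Bochner_Integration.integrable_sum
          Bochner_Integration.integrable_diff integrable_mult_right) auto
  qed
  also have "\<dots> = h * of_bool (x = v) * (\<integral>\<omega>. Z \<omega> \<partial>N) + (\<Sum>u\<in>nbrs E v. integral\<^sup>L N (?J u) - integral\<^sup>L N (?J v))"
    using F(2) weighted_path_integrable(6)[OF Z t]
    by (subst Bochner_Integration.integral_add) (auto simp: Bochner_Integration.integral_sum)
  finally show ?thesis unfolding F(3) by (simp add: mult_ac)
qed

lemma source_set_integrable:
  assumes Z: "weight c Z" and t: "0 \<le> t" and u: "w \<in> nbrs E u"
  shows "set_integrable lborel {0..t} (\<lambda>r. source h u r Z)"
proof -
  have "set_integrable lborel {0..t} (\<lambda>r. h * (\<integral>\<omega>. Z \<omega> * intensity u r \<omega> \<partial>N))"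
    using weighted_intensity_set_integrable[OF Z t u] by simp
  from set_integral_diff(1)[OF this dforce_fubini(1)[OF Z t, of h u]] show ?thesis
    by (simp add: source_def)
qed

lemma discrepancy_equation:
  assumes Z: "weight c Z" and t: "0 \<le> t"
  shows "discrepancy h v t Z = inflow (\<lambda>u r. source h u r Z) v t"
proof -
  have "discrepancy h v t Z = h * (\<integral>\<omega>. Z \<omega> * of_bool (Y t \<omega> = v) \<partial>N) - (\<integral>\<omega>. Z \<omega> * dpath h v t \<omega> \<partial>N)"
  proof -
    have "discrepancy h v t Z = (\<integral>\<omega>. h * (Z \<omega> * of_bool (Y t \<omega> = v)) - Z \<omega> * dpath h v t \<omega> \<partial>N)"
      unfolding discrepancy_def by (simp add: right_diff_distrib mult_ac)
    also have "\<dots> = h * (\<integral>\<omega>. Z \<omega> * of_bool (Y t \<omega> = v) \<partial>N) - (\<integral>\<omega>. Z \<omega> * dpath h v t \<omega> \<partial>N)"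
      using weighted_path_integrable(1,4)[OF Z t, where v = v] by simp
    finally show ?thesis .
  qed
  also have "h * (\<integral>\<omega>. Z \<omega> * of_bool (Y t \<omega> = v) \<partial>N) = h * (\<integral>\<omega>. Z \<omega> \<partial>N) * of_bool (x = v)
    + (\<Sum>u\<in>nbrs E v. h * (LBINT r:{0..t}. (\<integral>\<omega>. Z \<omega> * intensity u r \<omega> \<partial>N) - (\<integral>\<omega>. Z \<omega> * intensity v r \<omega> \<partial>N)))"
    unfolding weighted_forward_equation[OF Z t] by (simp add: distrib_left sum_distrib_left mult_ac)
  also have "\<dots> - (\<integral>\<omega>. Z \<omega> * dpath h v t \<omega> \<partial>N)
    = (\<Sum>u\<in>nbrs E v. h * (LBINT r:{0..t}. (\<integral>\<omega>. Z \<omega> * intensity u r \<omega> \<partial>N) - (\<integral>\<omega>. Z \<omega> * intensity v r \<omega> \<partial>N))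
      - ((LBINT r:{0..t}. \<integral>\<omega>. Z \<omega> * dforce h u r \<omega> \<partial>N) - (LBINT r:{0..t}. \<integral>\<omega>. Z \<omega> * dforce h v r \<omega> \<partial>N)))"
    unfolding weighted_flow_equation[OF Z t] sum_subtractf by simp
  also have "\<dots> = inflow (\<lambda>u r. source h u r Z) v t"
  proof (rule sum.cong[OF refl])
    fix u assume u: "u \<in> nbrs E v"
    then have v: "v \<in> nbrs E u" using nbrs_sym by blast
    note i = weighted_intensity_set_integrable[OF Z t v] weighted_intensity_set_integrable[OF Z t u]
    note f = dforce_fubini(1)[OF Z t, of h]
    let ?a = "\<lambda>u r. \<integral>\<omega>. Z \<omega> * intensity u r \<omega> \<partial>N" and ?b = "\<lambda>u r. \<integral>\<omega>. Z \<omega> * dforce h u r \<omega> \<partial>N"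
    have hi: "set_integrable lborel {0..t} (\<lambda>r. h * ?a u r)" "set_integrable lborel {0..t} (\<lambda>r. h * ?a v r)"
      using i by simp_all
    have "(LBINT r:{0..t}. source h u r Z - source h v r Z)
      = (LBINT r:{0..t}. source h u r Z) - (LBINT r:{0..t}. source h v r Z)"
      by (rule set_integral_diff(2)[OF source_set_integrable[OF Z t v] source_set_integrable[OF Z t u]])
    also have "(LBINT r:{0..t}. source h u r Z) = (LBINT r:{0..t}. h * ?a u r) - (LBINT r:{0..t}. ?b u r)"
      unfolding source_def by (rule set_integral_diff(2)[OF hi(1) f])
    also have "(LBINT r:{0..t}. source h v r Z) = (LBINT r:{0..t}. h * ?a v r) - (LBINT r:{0..t}. ?b v r)"
      unfolding source_def by (rule set_integral_diff(2)[OF hi(2) f])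
    finally show "h * (LBINT r:{0..t}. ?a u r - ?a v r) - ((LBINT r:{0..t}. ?b u r) - (LBINT r:{0..t}. ?b v r))
        = (LBINT r:{0..t}. source h u r Z - source h v r Z)"
      unfolding set_integral_diff(2)[OF i] by (simp add: right_diff_distrib)
  qed
  finally show ?thesis .
qed

text \<open>The step that closes the system: the source at \<open>u\<close> is the discrepancy at \<open>u\<close> itself for the weight
multiplied by the jump rate, up to the linearization error.\<close>

lemma source_le:
  assumes Z: "weight c Z" and r: "0 \<le> r"
  shows "\<bar>source h u r Z\<bar> \<le> \<bar>discrepancy h u r (\<lambda>\<omega>. Z \<omega> * stiffness u r \<omega>)\<bar> + c * mean_lin_error h u r"
proof -
  have Z': "weight (c * Cp) (\<lambda>\<omega>. Z \<omega> * stiffness u r \<omega>)" by (rule weight_stiffness[OF Z r])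
  have "discrepancy h u r (\<lambda>\<omega>. Z \<omega> * stiffness u r \<omega>) + (\<integral>\<omega>. Z \<omega> * lin_error h u r \<omega> \<partial>N)
    = (\<integral>\<omega>. (h * (Z \<omega> * intensity u r \<omega>) - Z \<omega> * stiffness u r \<omega> * dpath h u r \<omega>) + Z \<omega> * lin_error h u r \<omega> \<partial>N)"
  proof -
    have "discrepancy h u r (\<lambda>\<omega>. Z \<omega> * stiffness u r \<omega>)
        = (\<integral>\<omega>. h * (Z \<omega> * intensity u r \<omega>) - Z \<omega> * stiffness u r \<omega> * dpath h u r \<omega> \<partial>N)"
      unfolding discrepancy_def intensity_eq by (simp add: right_diff_distrib mult_ac)
    then show ?thesis
      using weighted_path_integrable(1)[OF Z' r, of h u] weighted_path_integrable(3,5)[OF Z r, where v = u] by simp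
  qed
  also have "\<dots> = (\<integral>\<omega>. h * (Z \<omega> * intensity u r \<omega>) - Z \<omega> * dforce h u r \<omega> \<partial>N)"
    by (simp add: lin_error_def algebra_simps)
  also have "\<dots> = source h u r Z"
    unfolding source_def using weighted_path_integrable(2,5)[OF Z r, where v = u] by simp
  finally have eq: "source h u r Z = discrepancy h u r (\<lambda>\<omega>. Z \<omega> * stiffness u r \<omega>) + (\<integral>\<omega>. Z \<omega> * lin_error h u r \<omega> \<partial>N)"
    by simp
  have "\<bar>\<integral>\<omega>. Z \<omega> * lin_error h u r \<omega> \<partial>N\<bar> \<le> (\<integral>\<omega>. \<bar>Z \<omega> * lin_error h u r \<omega>\<bar> \<partial>N)"
    by (rule integral_abs_bound)
  also have "\<dots> \<le> (\<integral>\<omega>. c * \<bar>lin_error h u r \<omega>\<bar> \<partial>N)"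
  proof (rule integral_mono)
    show "integrable N (\<lambda>\<omega>. \<bar>Z \<omega> * lin_error h u r \<omega>\<bar>)"
      by (intro integrable_abs weighted_path_integrable(3)[OF Z r])
    show "integrable N (\<lambda>\<omega>. c * \<bar>lin_error h u r \<omega>\<bar>)"
      by (intro integrable_mult_right integrable_abs lin_error_integrable[OF r])
    show "\<omega> \<in> space N \<Longrightarrow> \<bar>Z \<omega> * lin_error h u r \<omega>\<bar> \<le> c * \<bar>lin_error h u r \<omega>\<bar>" for \<omega>
      unfolding abs_mult using weight_D(5)[OF Z, of \<omega>] by (intro mult_right_mono) auto
  qed
  also have "\<dots> = c * mean_lin_error h u r"
    by (simp add: mean_lin_error_def)
  finally show ?thesis unfolding eq by linarith
qed

text \<open>The linearization errors collected in \<open>n\<close> iterations. They come from the finitely many sites within distance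
\<open>n\<close> of \<open>v\<close>, hence vanish as \<open>h\<close> tends to \<open>0\<close>; no uniformity over the graph is needed.\<close>

primrec remainder :: "real \<Rightarrow> real \<Rightarrow> nat \<Rightarrow> 'v \<Rightarrow> real" where
  "remainder T h 0 v = 0"
| "remainder T h (Suc n) v = (\<Sum>u\<in>nbrs E v. T * (Cp * (remainder T h n u + remainder T h n v))
      + (total_lin_error T h u + total_lin_error T h v))"

lemma total_lin_error_nonneg: "0 \<le> total_lin_error T h u"
  unfolding total_lin_error_def set_lebesgue_integral_def
  using mean_lin_error_nonneg by (intro Bochner_Integration.integral_nonneg) auto

lemma remainder_nonneg: "0 \<le> T \<Longrightarrow> 0 \<le> remainder T h n v"
  using Cp_pos total_lin_error_nonneg
  by (induction n arbitrary: v) (auto intro!: sum_nonneg add_nonneg_nonneg mult_nonneg_nonneg)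

lemma remainder_tendsto:
  assumes h: "\<And>k. h k \<noteq> 0" "h \<longlonglongrightarrow> 0" and T: "0 \<le> T"
  shows "(\<lambda>k. remainder T (h k) n v) \<longlonglongrightarrow> 0"
proof (induction n arbitrary: v)
  case (Suc n)
  have "(\<lambda>k. \<Sum>u\<in>nbrs E v. T * (Cp * (remainder T (h k) n u + remainder T (h k) n v))
      + (total_lin_error T (h k) u + total_lin_error T (h k) v))
    \<longlonglongrightarrow> (\<Sum>u\<in>nbrs E v. T * (Cp * (0 + 0)) + (0 + 0))"
    by (intro tendsto_intros Suc total_lin_error_tendsto h T)
  then show ?case by simp
qed simp

text \<open>Start from the crude bound of order \<open>\<bar>h\<bar>\<close> and insert it \<open>n\<close> times into \<open>discrepancy_equation\<close>; each
insertion integrates once in time.\<close>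

lemma discrepancy_bound:
  assumes h: "h \<noteq> 0" and T: "0 \<le> T"
  shows "0 \<le> t \<Longrightarrow> t \<le> T \<Longrightarrow> weight c Z \<Longrightarrow> \<bar>discrepancy h v t Z\<bar>
    \<le> \<bar>h\<bar> * (c * ((1 + flow_bound T) * ((2 * D * Cp * t) ^ n / fact n) + remainder T h n v))"
proof (induction n arbitrary: v t c Z)
  case 0
  note Z = \<open>weight c Z\<close>
  have "\<bar>discrepancy h v t Z\<bar> \<le> (\<integral>\<omega>. \<bar>Z \<omega> * (h * of_bool (Y t \<omega> = v) - dpath h v t \<omega>)\<bar> \<partial>N)"
    unfolding discrepancy_def by (rule integral_abs_bound)
  also have "\<dots> \<le> \<bar>h\<bar> * (c * (1 + flow_bound T))"
  proof (rule N.integral_le_const)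
    have "integrable N (\<lambda>\<omega>. h * (Z \<omega> * of_bool (Y t \<omega> = v)) - Z \<omega> * dpath h v t \<omega>)"
      using weighted_path_integrable(1,4)[OF Z 0(1), where v = v] by simp
    then show "integrable N (\<lambda>\<omega>. \<bar>Z \<omega> * (h * of_bool (Y t \<omega> = v) - dpath h v t \<omega>)\<bar>)"
      by (intro integrable_abs) (simp add: right_diff_distrib mult_ac)
    show "AE \<omega> in N. \<bar>Z \<omega> * (h * of_bool (Y t \<omega> = v) - dpath h v t \<omega>)\<bar> \<le> \<bar>h\<bar> * (c * (1 + flow_bound T))"
      using dpath_bound[OF T, of h] AE_space
    proof eventually_elim
      fix \<omega> assume d: "\<forall>r\<in>{0..T}. \<forall>u. \<bar>dpath h u r \<omega>\<bar> \<le> \<bar>h\<bar> * flow_bound T" and \<omega>: "\<omega> \<in> space N"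
      have "\<bar>h * of_bool (Y t \<omega> = v)\<bar> \<le> \<bar>h\<bar>" by simp
      moreover have "\<bar>dpath h v t \<omega>\<bar> \<le> \<bar>h\<bar> * flow_bound T" using d 0 by simp
      ultimately have "\<bar>h * of_bool (Y t \<omega> = v) - dpath h v t \<omega>\<bar> \<le> \<bar>h\<bar> * (1 + flow_bound T)"
        unfolding distrib_left by linarith
      then have "\<bar>Z \<omega>\<bar> * \<bar>h * of_bool (Y t \<omega> = v) - dpath h v t \<omega>\<bar> \<le> c * (\<bar>h\<bar> * (1 + flow_bound T))"
        using weight_D(5,6)[OF Z] \<omega> by (intro mult_mono) auto
      then show "\<bar>Z \<omega> * (h * of_bool (Y t \<omega> = v) - dpath h v t \<omega>)\<bar> \<le> \<bar>h\<bar> * (c * (1 + flow_bound T))"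
        by (simp add: abs_mult mult_ac)
    qed
  qed
  finally show ?case by simp
next
  case (Suc n)
  note Z = \<open>weight c Z\<close> and t = \<open>0 \<le> t\<close> \<open>t \<le> T\<close>
  define \<kappa> where "\<kappa> = 2 * D * Cp"
  define C where "C = 1 + flow_bound T"
  have c0: "0 \<le> c" by (rule weight_D(6)[OF Z])
  have C0: "0 \<le> C" using flow_bound_pos[of T] by (simp add: C_def)
  have \<kappa>0: "0 \<le> \<kappa>" using Cp_pos by (simp add: \<kappa>_def)
  have IH: "\<bar>discrepancy h v t Z\<bar> \<le> \<bar>h\<bar> * (c * (C * ((\<kappa> * t) ^ n / fact n) + remainder T h n v))"
    if "0 \<le> t" "t \<le> T" "weight c Z" for v t c Z
    using Suc.IH[OF that, of v] unfolding C_def \<kappa>_def .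
  let ?rem = "\<lambda>u. remainder T h n u"
  have src: "\<bar>source h u r Z\<bar> \<le> \<bar>h\<bar> * (c * (Cp * (C * ((\<kappa> * r) ^ n / fact n) + ?rem u) + mean_lin_error h u r / \<bar>h\<bar>))"
    if r: "r \<in> {0..t}" for u r
  proof -
    have "\<bar>source h u r Z\<bar> \<le> \<bar>discrepancy h u r (\<lambda>\<omega>. Z \<omega> * stiffness u r \<omega>)\<bar> + c * mean_lin_error h u r"
      using r by (intro source_le[OF Z]) auto
    also have "\<bar>discrepancy h u r (\<lambda>\<omega>. Z \<omega> * stiffness u r \<omega>)\<bar> \<le> \<bar>h\<bar> * (c * Cp * (C * ((\<kappa> * r) ^ n / fact n) + ?rem u))"
      using r t by (intro IH weight_stiffness[OF Z]) auto
    finally show ?thesis using h by (simp add: algebra_simps)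
  qed
  let ?b = "\<lambda>u r. \<bar>h\<bar> * (c * (2 * Cp * C * ((\<kappa> * r) ^ n / fact n) + (Cp * (?rem u + ?rem v)
      + (mean_lin_error h u r / \<bar>h\<bar> + mean_lin_error h v r / \<bar>h\<bar>))))"
  have edge: "\<bar>LBINT r:{0..t}. source h u r Z - source h v r Z\<bar>
      \<le> \<bar>h\<bar> * (c * (2 * Cp * C * (\<kappa> ^ n * t ^ Suc n / fact (Suc n)) + (T * (Cp * (?rem u + ?rem v))
      + (total_lin_error T h u + total_lin_error T h v))))" if u: "u \<in> nbrs E v" for u
  proof -
    have v: "v \<in> nbrs E u" using u nbrs_sym by blast
    have si: "set_integrable lborel {0..t} (\<lambda>r. source h u r Z - source h v r Z)"
      using source_set_integrable[OF Z t(1) v] source_set_integrable[OF Z t(1) u] by (rule set_integral_diff)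
    have e: "set_integrable lborel {0..t} (\<lambda>r. mean_lin_error h w r / \<bar>h\<bar>)" for w
      using mean_lin_error_set_integrable[OF t(1), of h w] by simp
    have p: "set_integrable lborel {0..t} (\<lambda>r. (\<kappa> * r) ^ n / fact n)" and k: "set_integrable lborel {0..t} (\<lambda>r. Cp * (?rem u + ?rem v))"
      by (auto intro!: borel_integrable_atLeastAtMost' continuous_intros)
    have "\<bar>LBINT r:{0..t}. source h u r Z - source h v r Z\<bar> \<le> (LBINT r:{0..t}. \<bar>source h u r Z - source h v r Z\<bar>)"
      using set_integral_norm_bound[OF si] by simp
    also have "\<dots> \<le> (LBINT r:{0..t}. ?b u r)"
    proof (rule set_integral_mono)
      show "set_integrable lborel {0..t} (\<lambda>r. \<bar>source h u r Z - source h v r Z\<bar>)"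
        using set_integrable_norm[OF si] by simp
      show "set_integrable lborel {0..t} (\<lambda>r. ?b u r)"
        by (rule set_integrable_mult_right, rule set_integrable_mult_right, rule set_integral_add(1),
            rule set_integrable_mult_right, rule p, rule set_integral_add(1), rule k,
            rule set_integral_add(1), rule e, rule e)
      fix r assume r: "r \<in> {0..t}"
      have "\<bar>source h u r Z - source h v r Z\<bar> \<le> \<bar>source h u r Z\<bar> + \<bar>source h v r Z\<bar>"
        by simp
      also have "\<dots> \<le> ?b u r"
        using add_mono[OF src[OF r, of u] src[OF r, of v]]
        by (rule order_trans) (simp only: distrib_left, simp add: mult_ac)
      finally show "\<bar>source h u r Z - source h v r Z\<bar> \<le> ?b u r" .
    qed
    also have "\<dots> = \<bar>h\<bar> * (c * (2 * Cp * C * (LBINT r:{0..t}. (\<kappa> * r) ^ n / fact n) + ((LBINT r:{0..t}. Cp * (?rem u + ?rem v))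
      + ((LBINT r:{0..t}. mean_lin_error h u r / \<bar>h\<bar>) + (LBINT r:{0..t}. mean_lin_error h v r / \<bar>h\<bar>)))))"
      using e p k
      by (simp only: set_integral_mult_right set_integral_add set_integrable_mult_right)
    also have "\<dots> \<le> \<bar>h\<bar> * (c * (2 * Cp * C * (\<kappa> ^ n * t ^ Suc n / fact (Suc n)) + (T * (Cp * (?rem u + ?rem v))
      + (total_lin_error T h u + total_lin_error T h v))))"
    proof (intro mult_left_mono[OF mult_left_mono[OF add_mono[OF _ add_mono[OF _ add_mono]]]])
      have "(LBINT r:{0..t}. (\<kappa> * r) ^ n / fact n) = \<kappa> ^ n * t ^ Suc n / fact (Suc n)"
      proof -
        have "(\<integral>r. r ^ n * indicator {0..t} r \<partial>lborel) = (t ^ Suc n - 0 ^ Suc n) / Suc n"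
          by (rule integral_power[OF t(1)])
        then show ?thesis
          by (simp add: set_lebesgue_integral_def power_mult_distrib mult_ac fact_Suc del: of_nat_Suc)
      qed
      then show "2 * Cp * C * (LBINT r:{0..t}. (\<kappa> * r) ^ n / fact n) \<le> 2 * Cp * C * (\<kappa> ^ n * t ^ Suc n / fact (Suc n))"
        by simp
      have "(LBINT r:{0..t}. Cp * (?rem u + ?rem v)) = t * (Cp * (?rem u + ?rem v))"
        using t by (simp add: set_lebesgue_integral_def)
      also have "\<dots> \<le> T * (Cp * (?rem u + ?rem v))"
        using t Cp_pos remainder_nonneg[OF T] by (intro mult_right_mono mult_nonneg_nonneg add_nonneg_nonneg) auto
      finally show "(LBINT r:{0..t}. Cp * (?rem u + ?rem v)) \<le> T * (Cp * (?rem u + ?rem v))" .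
      have "(LBINT r:{0..t}. mean_lin_error h w r / \<bar>h\<bar>) \<le> total_lin_error T h w" for w
        unfolding total_lin_error_def set_lebesgue_integral_def
      proof (rule integral_mono)
        show "integrable lborel (\<lambda>r. indicat_real {0..t} r *\<^sub>R (mean_lin_error h w r / \<bar>h\<bar>))"
          using e[of w] by (simp add: set_integrable_def)
        show "integrable lborel (\<lambda>r. indicat_real {0..T} r *\<^sub>R (mean_lin_error h w r / \<bar>h\<bar>))"
          using mean_lin_error_set_integrable[OF T, of h w] by (simp add: set_integrable_def)
        show "indicat_real {0..t} r *\<^sub>R (mean_lin_error h w r / \<bar>h\<bar>) \<le> indicat_real {0..T} r *\<^sub>R (mean_lin_error h w r / \<bar>h\<bar>)" for r
          using t mean_lin_error_nonneg[of h w r] by (auto split: split_indicator)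
      qed
      then show "(LBINT r:{0..t}. mean_lin_error h u r / \<bar>h\<bar>) \<le> total_lin_error T h u"
        "(LBINT r:{0..t}. mean_lin_error h v r / \<bar>h\<bar>) \<le> total_lin_error T h v" by blast+
    qed (use c0 in auto)
    finally show ?thesis .
  qed
  have "\<bar>discrepancy h v t Z\<bar> \<le> (\<Sum>u\<in>nbrs E v. \<bar>LBINT r:{0..t}. source h u r Z - source h v r Z\<bar>)"
    unfolding discrepancy_equation[OF Z t(1)] by (rule sum_abs)
  also have "\<dots> \<le> (\<Sum>u\<in>nbrs E v. \<bar>h\<bar> * (c * (2 * Cp * C * (\<kappa> ^ n * t ^ Suc n / fact (Suc n)) + (T * (Cp * (?rem u + ?rem v))
      + (total_lin_error T h u + total_lin_error T h v)))))"
    using edge by (rule sum_mono)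
  also have "\<dots> = \<bar>h\<bar> * (c * (card (nbrs E v) * (2 * Cp * C * (\<kappa> ^ n * t ^ Suc n / fact (Suc n))) + remainder T h (Suc n) v))"
    by (simp add: sum.distrib flip: sum_distrib_left)
  also have "\<dots> \<le> \<bar>h\<bar> * (c * (D * (2 * Cp * C * (\<kappa> ^ n * t ^ Suc n / fact (Suc n))) + remainder T h (Suc n) v))"
    using degree(2)[of v] c0 Cp_pos C0 \<kappa>0 t
    by (intro mult_left_mono add_right_mono mult_right_mono) auto
  also have "D * (2 * Cp * C * (\<kappa> ^ n * t ^ Suc n / fact (Suc n))) = C * ((\<kappa> * t) ^ Suc n / fact (Suc n))"
    by (simp add: \<kappa>_def power_mult_distrib mult_ac)
  finally show ?case unfolding C_def \<kappa>_def .
qed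

text \<open>In \<open>discrepancy_bound\<close> with \<open>Z = 1\<close>, first choose \<open>n\<close> so that the factorial term is small, then \<open>h\<close> so that the
remainder is small.\<close>

lemma mean_flow_derivative:
  assumes t: "0 \<le> t"
  shows "((\<lambda>s. mean_flow t y (\<sigma>(x := s))) has_real_derivative N.prob {\<omega> \<in> space N. Y t \<omega> = y}) (at (\<sigma> x))"
proof -
  let ?p = "N.prob {\<omega> \<in> space N. Y t \<omega> = y}"
  have disc: "discrepancy h y t (\<lambda>_. 1) = h * ?p - (mean_flow t y (shifted h) - mean_flow t y \<sigma>)" for h
  proof -
    have "weight 1 (\<lambda>_. 1)" by (simp add: weight_def)
    note i = weighted_path_integrable(4)[OF this t, of y]
    have "{\<omega> \<in> space N. Y t \<omega> = y} = Y t -` {y} \<inter> space N" by auto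
    then have "{\<omega> \<in> space N. Y t \<omega> = y} \<in> sets N"
      using measurable_sets[OF walk_measurable[OF t], of "{y}"] by simp
    then have "?p = (\<integral>\<omega>. indicator {\<omega> \<in> space N. Y t \<omega> = y} \<omega> \<partial>N)" by simp
    also have "\<dots> = (\<integral>\<omega>. of_bool (Y t \<omega> = y) \<partial>N)"
      by (intro Bochner_Integration.integral_cong) (auto simp: indicator_def)
    finally have p: "(\<integral>\<omega>. of_bool (Y t \<omega> = y) \<partial>N) = ?p" by simp
    have "discrepancy h y t (\<lambda>_. 1) = h * ?p - (\<integral>\<omega>. dpath h y t \<omega> \<partial>N)"
      unfolding discrepancy_def dpath_def p[symmetric]
      using i path_integrable[OF tempered_shifted t, of h y] path_integrable[OF tempered_start t, of y] by simp
    also have "(\<integral>\<omega>. dpath h y t \<omega> \<partial>N) = mean_flow t y (shifted h) - mean_flow t y \<sigma>"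
      unfolding dpath_def mean_flow_def
      using path_integrable[OF tempered_shifted t, of h y] path_integrable[OF tempered_start t, of y] by simp
    finally show ?thesis .
  qed
  show ?thesis
    unfolding DERIV_def LIMSEQ_SEQ_conv[symmetric]
  proof (intro allI impI)
    fix h :: "nat \<Rightarrow> real" assume "(\<forall>k. h k \<noteq> 0) \<and> h \<longlonglongrightarrow> 0"
    then have h: "\<And>k. h k \<noteq> 0" "h \<longlonglongrightarrow> 0" by auto
    show "(\<lambda>k. (mean_flow t y (\<sigma>(x := \<sigma> x + h k)) - mean_flow t y (\<sigma>(x := \<sigma> x))) / h k) \<longlonglongrightarrow> ?p"
    proof (rule LIMSEQ_I)
      fix e :: real assume e: "0 < e"
      let ?q = "\<lambda>n. (1 + flow_bound t) * ((2 * D * Cp * t) ^ n / fact n)"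
      have "?q \<longlonglongrightarrow> (1 + flow_bound t) * 0"
        using summable_LIMSEQ_zero[OF summable_exp[of "2 * D * Cp * t"]]
        by (intro tendsto_intros) (simp add: field_simps)
      then have "\<forall>\<^sub>F n in sequentially. ?q n < e / 2"
        using e by (intro order_tendstoD) auto
      then obtain n where n: "?q n < e / 2" by (auto simp: eventually_sequentially)
      have "\<forall>\<^sub>F k in sequentially. remainder t (h k) n y < e / 2"
        using e remainder_tendsto[OF h t, of n y] by (intro order_tendstoD) auto
      then obtain K where K: "\<And>k. K \<le> k \<Longrightarrow> remainder t (h k) n y < e / 2"
        by (auto simp: eventually_sequentially)
      have "norm ((mean_flow t y (shifted (h k)) - mean_flow t y (\<sigma>(x := \<sigma> x))) / h k - ?p) < e" if "K \<le> k" for k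
      proof -
        have "\<bar>discrepancy (h k) y t (\<lambda>_. 1)\<bar> \<le> \<bar>h k\<bar> * (1 * (?q n + remainder t (h k) n y))"
          by (rule discrepancy_bound[OF h(1) t t order_refl]) (simp add: weight_def)
        also have "\<dots> < \<bar>h k\<bar> * e"
        proof (rule mult_strict_left_mono)
          show "1 * (?q n + remainder t (h k) n y) < e" using add_strict_mono[OF n K[OF that]]
            unfolding mult_1_left field_sum_of_halves .
        qed (use h(1)[of k] in simp)
        finally have "\<bar>discrepancy (h k) y t (\<lambda>_. 1)\<bar> / \<bar>h k\<bar> < e"
          using h(1)[of k] by (simp add: pos_divide_less_eq mult.commute)
        also have "\<bar>discrepancy (h k) y t (\<lambda>_. 1)\<bar> / \<bar>h k\<bar>
          = \<bar>(mean_flow t y (shifted (h k)) - mean_flow t y (\<sigma>(x := \<sigma> x))) / h k - ?p\<bar>"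
        proof -
          have "(mean_flow t y (shifted (h k)) - mean_flow t y (\<sigma>(x := \<sigma> x))) / h k - ?p = - (discrepancy (h k) y t (\<lambda>_. 1) / h k)"
            unfolding disc using h(1)[of k] by (simp add: field_simps)
          then show ?thesis by (simp add: abs_divide)
        qed
        finally show ?thesis by simp
      qed
      then show "\<exists>K. \<forall>k\<ge>K. norm ((mean_flow t y (shifted (h k)) - mean_flow t y (\<sigma>(x := \<sigma> x))) / h k - ?p) < e"
        by blast
    qed
  qed
qed

end

section \<open>The Gibbs measure\<close>

context gl_walk
begin

abbreviation \<mu> :: "('v \<Rightarrow> real) measure" where "\<mu> \<equiv> gibbs U"

lemma gibbs_eq: "\<mu> = (\<Pi>\<^sub>M z\<in>UNIV. pot.\<nu> z)"
  by (simp add: gibbs_def)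

lemma space_gibbs [simp]: "space \<mu> = UNIV"
  by (simp add: gibbs_def space_PiM)

lemma prob_space_gibbs: "prob_space \<mu>"
  unfolding gibbs_eq by (intro prob_space_PiM pot.prob_space_\<nu>)

sublocale \<mu>: prob_space \<mu> by (rule prob_space_gibbs)

lemma coordinate_measurable [measurable]: "(\<lambda>\<sigma>. \<sigma> z) \<in> borel_measurable \<mu>"
proof -
  have "(\<lambda>\<sigma>. \<sigma> z) \<in> \<mu> \<rightarrow>\<^sub>M pot.\<nu> z"
    unfolding gibbs_eq by (rule measurable_component_singleton) simp
  then show ?thesis by (simp cong: measurable_cong_sets)
qed

lemma measurable_into_gibbs:
  assumes "\<And>z. (\<lambda>\<omega>. f \<omega> z) \<in> borel_measurable L"
  shows "f \<in> L \<rightarrow>\<^sub>M \<mu>"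
proof -
  have "(\<lambda>\<omega> z. f \<omega> z) \<in> L \<rightarrow>\<^sub>M (\<Pi>\<^sub>M z\<in>UNIV. pot.\<nu> z)"
    by (rule measurable_PiM_single') (use assms in \<open>auto cong: measurable_cong_sets\<close>)
  then show ?thesis by (simp add: gibbs_eq)
qed

lemma coordinate_nn_integral:
  assumes "f \<in> borel_measurable borel"
  shows "(\<integral>\<^sup>+\<sigma>. f (\<sigma> z) \<partial>\<mu>) = (\<integral>\<^sup>+s. f s \<partial>pot.\<nu> z)"
proof -
  have "distr \<mu> (pot.\<nu> z) (\<lambda>\<sigma>. \<sigma> z) = pot.\<nu> z"
    unfolding gibbs_eq by (rule distr_PiM_component) (auto intro: pot.prob_space_\<nu>)
  then have "(\<integral>\<^sup>+s. f s \<partial>pot.\<nu> z) = (\<integral>\<^sup>+s. f s \<partial>distr \<mu> (pot.\<nu> z) (\<lambda>\<sigma>. \<sigma> z))" by simp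
  also have "\<dots> = (\<integral>\<^sup>+\<sigma>. f (\<sigma> z) \<partial>\<mu>)"
    using assms by (intro nn_integral_distr) (auto cong: measurable_cong_sets)
  finally show ?thesis by simp
qed

definition moment_bound :: real where
  "moment_bound = 1 / Cm + M\<^sup>2"

lemma moment_bound_nonneg: "0 \<le> moment_bound"
  using Cp_pos by (simp add: moment_bound_def)

lemma coordinate_second_moment: "(\<integral>\<^sup>+\<sigma>. ennreal ((\<sigma> z)\<^sup>2) \<partial>\<mu>) \<le> ennreal moment_bound"
proof -
  have "(\<integral>\<^sup>+\<sigma>. ennreal ((\<sigma> z)\<^sup>2) \<partial>\<mu>) = (\<integral>\<^sup>+s. ennreal (s\<^sup>2) \<partial>pot.\<nu> z)"
    by (rule coordinate_nn_integral) simp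
  also have "\<dots> = ennreal (\<integral>s. s\<^sup>2 \<partial>pot.\<nu> z)"
    by (rule nn_integral_eq_integral[OF pot.integrable_square]) simp
  finally show ?thesis
    using pot.second_moment_le[of z] by (simp add: moment_bound_def ennreal_leI)
qed

lemma coordinate_integrable: "integrable \<mu> (\<lambda>\<sigma>. \<sigma> z)"
  and coordinate_mean: "(\<integral>\<sigma>. \<sigma> z \<partial>\<mu>) = M"
proof -
  have d: "distr \<mu> (pot.\<nu> z) (\<lambda>\<sigma>. \<sigma> z) = pot.\<nu> z"
    unfolding gibbs_eq by (rule distr_PiM_component) (auto intro: pot.prob_space_\<nu>)
  have m: "(\<lambda>\<sigma>. \<sigma> z) \<in> \<mu> \<rightarrow>\<^sub>M pot.\<nu> z"
    using coordinate_measurable[of z] by (simp cong: measurable_cong_sets)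
  have "integrable (distr \<mu> (pot.\<nu> z) (\<lambda>\<sigma>. \<sigma> z)) (\<lambda>s. s)"
    unfolding d by (rule pot.integrable_id)
  then show "integrable \<mu> (\<lambda>\<sigma>. \<sigma> z)"
    by (subst (asm) integrable_distr_eq[OF m]) auto
  have "(\<integral>\<sigma>. \<sigma> z \<partial>\<mu>) = (\<integral>s. s \<partial>distr \<mu> (pot.\<nu> z) (\<lambda>\<sigma>. \<sigma> z))"
    by (subst integral_distr[OF m]) auto
  then show "(\<integral>\<sigma>. \<sigma> z \<partial>\<mu>) = M"
    unfolding d by (simp add: pot.integral_id)
qed

lemma tempered_sets: "{\<sigma> \<in> space \<mu>. tempered E \<sigma>} \<in> sets \<mu>"
proof -
  have "{\<sigma> \<in> space \<mu>. tempered E \<sigma>} = {\<sigma> \<in> space \<mu>. \<exists>n::nat. \<forall>z\<in>UNIV. \<bar>\<sigma> z\<bar> \<le> real n * growth (real n) undefined z}"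
    using tempered_based[of _ undefined] by auto
  also have "\<dots> \<in> sets \<mu>"
  proof (rule sets.sets_Collect_countable_Ex, rule sets.sets_Collect_countable_All'[OF _ countable_vertices])
    fix n :: nat and z
    show "{\<sigma> \<in> space \<mu>. \<bar>\<sigma> z\<bar> \<le> real n * growth (real n) undefined z} \<in> sets \<mu>"
      by measurable
  qed
  finally show ?thesis .
qed

text \<open>A weighted \<open>l\<^sup>1\<close>-norm that is almost surely finite under the Gibbs measure. It dominates the weighted sup-norm
of \<open>mean_flow_lipschitz\<close> and, unlike that norm, has moments that are easily computed.\<close>

definition weighted_size :: "'v \<Rightarrow> ('v \<Rightarrow> real) \<Rightarrow> ennreal" where
  "weighted_size p \<sigma> = (\<integral>\<^sup>+z. ennreal (growth (- decay) p z * \<bar>\<sigma> z\<bar>) \<partial>count_space UNIV)"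

lemma weighted_size_measurable [measurable]: "weighted_size p \<in> borel_measurable \<mu>"
proof -
  interpret count: sigma_finite_measure "count_space (UNIV :: 'v set)"
    by (rule sigma_finite_measure_count_space_countable[OF countable_vertices])
  have "(\<lambda>(z, \<sigma>). ennreal (growth (- decay) p z * \<bar>\<sigma> z\<bar>)) \<in> borel_measurable (count_space UNIV \<Otimes>\<^sub>M \<mu>)"
    by (rule measurable_pair_measure_countable1[OF countable_vertices]) simp
  from measurable_pair_swap[OF this]
  have "(\<lambda>(\<sigma>, z). ennreal (growth (- decay) p z * \<bar>\<sigma> z\<bar>)) \<in> borel_measurable (\<mu> \<Otimes>\<^sub>M count_space UNIV)"
    by simp
  then show ?thesis
    unfolding weighted_size_def by (rule count.borel_measurable_nn_integral)
qed

lemma weighted_size_moment: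
  "(\<integral>\<^sup>+\<sigma>. ennreal \<bar>\<sigma> q\<bar> * weighted_size p \<sigma> \<partial>\<mu>) < top"
proof -
  let ?w = "\<lambda>z. growth (- decay) p z"
  have "(\<integral>\<^sup>+\<sigma>. ennreal \<bar>\<sigma> q\<bar> * weighted_size p \<sigma> \<partial>\<mu>)
      = (\<integral>\<^sup>+\<sigma>. \<integral>\<^sup>+z. ennreal \<bar>\<sigma> q\<bar> * ennreal (?w z * \<bar>\<sigma> z\<bar>) \<partial>count_space UNIV \<partial>\<mu>)"
    unfolding weighted_size_def by (simp add: nn_integral_cmult)
  also have "\<dots> = (\<integral>\<^sup>+z. \<integral>\<^sup>+\<sigma>. ennreal \<bar>\<sigma> q\<bar> * ennreal (?w z * \<bar>\<sigma> z\<bar>) \<partial>\<mu> \<partial>count_space UNIV)"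
    by (rule nn_integral_count_space_nn_integral[OF countable_vertices]) measurable
  also have "\<dots> \<le> (\<integral>\<^sup>+z. ennreal (?w z) * ennreal (2 * moment_bound) \<partial>count_space UNIV)"
  proof (rule nn_integral_mono)
    fix z
    have "(\<integral>\<^sup>+\<sigma>. ennreal \<bar>\<sigma> q\<bar> * ennreal (?w z * \<bar>\<sigma> z\<bar>) \<partial>\<mu>)
        \<le> (\<integral>\<^sup>+\<sigma>. ennreal (?w z) * (ennreal ((\<sigma> q)\<^sup>2) + ennreal ((\<sigma> z)\<^sup>2)) \<partial>\<mu>)"
    proof (rule nn_integral_mono)
      fix \<sigma> :: "'v \<Rightarrow> real"
      have "\<bar>\<sigma> q\<bar> * \<bar>\<sigma> z\<bar> \<le> (\<sigma> q)\<^sup>2 + (\<sigma> z)\<^sup>2"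
      proof -
        have "2 * (\<bar>\<sigma> q\<bar> * \<bar>\<sigma> z\<bar>) \<le> (\<sigma> q)\<^sup>2 + (\<sigma> z)\<^sup>2"
          using zero_le_power2[of "\<bar>\<sigma> q\<bar> - \<bar>\<sigma> z\<bar>"] by (simp add: power2_diff)
        moreover have "0 \<le> \<bar>\<sigma> q\<bar> * \<bar>\<sigma> z\<bar>" by simp
        ultimately show ?thesis by linarith
      qed
      then have "?w z * (\<bar>\<sigma> q\<bar> * \<bar>\<sigma> z\<bar>) \<le> ?w z * ((\<sigma> q)\<^sup>2 + (\<sigma> z)\<^sup>2)"
        by (intro mult_left_mono) auto
      then have "ennreal (\<bar>\<sigma> q\<bar> * (?w z * \<bar>\<sigma> z\<bar>)) \<le> ennreal (?w z * ((\<sigma> q)\<^sup>2 + (\<sigma> z)\<^sup>2))"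
        by (intro ennreal_leI) (simp add: mult_ac)
      then show "ennreal \<bar>\<sigma> q\<bar> * ennreal (?w z * \<bar>\<sigma> z\<bar>) \<le> ennreal (?w z) * (ennreal ((\<sigma> q)\<^sup>2) + ennreal ((\<sigma> z)\<^sup>2))"
        by (simp flip: ennreal_mult ennreal_plus)
    qed
    also have "\<dots> = ennreal (?w z) * ((\<integral>\<^sup>+\<sigma>. ennreal ((\<sigma> q)\<^sup>2) \<partial>\<mu>) + (\<integral>\<^sup>+\<sigma>. ennreal ((\<sigma> z)\<^sup>2) \<partial>\<mu>))"
      by (subst nn_integral_cmult, measurable) (subst nn_integral_add, measurable)
    also have "\<dots> \<le> ennreal (?w z) * (ennreal moment_bound + ennreal moment_bound)"
      by (intro mult_left_mono add_mono coordinate_second_moment) simp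
    also have "\<dots> = ennreal (?w z) * ennreal (2 * moment_bound)"
      using moment_bound_nonneg by (simp flip: ennreal_plus)
    finally show "(\<integral>\<^sup>+\<sigma>. ennreal \<bar>\<sigma> q\<bar> * ennreal (?w z * \<bar>\<sigma> z\<bar>) \<partial>\<mu>) \<le> ennreal (?w z) * ennreal (2 * moment_bound)" .
  qed
  also have "\<dots> = (\<integral>\<^sup>+z. ennreal (?w z) \<partial>count_space UNIV) * ennreal (2 * moment_bound)"
    by (rule nn_integral_multc) simp
  also have "\<dots> \<le> 2 * ennreal (2 * moment_bound)"
    by (rule mult_right_mono[OF decaying_weights_summable]) simp
  also have "\<dots> < top"
    by (simp add: ennreal_mult_less_top)
  finally show ?thesis .
qed

lemma weighted_size_integrable: "(\<integral>\<^sup>+\<sigma>. weighted_size p \<sigma> \<partial>\<mu>) < top"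
proof -
  let ?w = "\<lambda>z. growth (- decay) p z"
  have "(\<integral>\<^sup>+\<sigma>. weighted_size p \<sigma> \<partial>\<mu>) = (\<integral>\<^sup>+z. \<integral>\<^sup>+\<sigma>. ennreal (?w z * \<bar>\<sigma> z\<bar>) \<partial>\<mu> \<partial>count_space UNIV)"
    unfolding weighted_size_def
    by (rule nn_integral_count_space_nn_integral[OF countable_vertices]) measurable
  also have "\<dots> \<le> (\<integral>\<^sup>+z. ennreal (?w z) * ennreal (1 + moment_bound) \<partial>count_space UNIV)"
  proof (rule nn_integral_mono)
    fix z
    have "(\<integral>\<^sup>+\<sigma>. ennreal (?w z * \<bar>\<sigma> z\<bar>) \<partial>\<mu>) \<le> (\<integral>\<^sup>+\<sigma>. ennreal (?w z) * (1 + ennreal ((\<sigma> z)\<^sup>2)) \<partial>\<mu>)"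
    proof (rule nn_integral_mono)
      fix \<sigma> :: "'v \<Rightarrow> real"
      have "\<bar>\<sigma> z\<bar> \<le> 1 + (\<sigma> z)\<^sup>2" using pot.abs_le_quadratic[of 1 "\<sigma> z"] by simp
      then have "ennreal (?w z * \<bar>\<sigma> z\<bar>) \<le> ennreal (?w z * (1 + (\<sigma> z)\<^sup>2))"
        by (intro ennreal_leI mult_left_mono) auto
      then show "ennreal (?w z * \<bar>\<sigma> z\<bar>) \<le> ennreal (?w z) * (1 + ennreal ((\<sigma> z)\<^sup>2))"
        by (simp add: ennreal_mult flip: ennreal_plus ennreal_1)
    qed
    also have "\<dots> = ennreal (?w z) * (1 + (\<integral>\<^sup>+\<sigma>. ennreal ((\<sigma> z)\<^sup>2) \<partial>\<mu>))"
      by (subst nn_integral_cmult, measurable) (subst nn_integral_add, simp_all add: \<mu>.emeasure_space_1[simplified])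
    also have "\<dots> \<le> ennreal (?w z) * (1 + ennreal moment_bound)"
      by (intro mult_left_mono add_left_mono coordinate_second_moment) simp
    also have "\<dots> = ennreal (?w z) * ennreal (1 + moment_bound)"
      using moment_bound_nonneg by (simp add: ennreal_plus)
    finally show "(\<integral>\<^sup>+\<sigma>. ennreal (?w z * \<bar>\<sigma> z\<bar>) \<partial>\<mu>) \<le> ennreal (?w z) * ennreal (1 + moment_bound)" .
  qed
  also have "\<dots> = (\<integral>\<^sup>+z. ennreal (?w z) \<partial>count_space UNIV) * ennreal (1 + moment_bound)"
    by (rule nn_integral_multc) simp
  also have "\<dots> \<le> 2 * ennreal (1 + moment_bound)"
    by (rule mult_right_mono[OF decaying_weights_summable]) simp
  also have "\<dots> < top"
    by (simp add: ennreal_mult_less_top)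
  finally show ?thesis .
qed

lemma growth_of_weighted_size:
  assumes "weighted_size p \<sigma> < top"
  shows "\<bar>\<sigma> z\<bar> \<le> enn2real (weighted_size p \<sigma>) * growth decay p z"
proof -
  let ?f = "\<lambda>z. ennreal (growth (- decay) p z * \<bar>\<sigma> z\<bar>)"
  have "?f z \<le> weighted_size p \<sigma>"
  proof -
    have "?f z = (\<integral>\<^sup>+v. ?f v * indicator {z} v \<partial>count_space UNIV)"
      by (subst nn_integral_count_space'[of "{z}"]) auto
    also have "\<dots> \<le> weighted_size p \<sigma>"
      unfolding weighted_size_def by (intro nn_integral_mono) (auto split: split_indicator)
    finally show ?thesis .
  qed
  from enn2real_mono[OF this assms]
  have "growth (- decay) p z * \<bar>\<sigma> z\<bar> \<le> enn2real (weighted_size p \<sigma>)" by simp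
  from mult_right_mono[OF this, of "growth decay p z"] show ?thesis
    by (simp add: mult_ac flip: exp_add)
qed

lemma AE_weighted_size: "AE \<sigma> in \<mu>. weighted_size p \<sigma> < top"
  using nn_integral_PInf_AE[OF weighted_size_measurable[of p]] weighted_size_integrable[of p]
  by (auto simp: less_top)

lemma AE_tempered: "AE \<sigma> in \<mu>. tempered E \<sigma>"
  using AE_weighted_size[of undefined]
proof eventually_elim
  fix \<sigma> assume "weighted_size undefined \<sigma> < top"
  then show "tempered E \<sigma>"
    unfolding tempered_def using growth_of_weighted_size by blast
qed

lemma tempered_zero: "tempered E (\<lambda>_. 0)"
  unfolding tempered_def by (intro exI[of _ undefined] exI[of _ 0]) simp

definition semigroup_coord :: "real \<Rightarrow> 'v \<Rightarrow> ('v \<Rightarrow> real) \<Rightarrow> real" where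
  "semigroup_coord t y = gl_semigroup E N \<eta> t (\<lambda>\<sigma>. \<sigma> y)"

lemma semigroup_coord_tempered: "tempered E \<sigma> \<Longrightarrow> semigroup_coord t y \<sigma> = mean_flow t y \<sigma>"
  by (simp add: semigroup_coord_def gl_semigroup_def mean_flow_def)

lemma semigroup_coord_growth:
  assumes t: "0 \<le> t" and s: "weighted_size y \<sigma> < top"
  shows "\<bar>semigroup_coord t y \<sigma>\<bar> \<le> \<bar>mean_flow t y (\<lambda>_. 0)\<bar> + exp (growth_rate decay * t) * enn2real (weighted_size y \<sigma>)"
proof -
  note g = growth_of_weighted_size[OF s]
  have \<sigma>: "tempered E \<sigma>" unfolding tempered_def using g by blast
  have "\<bar>mean_flow t y \<sigma> - mean_flow t y (\<lambda>_. 0)\<bar> \<le> enn2real (weighted_size y \<sigma>) * exp (growth_rate decay * t)"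
    using g by (intro mean_flow_lipschitz tempered_zero \<sigma> t decay_nonneg) auto
  then show ?thesis
    by (simp add: semigroup_coord_tempered[OF \<sigma>] mult.commute)
qed

section \<open>Measurability in the initial configuration\<close>

text \<open>Truncation to a finite ball and rounding to a grid. The range is countable, so an arbitrary function of the
discretized configuration is measurable.\<close>

definition discretize :: "'v \<Rightarrow> nat \<Rightarrow> ('v \<Rightarrow> real) \<Rightarrow> 'v \<Rightarrow> real" where
  "discretize p n \<sigma> z = (if gdist E p z \<le> n then of_int \<lfloor>(real n + 1) * \<sigma> z\<rfloor> / (real n + 1) else 0)"

lemma countable_range_discretize: "countable (range (discretize p n))"
proof -
  let ?B = "{z. gdist E p z \<le> n}" and ?Q = "range (\<lambda>k. of_int k / (real n + 1) :: real)"
  let ?ext = "\<lambda>g z. if gdist E p z \<le> n then g z else (0::real)"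
  have "range (discretize p n) \<subseteq> ?ext ` (\<Pi>\<^sub>E z\<in>?B. ?Q)"
  proof
    fix a assume "a \<in> range (discretize p n)"
    then obtain \<sigma> where a: "a = discretize p n \<sigma>" by blast
    show "a \<in> ?ext ` (\<Pi>\<^sub>E z\<in>?B. ?Q)"
    proof (rule image_eqI)
      show "a = ?ext (restrict a ?B)" by (auto simp: a discretize_def fun_eq_iff)
      show "restrict a ?B \<in> (\<Pi>\<^sub>E z\<in>?B. ?Q)" by (auto simp: a discretize_def)
    qed
  qed
  moreover have "countable (\<Pi>\<^sub>E z\<in>?B. ?Q)"
    by (intro countable_PiE finite_ball) simp
  ultimately show ?thesis by (meson countable_image countable_subset)
qed

lemma discretize_measurable:
  "(\<lambda>\<sigma>. f (discretize p n \<sigma>) :: real) \<in> borel_measurable \<mu>"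
proof -
  have c [measurable]: "(\<lambda>\<sigma>. discretize p n \<sigma> z) \<in> borel_measurable \<mu>" for z
    unfolding discretize_def by measurable
  have "discretize p n \<in> \<mu> \<rightarrow>\<^sub>M count_space (range (discretize p n))"
    unfolding measurable_count_space_eq_countable[OF countable_range_discretize]
  proof (intro conjI ballI)
    fix a
    have "discretize p n -` {a} \<inter> space \<mu> = {\<sigma> \<in> space \<mu>. \<forall>z\<in>UNIV. discretize p n \<sigma> z = a z}"
      by (auto simp: fun_eq_iff)
    also have "\<dots> \<in> sets \<mu>"
    proof (rule sets.sets_Collect_countable_All'[OF _ countable_vertices])
      fix z show "{\<sigma> \<in> space \<mu>. discretize p n \<sigma> z = a z} \<in> sets \<mu>" by measurable
    qed
    finally show "discretize p n -` {a} \<inter> space \<mu> \<in> sets \<mu>" .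
  qed simp
  from measurable_compose[OF this, of f borel] show ?thesis by simp
qed

lemma discretize_error:
  assumes \<sigma>: "\<And>z. \<bar>\<sigma> z\<bar> \<le> real k * growth (real k) p z"
  shows "\<bar>discretize p n \<sigma> z - \<sigma> z\<bar> \<le> (1 / (real n + 1) + real k * exp (- real n)) * growth (real k + 1) p z"
proof (cases "gdist E p z \<le> n")
  case True
  define q where "q = (real n + 1) * \<sigma> z"
  have "\<bar>discretize p n \<sigma> z - \<sigma> z\<bar> = \<bar>of_int \<lfloor>q\<rfloor> - q\<bar> / (real n + 1)"
  proof -
    have "discretize p n \<sigma> z - \<sigma> z = (of_int \<lfloor>q\<rfloor> - q) / (real n + 1)"
      using True by (simp add: discretize_def q_def diff_divide_distrib)
    then show ?thesis by simp
  qed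
  also have "\<dots> \<le> 1 / (real n + 1)"
  proof (rule divide_right_mono)
    show "\<bar>of_int \<lfloor>q\<rfloor> - q\<bar> \<le> 1" by linarith
  qed simp
  also have "\<dots> \<le> 1 / (real n + 1) + real k * exp (- real n)" by simp
  also have "\<dots> \<le> (1 / (real n + 1) + real k * exp (- real n)) * growth (real k + 1) p z"
  proof -
    have "0 \<le> 1 / (real n + 1) + real k * exp (- real n)" by simp
    from mult_left_mono[OF _ this, of 1 "growth (real k + 1) p z"] show ?thesis by simp
  qed
  finally show ?thesis .
next
  case False
  then have "real n \<le> real (gdist E p z)" by simp
  have "\<bar>discretize p n \<sigma> z - \<sigma> z\<bar> = \<bar>\<sigma> z\<bar>" using False by (simp add: discretize_def)
  also have "\<dots> \<le> real k * growth (real k) p z" by (rule \<sigma>)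
  also have "\<dots> \<le> real k * (exp (- real n) * growth (real k + 1) p z)"
    using \<open>real n \<le> real (gdist E p z)\<close> by (intro mult_left_mono) (auto simp: algebra_simps simp flip: exp_add)
  also have "\<dots> \<le> (1 / (real n + 1) + real k * exp (- real n)) * growth (real k + 1) p z"
    by (simp add: algebra_simps)
  finally show ?thesis .
qed

text \<open>Tempered configurations are approximated by their discretizations in a weighted sup-norm with a
slightly larger rate, which makes up for the truncated part, and \<open>mean_flow\<close> is Lipschitz in that norm.\<close>

lemma mean_flow_discretize:
  assumes \<sigma>: "tempered E \<sigma>" and t: "0 \<le> t"
  shows "(\<lambda>n. mean_flow t y (discretize y n \<sigma>)) \<longlonglongrightarrow> mean_flow t y \<sigma>"
proof -
  obtain k :: nat where k: "\<And>z. \<bar>\<sigma> z\<bar> \<le> real k * growth (real k) y z"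
    using \<sigma> tempered_based[of \<sigma> y] by blast
  define \<epsilon> where "\<epsilon> = (\<lambda>n. 1 / (real n + 1) + real k * exp (- real n))"
  have e: "\<bar>discretize y n \<sigma> z - \<sigma> z\<bar> \<le> \<epsilon> n * growth (real k + 1) y z" for n z
    unfolding \<epsilon>_def by (rule discretize_error[OF k])
  have e0: "0 \<le> \<epsilon> n" for n by (simp add: \<epsilon>_def)
  have temp: "tempered E (discretize y n \<sigma>)" for n
  proof -
    have "\<bar>discretize y n \<sigma> z\<bar> \<le> (\<epsilon> n + real k) * growth (real k + 1) y z" for z
    proof -
      have "real k * growth (real k) y z \<le> real k * growth (real k + 1) y z"
        by (intro mult_left_mono) (auto intro!: mult_right_mono)
      then have "\<bar>\<sigma> z\<bar> \<le> real k * growth (real k + 1) y z" using k[of z] by linarith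
      then show ?thesis using e[of n z] unfolding distrib_right by linarith
    qed
    then show ?thesis unfolding tempered_def by blast
  qed
  have b: "\<bar>mean_flow t y (discretize y n \<sigma>) - mean_flow t y \<sigma>\<bar> \<le> \<epsilon> n * exp (growth_rate (real k + 1) * t)" for n
    using e e0 by (intro mean_flow_lipschitz \<sigma> temp t) auto
  have "\<epsilon> \<longlonglongrightarrow> 0 + real k * 0"
    unfolding \<epsilon>_def
  proof (intro tendsto_intros)
    show "(\<lambda>n. 1 / (real n + 1)) \<longlonglongrightarrow> 0"
      using LIMSEQ_inverse_real_of_nat by (simp add: inverse_eq_divide add.commute)
    show "(\<lambda>n. exp (- real n)) \<longlonglongrightarrow> 0"
      by (rule filterlim_compose[OF exp_at_bot]) (simp add: filterlim_uminus_at_bot filterlim_real_sequentially)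
  qed
  then have "(\<lambda>n. \<epsilon> n * exp (growth_rate (real k + 1) * t)) \<longlonglongrightarrow> 0 * exp (growth_rate (real k + 1) * t)"
    by (intro tendsto_mult tendsto_const) simp
  then have lim: "(\<lambda>n. \<epsilon> n * exp (growth_rate (real k + 1) * t)) \<longlonglongrightarrow> 0" by simp
  have "(\<lambda>n. mean_flow t y (discretize y n \<sigma>) - mean_flow t y \<sigma>) \<longlonglongrightarrow> 0"
    using b by (intro Lim_null_comparison[OF _ lim]) auto
  then show ?thesis by (simp add: LIM_zero_iff)
qed

lemma semigroup_coord_measurable [measurable]:
  assumes t: "0 \<le> t"
  shows "semigroup_coord t y \<in> borel_measurable \<mu>"
proof (rule borel_measurable_LIMSEQ_real)
  show "(\<lambda>\<sigma>. if tempered E \<sigma> then mean_flow t y (discretize y n \<sigma>) else 0) \<in> borel_measurable \<mu>" for n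
    by (rule measurable_If[OF discretize_measurable measurable_const tempered_sets]) simp
  fix \<sigma>
  show "(\<lambda>n. if tempered E \<sigma> then mean_flow t y (discretize y n \<sigma>) else 0) \<longlonglongrightarrow> semigroup_coord t y \<sigma>"
  proof (cases "tempered E \<sigma>")
    case True
    then show ?thesis
      using mean_flow_discretize[OF True t, of y] by (simp add: semigroup_coord_tempered)
  qed (simp add: semigroup_coord_def gl_semigroup_def)
qed

lemma semigroup_coord_derivative:
  assumes \<sigma>: "tempered E \<sigma>" and t: "0 \<le> t"
  shows "((\<lambda>s. semigroup_coord t y (\<sigma>(x := s))) has_real_derivative walk_prob E N X x t y (\<sigma>(x := r))) (at r)"
proof -
  have temp: "tempered E (\<sigma>(x := s))" for s by (rule tempered_upd[OF \<sigma>])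
  interpret W: gl_walk_from E D N A U M Cm Cp B \<eta> X x "\<sigma>(x := r)"
    by unfold_locales (rule temp)
  show ?thesis
    using W.mean_flow_derivative[OF t, of y] temp
    by (simp add: semigroup_coord_tempered walk_prob_def)
qed

lemma walk_prob_bounds: "0 \<le> walk_prob E N X x t y \<sigma>" "walk_prob E N X x t y \<sigma> \<le> 1"
  by (auto simp: walk_prob_def)

lemma update_measurable:
  assumes "f \<in> borel_measurable L" "g \<in> L \<rightarrow>\<^sub>M \<mu>"
  shows "(\<lambda>\<omega>. (g \<omega>)(x := f \<omega>)) \<in> L \<rightarrow>\<^sub>M \<mu>"
proof (rule measurable_into_gibbs)
  fix z
  show "(\<lambda>\<omega>. ((g \<omega>)(x := f \<omega>)) z) \<in> borel_measurable L"
    using assms(1) measurable_compose[OF assms(2) coordinate_measurable[of z]]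
    by (cases "z = x") auto
qed

text \<open>A pointwise limit of difference quotients of the semigroup.\<close>

lemma walk_prob_measurable:
  assumes t: "0 \<le> t"
  shows "walk_prob E N X x t y \<in> borel_measurable \<mu>"
proof (rule borel_measurable_LIMSEQ_real)
  define h where "h = (\<lambda>k::nat. inverse (real (Suc k)))"
  have h: "h \<longlonglongrightarrow> 0" "\<And>k. h k \<noteq> 0" unfolding h_def using LIMSEQ_inverse_real_of_nat by auto
  let ?q = "\<lambda>k \<sigma>. if tempered E \<sigma> then (semigroup_coord t y (\<sigma>(x := \<sigma> x + h k)) - semigroup_coord t y \<sigma>) / h k else 0"
  show "?q k \<in> borel_measurable \<mu>" for k
  proof (rule measurable_If[OF _ measurable_const tempered_sets])
    have "(\<lambda>\<sigma>. \<sigma>(x := \<sigma> x + h k)) \<in> \<mu> \<rightarrow>\<^sub>M \<mu>"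
      by (rule update_measurable) auto
    from measurable_compose[OF this semigroup_coord_measurable[OF t, of y]]
    show "(\<lambda>\<sigma>. (semigroup_coord t y (\<sigma>(x := \<sigma> x + h k)) - semigroup_coord t y \<sigma>) / h k) \<in> borel_measurable \<mu>"
      using semigroup_coord_measurable[OF t, of y] by auto
  qed simp
  fix \<sigma>
  show "(\<lambda>k. ?q k \<sigma>) \<longlonglongrightarrow> walk_prob E N X x t y \<sigma>"
  proof (cases "tempered E \<sigma>")
    case True
    have "(\<lambda>h. (semigroup_coord t y (\<sigma>(x := \<sigma> x + h)) - semigroup_coord t y (\<sigma>(x := \<sigma> x))) / h) \<midarrow>0\<rightarrow> walk_prob E N X x t y (\<sigma>(x := \<sigma> x))"
      using semigroup_coord_derivative[OF True t, of y x "\<sigma> x"] unfolding DERIV_def .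
    then show ?thesis
      using h True unfolding LIMSEQ_SEQ_conv[symmetric] by simp
  qed (simp add: walk_prob_def)
qed

section \<open>The covariance\<close>

text \<open>Replacing one coordinate by an independent copy preserves a product measure; this isolates the
integral over that coordinate without splitting the index set.\<close>

lemma resample:
  "distr (pot.\<nu> x \<Otimes>\<^sub>M \<mu>) \<mu> (\<lambda>(s, \<sigma>). \<sigma>(x := s)) = \<mu>"
  using distr_pair_PiM_eq_PiM[of UNIV pot.\<nu> x] pot.prob_space_\<nu> unfolding gibbs_eq by simp

lemma resample_measurable: "(\<lambda>(s, \<sigma>). \<sigma>(x := s)) \<in> pot.\<nu> x \<Otimes>\<^sub>M \<mu> \<rightarrow>\<^sub>M \<mu>"
proof -
  have "fst \<in> borel_measurable (pot.\<nu> x \<Otimes>\<^sub>M \<mu>)"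
    using measurable_fst[of "pot.\<nu> x" \<mu>] by (simp cong: measurable_cong_sets)
  from update_measurable[OF this measurable_snd, of x] show ?thesis by (simp add: split_beta')
qed

lemma resample_integral:
  fixes f :: "('v \<Rightarrow> real) \<Rightarrow> real"
  assumes f: "integrable \<mu> f"
  shows "integrable \<mu> (\<lambda>\<sigma>. \<integral>s. f (\<sigma>(x := s)) \<partial>pot.\<nu> x)"
    and "(\<integral>\<sigma>. f \<sigma> \<partial>\<mu>) = (\<integral>\<sigma>. (\<integral>s. f (\<sigma>(x := s)) \<partial>pot.\<nu> x) \<partial>\<mu>)"
proof -
  interpret pair_prob_space "pot.\<nu> x" \<mu> ..
  have fm: "f \<in> borel_measurable \<mu>" using f by simp
  have "integrable (distr (pot.\<nu> x \<Otimes>\<^sub>M \<mu>) \<mu> (\<lambda>(s, \<sigma>). \<sigma>(x := s))) f"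
    unfolding resample by (rule f)
  then have i: "integrable (pot.\<nu> x \<Otimes>\<^sub>M \<mu>) (\<lambda>(s, \<sigma>). f (\<sigma>(x := s)))"
    by (subst (asm) integrable_distr_eq[OF resample_measurable fm]) (simp add: split_beta')
  show "integrable \<mu> (\<lambda>\<sigma>. \<integral>s. f (\<sigma>(x := s)) \<partial>pot.\<nu> x)"
    using integrable_snd[OF i] by simp
  have "(\<integral>\<sigma>. f \<sigma> \<partial>\<mu>) = (\<integral>\<sigma>. f \<sigma> \<partial>distr (pot.\<nu> x \<Otimes>\<^sub>M \<mu>) \<mu> (\<lambda>(s, \<sigma>). \<sigma>(x := s)))"
    unfolding resample ..
  also have "\<dots> = (\<integral>(s, \<sigma>). f (\<sigma>(x := s)) \<partial>(pot.\<nu> x \<Otimes>\<^sub>M \<mu>))"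
    by (subst integral_distr[OF resample_measurable fm]) (simp add: split_beta')
  also have "\<dots> = (\<integral>\<sigma>. (\<integral>s. f (\<sigma>(x := s)) \<partial>pot.\<nu> x) \<partial>\<mu>)"
    using integral_snd[OF i] by simp
  finally show "(\<integral>\<sigma>. f \<sigma> \<partial>\<mu>) = (\<integral>\<sigma>. (\<integral>s. f (\<sigma>(x := s)) \<partial>pot.\<nu> x) \<partial>\<mu>)" .
qed

lemma centred_product_integrable:
  assumes t: "0 \<le> t"
  shows "integrable \<mu> (\<lambda>\<sigma>. (\<sigma> x - M) * semigroup_coord t y \<sigma>)"
proof -
  define K where "K = \<bar>mean_flow t y (\<lambda>_. 0)\<bar>"
  define R where "R = exp (growth_rate decay * t)"
  let ?S = "\<lambda>\<sigma>. enn2real (weighted_size y \<sigma>)"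
  note [measurable] = semigroup_coord_measurable[OF t, of y]
  have fin: "AE \<sigma> in \<mu>. weighted_size y \<sigma> < top" by (rule AE_weighted_size)
  have iS: "integrable \<mu> ?S"
  proof (rule integrableI_bounded)
    have "(\<integral>\<^sup>+\<sigma>. ennreal (norm (?S \<sigma>)) \<partial>\<mu>) = (\<integral>\<^sup>+\<sigma>. weighted_size y \<sigma> \<partial>\<mu>)"
      using fin by (intro nn_integral_cong_AE) (auto elim!: eventually_mono)
    then show "(\<integral>\<^sup>+\<sigma>. ennreal (norm (?S \<sigma>)) \<partial>\<mu>) < \<infinity>"
      using weighted_size_integrable[of y] by simp
  qed measurable
  have ixS: "integrable \<mu> (\<lambda>\<sigma>. \<bar>\<sigma> x\<bar> * ?S \<sigma>)"
  proof (rule integrableI_bounded)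
    have "(\<integral>\<^sup>+\<sigma>. ennreal (norm (\<bar>\<sigma> x\<bar> * ?S \<sigma>)) \<partial>\<mu>) = (\<integral>\<^sup>+\<sigma>. ennreal \<bar>\<sigma> x\<bar> * weighted_size y \<sigma> \<partial>\<mu>)"
      using fin by (intro nn_integral_cong_AE) (auto elim!: eventually_mono simp: abs_mult ennreal_mult)
    then show "(\<integral>\<^sup>+\<sigma>. ennreal (norm (\<bar>\<sigma> x\<bar> * ?S \<sigma>)) \<partial>\<mu>) < \<infinity>"
      using weighted_size_moment[of x y] by simp
  qed measurable
  have "integrable \<mu> (\<lambda>\<sigma>. K * \<bar>\<sigma> x\<bar> + R * (\<bar>\<sigma> x\<bar> * ?S \<sigma>) + (\<bar>M\<bar> * K + \<bar>M\<bar> * R * ?S \<sigma>))"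
    using coordinate_integrable[of x] iS ixS by simp
  then show ?thesis
  proof (rule Bochner_Integration.integrable_bound)
    show "AE \<sigma> in \<mu>. norm ((\<sigma> x - M) * semigroup_coord t y \<sigma>)
       \<le> norm (K * \<bar>\<sigma> x\<bar> + R * (\<bar>\<sigma> x\<bar> * ?S \<sigma>) + (\<bar>M\<bar> * K + \<bar>M\<bar> * R * ?S \<sigma>))"
      using fin
    proof eventually_elim
      fix \<sigma> assume "weighted_size y \<sigma> < top"
      then have "\<bar>semigroup_coord t y \<sigma>\<bar> \<le> K + R * ?S \<sigma>"
        unfolding K_def R_def by (rule semigroup_coord_growth[OF t])
      moreover have "\<bar>\<sigma> x - M\<bar> \<le> \<bar>\<sigma> x\<bar> + \<bar>M\<bar>" by simp
      ultimately have "\<bar>\<sigma> x - M\<bar> * \<bar>semigroup_coord t y \<sigma>\<bar> \<le> (\<bar>\<sigma> x\<bar> + \<bar>M\<bar>) * (K + R * ?S \<sigma>)"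
        by (intro mult_mono) auto
      also have "\<dots> = K * \<bar>\<sigma> x\<bar> + R * (\<bar>\<sigma> x\<bar> * ?S \<sigma>) + (\<bar>M\<bar> * K + \<bar>M\<bar> * R * ?S \<sigma>)"
        by (simp add: algebra_simps)
      finally show "norm ((\<sigma> x - M) * semigroup_coord t y \<sigma>)
         \<le> norm (K * \<bar>\<sigma> x\<bar> + R * (\<bar>\<sigma> x\<bar> * ?S \<sigma>) + (\<bar>M\<bar> * K + \<bar>M\<bar> * R * ?S \<sigma>))"
        unfolding real_norm_def abs_mult by (rule order_trans[OF _ abs_ge_self])
    qed
  qed measurable
qed

lemma covariance_eq:
  assumes t: "0 \<le> t"
  shows "covariance \<mu> (\<lambda>\<sigma>. \<sigma> x) (semigroup_coord t y) = (\<integral>\<sigma>. (\<sigma> x - M) * semigroup_coord t y \<sigma> \<partial>\<mu>)"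
proof -
  let ?m = "\<integral>\<sigma>. semigroup_coord t y \<sigma> \<partial>\<mu>"
  have "covariance \<mu> (\<lambda>\<sigma>. \<sigma> x) (semigroup_coord t y)
      = (\<integral>\<sigma>. (\<sigma> x - M) * semigroup_coord t y \<sigma> - (\<sigma> x - M) * ?m \<partial>\<mu>)"
    by (simp add: covariance_def coordinate_mean right_diff_distrib)
  also have "\<dots> = (\<integral>\<sigma>. (\<sigma> x - M) * semigroup_coord t y \<sigma> \<partial>\<mu>) - (\<integral>\<sigma>. (\<sigma> x - M) * ?m \<partial>\<mu>)"
    using centred_product_integrable[OF t, of x y] coordinate_integrable[of x] by simp
  also have "(\<integral>\<sigma>. (\<sigma> x - M) * ?m \<partial>\<mu>) = 0"
    using coordinate_integrable[of x] coordinate_mean[of x] \<mu>.prob_space by simp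
  finally show ?thesis by simp
qed

text \<open>\<open>covariance_sandwich\<close> for the coordinate at \<open>x\<close>, averaged over the other coordinates.\<close>

lemma covariance_walk_bounds:
  assumes t: "0 \<le> t"
  shows "1 / Cp * (\<integral>\<sigma>. walk_prob E N X x t y \<sigma> \<partial>\<mu>) \<le> covariance \<mu> (\<lambda>\<sigma>. \<sigma> x) (semigroup_coord t y)"
    and "covariance \<mu> (\<lambda>\<sigma>. \<sigma> x) (semigroup_coord t y) \<le> 1 / Cm * (\<integral>\<sigma>. walk_prob E N X x t y \<sigma> \<partial>\<mu>)"
proof -
  let ?W = "walk_prob E N X x t y"
  let ?G = "\<lambda>\<sigma>. (\<sigma> x - M) * semigroup_coord t y \<sigma>"
  let ?IW = "\<lambda>\<sigma>. \<integral>s. ?W (\<sigma>(x := s)) \<partial>pot.\<nu> x"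
  let ?IG = "\<lambda>\<sigma>. \<integral>s. ?G (\<sigma>(x := s)) \<partial>pot.\<nu> x"
  have iW: "integrable \<mu> ?W"
    using walk_prob_bounds[of x t y]
    by (intro \<mu>.integrable_const_bound[of _ 1] walk_prob_measurable[OF t] AE_I2) auto
  note iG = centred_product_integrable[OF t, of x y]
  note RW = resample_integral[OF iW, of x] and RG = resample_integral[OF iG, of x]
  have sandwich: "1 / Cp * ?IW \<sigma> \<le> ?IG \<sigma>" "?IG \<sigma> \<le> 1 / Cm * ?IW \<sigma>" if \<sigma>: "tempered E \<sigma>" for \<sigma>
  proof -
    let ?f = "\<lambda>s. semigroup_coord t y (\<sigma>(x := s))" and ?p = "\<lambda>s. ?W (\<sigma>(x := s))"
    have "(\<lambda>s. \<sigma>(x := s)) \<in> borel \<rightarrow>\<^sub>M \<mu>"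
      by (rule update_measurable) auto
    then have p: "?p \<in> borel_measurable borel"
      by (rule measurable_compose[OF _ walk_prob_measurable[OF t]])
    have "1 / Cp * integral\<^sup>L (pot.\<nu> x) ?p \<le> (\<integral>s. (s - M) * ?f s \<partial>pot.\<nu> x)"
      "(\<integral>s. (s - M) * ?f s \<partial>pot.\<nu> x) \<le> 1 / Cm * integral\<^sup>L (pot.\<nu> x) ?p"
      using pot.covariance_sandwich[of ?f ?p x, OF semigroup_coord_derivative[OF \<sigma> t] _ p] walk_prob_bounds
      by auto
    then show "1 / Cp * ?IW \<sigma> \<le> ?IG \<sigma>" "?IG \<sigma> \<le> 1 / Cm * ?IW \<sigma>" by simp_all
  qed
  have "1 / Cp * (\<integral>\<sigma>. ?W \<sigma> \<partial>\<mu>) = (\<integral>\<sigma>. 1 / Cp * ?IW \<sigma> \<partial>\<mu>)"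
    unfolding RW(2) by simp
  also have "\<dots> \<le> (\<integral>\<sigma>. ?IG \<sigma> \<partial>\<mu>)"
    using AE_tempered sandwich RW(1) RG(1)
    by (intro integral_mono_AE integrable_mult_right) (auto elim!: eventually_mono)
  also have "\<dots> = covariance \<mu> (\<lambda>\<sigma>. \<sigma> x) (semigroup_coord t y)"
    unfolding covariance_eq[OF t] RG(2) ..
  finally show "1 / Cp * (\<integral>\<sigma>. ?W \<sigma> \<partial>\<mu>) \<le> covariance \<mu> (\<lambda>\<sigma>. \<sigma> x) (semigroup_coord t y)" .
  have "covariance \<mu> (\<lambda>\<sigma>. \<sigma> x) (semigroup_coord t y) = (\<integral>\<sigma>. ?IG \<sigma> \<partial>\<mu>)"
    unfolding covariance_eq[OF t] RG(2) ..
  also have "\<dots> \<le> (\<integral>\<sigma>. 1 / Cm * ?IW \<sigma> \<partial>\<mu>)"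
    using AE_tempered sandwich RW(1) RG(1)
    by (intro integral_mono_AE integrable_mult_right) (auto elim!: eventually_mono)
  also have "\<dots> = 1 / Cm * (\<integral>\<sigma>. ?W \<sigma> \<partial>\<mu>)"
    unfolding RW(2) by simp
  finally show "covariance \<mu> (\<lambda>\<sigma>. \<sigma> x) (semigroup_coord t y) \<le> 1 / Cm * (\<integral>\<sigma>. ?W \<sigma> \<partial>\<mu>)" .
qed

end


theorem theorem2p1:
  fixes E :: "'v set set"
    and A :: "('v \<times> 'v) set"
    and U :: "'v \<Rightarrow> real \<Rightarrow> real"
    and M Cm Cp :: real
    and N :: "'w measure"
    and B :: "'v \<times> 'v \<Rightarrow> real \<Rightarrow> 'w \<Rightarrow> real"
    and \<eta> :: "('v \<Rightarrow> real) \<Rightarrow> real \<Rightarrow> 'w \<Rightarrow> 'v \<Rightarrow> real"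
    and X :: "'v \<Rightarrow> ('v \<Rightarrow> real) \<Rightarrow> real \<Rightarrow> 'w \<Rightarrow> 'v"
    and x y :: 'v and t :: real
  assumes graph: "simple_graph E" "infinite (UNIV :: 'v set)" "connected_graph E" "bounded_degree E"
    and orient: "orientation E A"
    and normalized: "\<And>x. has_bochner_integral lborel (\<lambda>s. exp (- U x s)) 1"
    and mean: "\<And>x. has_bochner_integral lborel (\<lambda>s. s * exp (- U x s)) M"
    and smooth: "\<And>x. C2_fun (U x)"
    and constants: "0 < Cm" "Cm \<le> Cp"
    and bounds: "\<And>x s. Cm \<le> deriv (deriv (U x)) s \<and> deriv (deriv (U x)) s \<le> Cp"
    and prob: "prob_space N"
    and noise: "independent_BMs N A B"
    and process: "\<And>\<sigma>. tempered E \<sigma> \<Longrightarrow> gl_process E A U N B \<sigma> (\<eta> \<sigma>)"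
    and walk: "\<And>x \<sigma>. tempered E \<sigma> \<Longrightarrow> walk_in_env E U N (\<eta> \<sigma>) x (X x \<sigma>)"
    and time: "0 \<le> t"
  shows "1 / Cp * (\<integral>\<sigma>. walk_prob E N X x t y \<sigma> \<partial>gibbs U)
           \<le> covariance (gibbs U) (\<lambda>\<sigma>. \<sigma> x) (gl_semigroup E N \<eta> t (\<lambda>\<sigma>. \<sigma> y))
       \<and> covariance (gibbs U) (\<lambda>\<sigma>. \<sigma> x) (gl_semigroup E N \<eta> t (\<lambda>\<sigma>. \<sigma> y))
           \<le> 1 / Cm * (\<integral>\<sigma>. walk_prob E N X x t y \<sigma> \<partial>gibbs U)"
proof -
  obtain D where D: "\<And>z. finite (nbrs E z)" "\<And>z. card (nbrs E z) \<le> D"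
    using graph(4) by (auto simp: bounded_degree_def)
  interpret prob_space N by (rule prob)
  interpret bounded_graph E D
    by unfold_locales (fact graph(1) graph(3) D)+
  interpret gl_system E D N A U M Cm Cp B \<eta>
    by unfold_locales (fact orient normalized mean smooth constants bounds noise process)+
  interpret gl_walk E D N A U M Cm Cp B \<eta> X
    by unfold_locales (fact walk)
  show ?thesis
    using covariance_walk_bounds[OF time, of x y] by (simp add: semigroup_coord_def)
qed

end
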